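(* Let $k>2$, $m(v)=\langle v\rangle^k$, and let $B$ be a collision kernel satisfying: $B(v-v_*,\sigma)=|v-v_*|^\gamma\, b(\cos\theta)$ with $\gamma\in(0,1)$, where $b$ is locally smooth, supported in $0\le\theta\le\pi/2$, and for some $c_b>0$ and $s\in(0,1/2)$, $\frac{c_b}{\theta^{1+2s}}\le \sin\theta\, b(\cos\theta)\le\frac{1}{c_b\,\theta^{1+2s}}$ for all $\theta\in(0,\pi/2]$. Then there exists a constant $C>0$ such that, for all $h$ for which the right-hand side is finite, $$\|Q(h,h)\|_{L^1(m)}\le C\Big(\|h\|_{L^1(\langle v\rangle^\gamma m)}\,\|h\|_{L^1(m)}+\|h\|_{L^1(\langle v\rangle^{\gamma+1})}\,\|h\|_{W^{1,1}(\langle v\rangle^{\gamma+1}m)}\Big).$$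
   Context: Functions are defined on $\mathbb{R}^3$; $\langle v\rangle=(1+|v|^2)^{1/2}$; $\|h\|_{L^p(w)}=\|h\,w\|_{L^p}$ and $\|h\|_{W^{N,p}(w)}=\big(\sum_{|\alpha|\le N}\|\partial^\alpha h\|_{L^p(w)}^p\big)^{1/p}$ for a weight $w\ge0$. Collision operator: $$Q(g,f)(v)=\int_{\mathbb{R}^3\times\mathbb{S}^2}B(v-v_*,\sigma)\,[g'_*f'-g_*f]\,d\sigma\,dv_*,$$ with $f=f(v)$, $g_*=g(v_* )$, $f'=f(v')$, $g'_*=g(v'_* )$, $v'=\frac{v+v_*}{2}+\frac{|v-v_*|}{2}\sigma$, $v'_*=\frac{v+v_*}{2}-\frac{|v-v_*|}{2}\sigma$, $\sigma\in\mathbb{S}^2$, $\cos\theta=\langle\kappa,\sigma\rangle$, $\kappa=(v-v_* )/|v-v_*|$. *)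

theory Defs
  imports "HOL-Analysis.Analysis"
begin

definition jb :: "real^3 \<Rightarrow> real" where
  "jb v = sqrt (1 + (norm v)\<^sup>2)"

definition L1_norm :: "(real^3 \<Rightarrow> real) \<Rightarrow> (real^3 \<Rightarrow> real) \<Rightarrow> ennreal" where
  "L1_norm w h = (\<integral>\<^sup>+ v. ennreal \<bar>h v * w v\<bar> \<partial>lborel)"

definition partial_deriv :: "3 \<Rightarrow> (real^3 \<Rightarrow> real) \<Rightarrow> real^3 \<Rightarrow> real" where
  "partial_deriv i \<phi> x = frechet_derivative \<phi> (at x) (axis i 1)"

text \<open>Infinitely differentiable with compact support: the list \<open>js\<close> ranges over all iterated
  partial derivatives, in any order; differentiability of all of them gives their continuity.\<close>

definition test_function :: "(real^3 \<Rightarrow> real) \<Rightarrow> bool" where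
  "test_function \<phi> \<longleftrightarrow>
     (\<forall>js. foldr partial_deriv js \<phi> differentiable_on UNIV) \<and> compact (closure {x. \<phi> x \<noteq> 0})"

definition locally_integrable :: "(real^3 \<Rightarrow> real) \<Rightarrow> bool" where
  "locally_integrable h \<longleftrightarrow>
     h \<in> borel_measurable lborel \<and> (\<forall>K. compact K \<longrightarrow> set_integrable lborel K h)"

definition is_weak_partial :: "3 \<Rightarrow> (real^3 \<Rightarrow> real) \<Rightarrow> (real^3 \<Rightarrow> real) \<Rightarrow> bool" where
  "is_weak_partial i h g \<longleftrightarrow> locally_integrable h \<and> locally_integrable g \<and>
     (\<forall>\<phi>. test_function \<phi> \<longrightarrow>
        (\<integral>x. h x * partial_deriv i \<phi> x \<partial>lborel) = - (\<integral>x. g x * \<phi> x \<partial>lborel))"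

text \<open>Weak derivatives are unique up to null sets, so the choice of representative does not
  affect the norm below.\<close>

definition weak_partial :: "3 \<Rightarrow> (real^3 \<Rightarrow> real) \<Rightarrow> real^3 \<Rightarrow> real" where
  "weak_partial i h = (SOME g. is_weak_partial i h g)"

text \<open>The sum runs over the multi-indices of order at most one; the norm is infinite if some
  first-order distributional derivative is not a locally integrable function.\<close>

definition W11_norm :: "(real^3 \<Rightarrow> real) \<Rightarrow> (real^3 \<Rightarrow> real) \<Rightarrow> ennreal" where
  "W11_norm w h =
     (if \<forall>i. \<exists>g. is_weak_partial i h g
      then L1_norm w h + (\<Sum>i\<in>UNIV. L1_norm w (weak_partial i h))
      else \<infinity>)"

text \<open>Surface measure on the unit sphere: the measure of a set \<open>A\<close> is three times the volume of the
  cone \<open>{r *\<^sub>R x | x \<in> A, 0 < r < 1}\<close> (as in integration in polar coordinates);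
  \<open>sgn x\<close> is \<open>x /\<^sub>R norm x\<close>. The total mass is computed below to confirm the normalisation.\<close>

definition sphere_measure :: "(real^3) measure" where
  "sphere_measure =
     scale_measure 3
       (distr (restrict_space lborel (ball 0 1 - {0})) (restrict_space borel (sphere 0 1)) sgn)"

lemma space_sphere_measure: "space sphere_measure = sphere 0 1"
  by (simp add: sphere_measure_def space_restrict_space space_scale_measure)

lemma sets_sphere_measure: "sets sphere_measure = sets (restrict_space borel (sphere 0 1))"
  by (simp add: sphere_measure_def)

lemma sgn_measurable_sphere:
  "sgn \<in> restrict_space lborel (ball 0 1 - {0}) \<rightarrow>\<^sub>M restrict_space borel (sphere 0 (1::real) :: (real^3) set)"
proof (rule measurable_restrict_space2)
  show "sgn \<in> space (restrict_space lborel (ball 0 1 - {0})) \<rightarrow> (sphere 0 1 :: (real^3) set)"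
    by (auto simp: space_restrict_space norm_sgn)
  have "(\<lambda>x::real^3. x /\<^sub>R norm x) \<in> borel_measurable borel"
    by measurable
  then have "(sgn :: real^3 \<Rightarrow> real^3) \<in> borel_measurable lborel"
    by (simp add: sgn_div_norm[abs_def])
  then show "(sgn :: real^3 \<Rightarrow> real^3) \<in> borel_measurable (restrict_space lborel (ball 0 1 - {0}))"
    by (rule measurable_restrict_space1)
qed

lemma emeasure_sphere_measure:
  "emeasure sphere_measure (sphere 0 1) = ennreal (4 * pi)"
proof -
  let ?R = "restrict_space lborel (ball 0 1 - {0}) :: (real^3) measure"
  have "emeasure sphere_measure (sphere 0 1) = 3 * emeasure ?R (space ?R)"
  proof -
    have "sphere 0 1 \<in> sets (restrict_space borel (sphere 0 1 :: (real^3) set))"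
      by (simp add: sets_restrict_space_iff)
    moreover have "sgn -` sphere 0 1 \<inter> space ?R = space ?R"
      by (auto simp: space_restrict_space norm_sgn)
    ultimately show ?thesis
      by (simp add: sphere_measure_def emeasure_distr[OF sgn_measurable_sphere])
  qed
  also have "emeasure ?R (space ?R) = emeasure lborel (ball 0 1 - {0} :: (real^3) set)"
    by (simp add: space_restrict_space emeasure_restrict_space)
  also have "\<dots> = emeasure lborel (ball 0 1 :: (real^3) set)"
    by (rule emeasure_Diff_null_set) auto
  also have "\<dots> = ennreal (4 / 3 * pi)"
    using emeasure_ball[of 1 "0::real^3"] unit_ball_vol_3 by simp
  also have "3 * \<dots> = ennreal (4 * pi)"
    by (simp flip: ennreal_numeral ennreal_mult')
  finally show ?thesis .
qed

text \<open>With \<open>z = v - v\<^sub>*\<close>, the unit vector \<open>\<kappa>\<close> is \<open>sgn z\<close>. For \<open>z = 0\<close> the kernel is \<open>0\<close> when \<open>\<gamma> > 0\<close>.\<close>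

definition collision_kernel :: "real \<Rightarrow> (real \<Rightarrow> real) \<Rightarrow> real^3 \<Rightarrow> real^3 \<Rightarrow> real" where
  "collision_kernel \<gamma> b z \<sigma> = norm z powr \<gamma> * b (sgn z \<bullet> \<sigma>)"

definition post_v :: "real^3 \<Rightarrow> real^3 \<Rightarrow> real^3 \<Rightarrow> real^3" where
  "post_v v vs \<sigma> = (v + vs) /\<^sub>R 2 + (norm (v - vs) / 2) *\<^sub>R \<sigma>"

definition post_vs :: "real^3 \<Rightarrow> real^3 \<Rightarrow> real^3 \<Rightarrow> real^3" where
  "post_vs v vs \<sigma> = (v + vs) /\<^sub>R 2 - (norm (v - vs) / 2) *\<^sub>R \<sigma>"

definition collision_integrand ::
  "(real^3 \<Rightarrow> real^3 \<Rightarrow> real) \<Rightarrow> (real^3 \<Rightarrow> real) \<Rightarrow> (real^3 \<Rightarrow> real) \<Rightarrow> real^3 \<Rightarrow> (real^3) \<times> (real^3) \<Rightarrow> real" where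
  "collision_integrand B g f v =
     (\<lambda>(vs, \<sigma>). B (v - vs) \<sigma> * (g (post_vs v vs \<sigma>) * f (post_v v vs \<sigma>) - g vs * f v))"

text \<open>The integrand is signed and the kernel is not integrable in \<open>\<sigma>\<close>, so the value is meaningful
  only where \<open>collision_integrable\<close> holds; elsewhere the Bochner integral is \<open>0\<close> by convention.\<close>

definition collision_integrable ::
  "(real^3 \<Rightarrow> real^3 \<Rightarrow> real) \<Rightarrow> (real^3 \<Rightarrow> real) \<Rightarrow> (real^3 \<Rightarrow> real) \<Rightarrow> real^3 \<Rightarrow> bool" where
  "collision_integrable B g f v \<longleftrightarrow>
     integrable (lborel \<Otimes>\<^sub>M sphere_measure) (collision_integrand B g f v)"

definition collision_Q ::
  "(real^3 \<Rightarrow> real^3 \<Rightarrow> real) \<Rightarrow> (real^3 \<Rightarrow> real) \<Rightarrow> (real^3 \<Rightarrow> real) \<Rightarrow> real^3 \<Rightarrow> real" where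
  "collision_Q B g f v = integral\<^sup>L (lborel \<Otimes>\<^sub>M sphere_measure) (collision_integrand B g f v)"

end

theory Submission
  imports Defs
begin

text \<open>Write \<open>h'\<close>, \<open>h\<^sub>*\<close>, \<open>h'\<^sub>*\<close> for the values of \<open>h\<close> at the velocities \<open>v'\<close>, \<open>v\<^sub>*\<close>, \<open>v'\<^sub>*\<close>,
put \<open>z = v - v\<^sub>*\<close>, \<open>u = cos \<theta>\<close> and \<open>F = h m\<close>. The angular kernel is of size \<open>(1 - u) powr (- 1 - s)\<close>: it is not
integrable over the sphere, but it becomes integrable when multiplied by the deflection
\<open>\<bar>v' - v\<bar> = \<bar>z\<bar> sqrt ((1 - u) / 2)\<close>, because \<open>s < 1/2\<close>. So one order of cancellation has to be found in

  \<open>m (h'\<^sub>* h' - h\<^sub>* h) = h'\<^sub>* h' (m - m') + h'\<^sub>* (F' - F) + F (h'\<^sub>* - h\<^sub>*)\<close>.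

The first two terms are estimated with absolute values inside the integral. Exchanging pre- and post-collisional
velocities preserves the measure \<open>B dv dv\<^sub>* d\<sigma>\<close> (\<open>pre_post_collisional\<close>) and turns them into
\<open>h\<^sub>* h (m' - m)\<close> and \<open>h\<^sub>* (F - F')\<close>. In the first one the mean value theorem for \<open>m\<close> gives the deflection, and the
weights that appear are shared between \<open>h\<close> and \<open>h\<^sub>*\<close> (\<open>weight_commutator_bound\<close>). In the second one \<open>F' - F\<close> is the
integral of \<open>\<nabla>F\<close> along the segment from \<open>v\<close> to \<open>v'\<close>; at fixed \<open>v\<^sub>*\<close> and \<open>\<sigma>\<close> the map from \<open>v\<close> to a point of that segment is
injective with Jacobian at least \<open>1/8\<close> on the support \<open>\<theta> \<le> \<pi>/2\<close> of the kernel (\<open>nn_integral_tilt_le\<close>), so this term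
is controlled by the weighted norms of \<open>h\<close> and of \<open>\<nabla>F\<close> (\<open>kern_difference\<close>, \<open>gradient_term_bound\<close>). For a weakly
differentiable \<open>F\<close> the bound is first proved for its mollifications and passes to the limit by Fatou's lemma.

In the third term the same argument would put the derivative on \<open>h\<^sub>*\<close> and the large weight on \<open>h\<close>, a product which the
right-hand side does not control. That argument serves to show that the third term is integrable in
\<open>(v\<^sub>*, \<sigma>)\<close> (\<open>cancellation_term\<close>); the size of its integral comes from the
cancellation lemma (\<open>cancellation\<close>): at fixed \<open>\<sigma>\<close> the change of variable from \<open>v\<^sub>*\<close> to \<open>v'\<^sub>*\<close> halves the angle to
\<open>\<sigma>\<close>, and the gain and loss parts of \<open>\<integral>\<integral> B (h'\<^sub>* - h\<^sub>*)\<close> become multiples of the same integral of \<open>\<bar>v - v\<^sub>*\<bar> powr \<gamma>\<close> times \<open>h\<^sub>*\<close>, with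
angular masses that differ by a finite amount.

The angular integrals are reduced to one variable by Archimedes' theorem (\<open>nn_integral_sph_inner\<close>): the
component of \<open>\<sigma>\<close> along a fixed axis is uniformly distributed. The exchange of velocities is the exchange of the
directions of \<open>z\<close> and \<open>v' - v'\<^sub>*\<close>, and is read off from polar coordinates (\<open>nn_integral_polar\<close>).\<close>

section \<open>The surface measure and polar coordinates\<close>

lemma sgn_borel_measurable [measurable]: "(sgn :: real^3 \<Rightarrow> real^3) \<in> borel_measurable borel"
  unfolding sgn_div_norm[abs_def] by measurable

text \<open>The surface measure, transported to the Borel sets of the whole space: this way the
  integrands below, which are Borel functions of all their arguments, need no restriction.\<close>

definition sph :: "(real^3) measure" where
  "sph = distr sphere_measure borel (\<lambda>x. x)"

lemma measurable_sphere_id: "(\<lambda>x. x) \<in> sphere_measure \<rightarrow>\<^sub>M borel"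
  by (simp add: measurable_cong_sets[OF sets_sphere_measure refl] measurable_restrict_space1)

lemma sets_sph [measurable_cong, simp]: "sets sph = sets borel"
  and space_sph [simp]: "space sph = UNIV"
  by (simp_all add: sph_def)

interpretation sphere: finite_measure sphere_measure
  by standard (simp add: space_sphere_measure emeasure_sphere_measure)

interpretation sph: finite_measure sph
  unfolding sph_def by (rule sphere.finite_measure_distr[OF measurable_sphere_id])

lemma emeasure_sph: "emeasure sph UNIV = ennreal (4 * pi)"
proof -
  have "emeasure sph UNIV = emeasure sphere_measure (space sphere_measure)"
    by (simp add: sph_def emeasure_distr[OF measurable_sphere_id])
  then show ?thesis by (simp add: space_sphere_measure emeasure_sphere_measure)
qed

lemma AE_sph_norm: "AE \<sigma> in sph. norm \<sigma> = 1"
  unfolding sph_def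
  by (subst AE_distr_iff[OF measurable_sphere_id])
     (auto simp: space_sphere_measure intro!: AE_I2)

lemma nn_integral_sph:
  assumes f [measurable]: "f \<in> borel_measurable borel"
  shows "(\<integral>\<^sup>+\<sigma>. f \<sigma> \<partial>sph) = 3 * (\<integral>\<^sup>+x. f (sgn x) * indicator (ball 0 1 - {0}) x \<partial>lborel)"
proof -
  have f': "f \<in> borel_measurable (restrict_space borel (sphere 0 1))"
    by (rule measurable_restrict_space1[OF f])
  have "(\<integral>\<^sup>+\<sigma>. f \<sigma> \<partial>sph) = (\<integral>\<^sup>+\<sigma>. f \<sigma> \<partial>sphere_measure)"
    unfolding sph_def by (rule nn_integral_distr[OF measurable_sphere_id]) simp
  then show ?thesis
    unfolding sphere_measure_def
    by (simp add: nn_integral_scale_measure f' nn_integral_distr[OF sgn_measurable_sphere]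
        nn_integral_restrict_space)
qed

lemma nn_integral_lborel_scale:
  fixes f :: "'a::euclidean_space \<Rightarrow> ennreal"
  assumes [measurable]: "f \<in> borel_measurable borel" and c: "c > 0"
  shows "ennreal (c ^ DIM('a)) * (\<integral>\<^sup>+x. f (c *\<^sub>R x) \<partial>lborel) = (\<integral>\<^sup>+x. f x \<partial>lborel)"
proof -
  have "(\<integral>\<^sup>+x. f x \<partial>lborel) = (\<integral>\<^sup>+x. f x \<partial>density (distr lborel borel (\<lambda>x::'a. 0 + c *\<^sub>R x)) (\<lambda>_. \<bar>c\<bar> ^ DIM('a)))"
    using c by (subst lborel_affine[of c 0]) auto
  also have "\<dots> = ennreal (c ^ DIM('a)) * (\<integral>\<^sup>+x. f (c *\<^sub>R x) \<partial>lborel)"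
    using c by (simp add: nn_integral_density nn_integral_distr nn_integral_cmult)
  finally show ?thesis by simp
qed

lemma nn_integral_shift:
  fixes g :: "'a::euclidean_space \<Rightarrow> ennreal"
  assumes [measurable]: "g \<in> borel_measurable borel"
  shows "(\<integral>\<^sup>+x. g (c + x) \<partial>lborel) = (\<integral>\<^sup>+x. g x \<partial>lborel)"
proof -
  have "(\<integral>\<^sup>+x. g x \<partial>lborel) = (\<integral>\<^sup>+x. g x \<partial>distr lborel borel ((+) c))" by (simp add: lborel_distr_plus)
  also have "\<dots> = (\<integral>\<^sup>+x. g (c + x) \<partial>lborel)" by (rule nn_integral_distr) measurable
  finally show ?thesis by simp
qed

lemma nn_integral_inverse_power4:
  fixes a :: real
  assumes "a > 0"
  shows "(\<integral>\<^sup>+\<rho>. ennreal (3 / \<rho> ^ 4) * indicator {a<..} \<rho> \<partial>lborel) = ennreal (1 / a ^ 3)"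
proof -
  have "(\<integral>\<^sup>+\<rho>. ennreal (3 / \<rho> ^ 4) * indicator {a<..} \<rho> \<partial>lborel)
      = (\<integral>\<^sup>+\<rho>. ennreal (3 / \<rho> ^ 4) * indicator {a..} \<rho> \<partial>lborel)"
    by (rule nn_integral_cong_AE, rule AE_mp[OF AE_lborel_singleton[of a]], rule AE_I2)
       (auto simp: indicator_def)
  also have "\<dots> = 0 - (- 1 / a ^ 3)"
  proof (rule nn_integral_FTC_atLeast)
    fix x assume "a \<le> x"
    with assms have x: "x > 0" by simp
    show "((\<lambda>x. - 1 / x ^ 3) has_real_derivative 3 / x ^ 4) (at x)"
      using x by (auto intro!: derivative_eq_intros simp: field_simps power_numeral_reduce)
    show "0 \<le> 3 / x ^ 4" using x by simp
  next
    show "((\<lambda>x::real. - 1 / x ^ 3) \<longlongrightarrow> 0) at_top"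
      by (intro tendsto_divide_0[OF tendsto_const] filterlim_at_top_imp_at_infinity
          filterlim_pow_at_top filterlim_ident) auto
  qed auto
  finally show ?thesis by simp
qed

text \<open>Insert the definition of the surface measure by cones, substitute \<open>r = \<rho> \<bar>x\<bar>\<close> in the radial integral, exchange the
integrals and scale \<open>x\<close> by \<open>\<rho>\<close>: what remains is the integral of \<open>f(x) \<bar>x\<bar>\<^sup>3\<close> times the integral of \<open>3 / \<rho>\<^sup>4\<close> over
\<open>\<rho> > \<bar>x\<bar>\<close>, and the latter is \<open>1 / \<bar>x\<bar>\<^sup>3\<close>.\<close>

lemma nn_integral_polar:
  fixes f :: "real^3 \<Rightarrow> ennreal"
  assumes [measurable]: "f \<in> borel_measurable borel"
  shows "(\<integral>\<^sup>+x. f x \<partial>lborel)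
    = (\<integral>\<^sup>+r. ennreal (r\<^sup>2) * indicator {0<..} r * (\<integral>\<^sup>+\<sigma>. f (r *\<^sub>R \<sigma>) \<partial>sph) \<partial>lborel)"
proof -
  let ?B = "ball 0 1 - {0} :: (real^3) set"
  have [measurable]: "?B \<in> sets borel" by simp
  have "(\<integral>\<^sup>+r. ennreal (r\<^sup>2) * indicator {0<..} r * (\<integral>\<^sup>+\<sigma>. f (r *\<^sub>R \<sigma>) \<partial>sph) \<partial>lborel)
    = (\<integral>\<^sup>+r. (\<integral>\<^sup>+x. 3 * (ennreal (r\<^sup>2) * indicator {0<..} r * f (r *\<^sub>R sgn x)) * indicator ?B x \<partial>lborel) \<partial>lborel)"
  proof (rule nn_integral_cong)
    fix r :: real
    have "(\<integral>\<^sup>+x. 3 * (ennreal (r\<^sup>2) * indicator {0<..} r * f (r *\<^sub>R sgn x)) * indicator ?B x \<partial>lborel)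
      = (\<integral>\<^sup>+x. (3 * (ennreal (r\<^sup>2) * indicator {0<..} r)) * (f (r *\<^sub>R sgn x) * indicator ?B x) \<partial>lborel)"
      by (simp only: mult.assoc)
    also have "\<dots> = (3 * (ennreal (r\<^sup>2) * indicator {0<..} r)) * (\<integral>\<^sup>+x. f (r *\<^sub>R sgn x) * indicator ?B x \<partial>lborel)"
      by (rule nn_integral_cmult) measurable
    finally show "ennreal (r\<^sup>2) * indicator {0<..} r * (\<integral>\<^sup>+\<sigma>. f (r *\<^sub>R \<sigma>) \<partial>sph)
      = (\<integral>\<^sup>+x. 3 * (ennreal (r\<^sup>2) * indicator {0<..} r * f (r *\<^sub>R sgn x)) * indicator ?B x \<partial>lborel)"
      by (subst nn_integral_sph) (simp_all add: mult.assoc mult.left_commute[of _ 3])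
  qed
  also have "\<dots> = (\<integral>\<^sup>+x. (\<integral>\<^sup>+r. 3 * (ennreal (r\<^sup>2) * indicator {0<..} r * f (r *\<^sub>R sgn x)) * indicator ?B x \<partial>lborel) \<partial>lborel)"
    by (rule lborel_pair.Fubini') measurable
  also have "\<dots> = (\<integral>\<^sup>+x. (\<integral>\<^sup>+r. 3 * (ennreal (norm x ^ 3 * r\<^sup>2) * indicator {0<..} r * f (r *\<^sub>R x)) * indicator ?B x \<partial>lborel) \<partial>lborel)"
  proof (rule nn_integral_cong)
    fix x :: "real^3"
    show "(\<integral>\<^sup>+r. 3 * (ennreal (r\<^sup>2) * indicator {0<..} r * f (r *\<^sub>R sgn x)) * indicator ?B x \<partial>lborel)
        = (\<integral>\<^sup>+r. 3 * (ennreal (norm x ^ 3 * r\<^sup>2) * indicator {0<..} r * f (r *\<^sub>R x)) * indicator ?B x \<partial>lborel)"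
    proof (cases "x = 0")
      case False
      then have n: "norm x > 0" by simp
      have "(\<integral>\<^sup>+r. 3 * (ennreal (r\<^sup>2) * indicator {0<..} r * f (r *\<^sub>R sgn x)) * indicator ?B x \<partial>lborel)
        = ennreal (norm x) * (\<integral>\<^sup>+r. 3 * (ennreal ((norm x * r)\<^sup>2) * indicator {0<..} (norm x * r) * f ((norm x * r) *\<^sub>R sgn x)) * indicator ?B x \<partial>lborel)"
        using nn_integral_lborel_scale[of "\<lambda>r. 3 * (ennreal (r\<^sup>2) * indicator {0<..} r * f (r *\<^sub>R sgn x)) * indicator ?B x" "norm x"] n
        by simp
      also have "\<dots> = (\<integral>\<^sup>+r. 3 * (ennreal (norm x ^ 3 * r\<^sup>2) * indicator {0<..} r * f (r *\<^sub>R x)) * indicator ?B x \<partial>lborel)"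
      proof (subst nn_integral_cmult[symmetric], measurable, rule nn_integral_cong)
        fix r :: real
        have 1: "(norm x * r) *\<^sub>R sgn x = r *\<^sub>R x" using n by (simp add: sgn_div_norm)
        have 2: "ennreal (norm x) * ennreal ((norm x * r)\<^sup>2) = ennreal (norm x ^ 3 * r\<^sup>2)"
          by (simp add: ennreal_mult'[symmetric] power2_eq_square power3_eq_cube ac_simps)
        have 3: "indicator {0<..} (norm x * r) = (indicator {0<..} r :: ennreal)"
          using n by (auto simp: indicator_def zero_less_mult_iff)
        have "ennreal (norm x) * (3 * (ennreal ((norm x * r)\<^sup>2) * indicator {0<..} (norm x * r) * f ((norm x * r) *\<^sub>R sgn x)) * indicator ?B x)
          = 3 * ((ennreal (norm x) * ennreal ((norm x * r)\<^sup>2)) * indicator {0<..} (norm x * r) * f ((norm x * r) *\<^sub>R sgn x)) * indicator ?B x"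
          by (simp only: ac_simps)
        then show "ennreal (norm x) * (3 * (ennreal ((norm x * r)\<^sup>2) * indicator {0<..} (norm x * r) * f ((norm x * r) *\<^sub>R sgn x)) * indicator ?B x)
           = 3 * (ennreal (norm x ^ 3 * r\<^sup>2) * indicator {0<..} r * f (r *\<^sub>R x)) * indicator ?B x"
          unfolding 1 2 3 .
      qed
      finally show ?thesis .
    qed simp
  qed
  also have "\<dots> = (\<integral>\<^sup>+r. (\<integral>\<^sup>+x. 3 * (ennreal (norm x ^ 3 * r\<^sup>2) * indicator {0<..} r * f (r *\<^sub>R x)) * indicator ?B x \<partial>lborel) \<partial>lborel)"
    by (rule lborel_pair.Fubini') measurable
  also have "\<dots> = (\<integral>\<^sup>+r. (\<integral>\<^sup>+x. ennreal (3 / r ^ 4) * (if norm x < r then 1 else 0) * (ennreal (norm x ^ 3) * f x * indicator (-{0}) x) \<partial>lborel) \<partial>lborel)"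
  proof (rule nn_integral_cong)
    fix r :: real
    show "(\<integral>\<^sup>+x. 3 * (ennreal (norm x ^ 3 * r\<^sup>2) * indicator {0<..} r * f (r *\<^sub>R x)) * indicator ?B x \<partial>lborel)
      = (\<integral>\<^sup>+x. ennreal (3 / r ^ 4) * (if norm x < r then 1 else 0) * (ennreal (norm x ^ 3) * f x * indicator (-{0}) x) \<partial>lborel)"
    proof (cases "r > 0")
      case r: True
      have "(\<integral>\<^sup>+x. ennreal (3 / r ^ 4) * (if norm x < r then 1 else 0) * (ennreal (norm x ^ 3) * f x * indicator (-{0}) x) \<partial>lborel)
        = ennreal (r ^ 3) * (\<integral>\<^sup>+x. ennreal (3 / r ^ 4) * (if norm (r *\<^sub>R x) < r then 1 else 0) * (ennreal (norm (r *\<^sub>R x) ^ 3) * f (r *\<^sub>R x) * indicator (-{0}) (r *\<^sub>R x)) \<partial>lborel)"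
        by (subst nn_integral_lborel_scale[symmetric, OF _ r]) simp_all
      also have "\<dots> = (\<integral>\<^sup>+x. 3 * (ennreal (norm x ^ 3 * r\<^sup>2) * indicator {0<..} r * f (r *\<^sub>R x)) * indicator ?B x \<partial>lborel)"
      proof (subst nn_integral_cmult[symmetric], measurable, rule nn_integral_cong)
        fix x :: "real^3"
        have 1: "ennreal (r ^ 3) * ennreal (3 / r ^ 4) * ennreal (norm (r *\<^sub>R x) ^ 3) = 3 * ennreal (norm x ^ 3 * r\<^sup>2)"
        proof -
          have "ennreal (r ^ 3) * ennreal (3 / r ^ 4) * ennreal (norm (r *\<^sub>R x) ^ 3) = ennreal (r ^ 3 * (3 / r ^ 4) * norm (r *\<^sub>R x) ^ 3)"
            using r by (simp add: ennreal_mult'[symmetric])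
          also have "r ^ 3 * (3 / r ^ 4) * norm (r *\<^sub>R x) ^ 3 = 3 * (norm x ^ 3 * r\<^sup>2)"
            using r by (simp add: field_simps power_mult_distrib power_numeral_reduce)
          finally show ?thesis by (simp add: ennreal_mult')
        qed
        have 2: "(if norm (r *\<^sub>R x) < r then 1 else 0) * indicator (-{0}) (r *\<^sub>R x) = (indicator {0<..} r * indicator ?B x :: ennreal)"
          using r by (auto simp: indicator_def)
        have "ennreal (r ^ 3) * (ennreal (3 / r ^ 4) * (if norm (r *\<^sub>R x) < r then 1 else 0) * (ennreal (norm (r *\<^sub>R x) ^ 3) * f (r *\<^sub>R x) * indicator (-{0}) (r *\<^sub>R x)))
          = (ennreal (r ^ 3) * ennreal (3 / r ^ 4) * ennreal (norm (r *\<^sub>R x) ^ 3)) * f (r *\<^sub>R x) * ((if norm (r *\<^sub>R x) < r then 1 else 0) * indicator (-{0}) (r *\<^sub>R x))"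
          by (simp only: ac_simps)
        also have "\<dots> = 3 * (ennreal (norm x ^ 3 * r\<^sup>2) * indicator {0<..} r * f (r *\<^sub>R x)) * indicator ?B x"
          unfolding 1 2 by (simp only: ac_simps)
        finally show "ennreal (r ^ 3) * (ennreal (3 / r ^ 4) * (if norm (r *\<^sub>R x) < r then 1 else 0) * (ennreal (norm (r *\<^sub>R x) ^ 3) * f (r *\<^sub>R x) * indicator (-{0}) (r *\<^sub>R x)))
          = 3 * (ennreal (norm x ^ 3 * r\<^sup>2) * indicator {0<..} r * f (r *\<^sub>R x)) * indicator ?B x" .
      qed
      finally show ?thesis by simp
    next
      case False
      then have "\<not> norm x < r" for x :: "real^3"
        using norm_ge_zero[of x] by linarith
      with False show ?thesis by simp
    qed
  qed
  also have "\<dots> = (\<integral>\<^sup>+x. (\<integral>\<^sup>+r. ennreal (3 / r ^ 4) * (if norm x < r then 1 else 0) * (ennreal (norm x ^ 3) * f x * indicator (-{0}) x) \<partial>lborel) \<partial>lborel)"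
    by (rule lborel_pair.Fubini') measurable
  also have "\<dots> = (\<integral>\<^sup>+x. f x \<partial>lborel)"
  proof (rule nn_integral_cong_AE, rule AE_mp[OF AE_lborel_singleton[of 0]], rule AE_I2, rule impI)
    fix x :: "real^3" assume x: "x \<noteq> 0"
    have "(\<integral>\<^sup>+r. ennreal (3 / r ^ 4) * (if norm x < r then 1 else 0) * (ennreal (norm x ^ 3) * f x * indicator (-{0}) x) \<partial>lborel)
      = ennreal (1 / norm x ^ 3) * (ennreal (norm x ^ 3) * f x)"
      using x nn_integral_inverse_power4[of "norm x"]
      by (subst nn_integral_multc) (auto simp: indicator_def of_bool_def cong: if_cong)
    also have "\<dots> = f x"
      using x by (simp add: mult.assoc[symmetric] ennreal_mult'[symmetric])
    finally show "(\<integral>\<^sup>+r. ennreal (3 / r ^ 4) * (if norm x < r then 1 else 0) * (ennreal (norm x ^ 3) * f x * indicator (-{0}) x) \<partial>lborel) = f x" .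
  qed
  finally show ?thesis by simp
qed

section \<open>Changes of variables\<close>

text \<open>The change of variables theorem for the gauge integral, in the form that it takes for the measure of an image.
Both sides may be infinite here, which is why the two are compared through every finite value \<open>r\<close>.\<close>

lemma emeasure_differentiable_image:
  fixes g :: "real^'n::{finite,wellorder} \<Rightarrow> real^'n::_"
  assumes S [measurable]: "S \<in> sets borel"
    and der: "\<And>x. x \<in> S \<Longrightarrow> (g has_derivative g' x) (at x)"
    and inj: "inj_on g S"
    and J [measurable]: "J \<in> borel_measurable borel"
    and Jg: "\<And>x. x \<in> S \<Longrightarrow> J x = \<bar>det (matrix (g' x))\<bar>"
  shows "g ` S \<in> sets lebesgue"
    and "emeasure lebesgue (g ` S) = (\<integral>\<^sup>+x. ennreal (J x) * indicator S x \<partial>lborel)"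
proof -
  have Sl: "S \<in> sets lebesgue" by simp
  have der': "\<And>x. x \<in> S \<Longrightarrow> (g has_derivative g' x) (at x within S)"
    using der by (blast intro: has_derivative_at_withinI)
  show im: "g ` S \<in> sets lebesgue"
    by (rule differentiable_image_in_sets_lebesgue[OF Sl])
       (use der' in \<open>auto simp: differentiable_on_def differentiable_def\<close>)
  let ?F = "\<lambda>x. J x * indicator S x"
  have nn: "0 \<le> ?F x" for x by (cases "x \<in> S") (simp_all add: Jg)
  have key: "emeasure lebesgue (g ` S) = ennreal r \<longleftrightarrow> (\<integral>\<^sup>+x. ennreal (?F x) \<partial>lborel) = ennreal r" if r: "0 \<le> r" for r
  proof -
    have "emeasure lebesgue (g ` S) = ennreal r \<longleftrightarrow> g ` S \<in> lmeasurable \<and> measure lebesgue (g ` S) = r"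
    proof safe
      assume e: "emeasure lebesgue (g ` S) = ennreal r"
      then show "g ` S \<in> lmeasurable" by (intro fmeasurableI im) simp
      show "measure lebesgue (g ` S) = r" using e r by (simp add: measure_def)
    next
      assume "g ` S \<in> lmeasurable" "r = measure lebesgue (g ` S)"
      then show "emeasure lebesgue (g ` S) = ennreal (measure lebesgue (g ` S))"
        by (simp add: emeasure_eq_measure2)
    qed
    also have "\<dots> \<longleftrightarrow> ((\<lambda>x. \<bar>det (matrix (g' x))\<bar>) has_integral r) S"
      by (rule has_measure_differentiable_image[OF Sl der' inj])
    also have "\<dots> \<longleftrightarrow> (J has_integral r) S"
      using Jg by (intro has_integral_cong) auto
    also have "\<dots> \<longleftrightarrow> (?F has_integral r) UNIV"
    proof -
      have F: "?F = (\<lambda>x. if x \<in> S then J x else 0)" by (auto simp: fun_eq_iff)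
      show ?thesis unfolding F has_integral_restrict_UNIV ..
    qed
    also have "\<dots> \<longleftrightarrow> (\<integral>\<^sup>+x. ennreal (?F x) \<partial>lborel) = ennreal r"
      using r by (simp add: has_integral_iff_nn_integral_lebesgue[OF nn] nn_integral_completion measurable_completion)
    finally show ?thesis .
  qed
  have "emeasure lebesgue (g ` S) = (\<integral>\<^sup>+x. ennreal (?F x) \<partial>lborel)"
  proof (cases "\<integral>\<^sup>+x. ennreal (?F x) \<partial>lborel")
    case (real r)
    then show ?thesis using key[of r] by simp
  next
    case top
    then show ?thesis using key by (cases "emeasure lebesgue (g ` S)") auto
  qed
  also have "\<dots> = (\<integral>\<^sup>+x. ennreal (J x) * indicator S x \<partial>lborel)"
    by (intro nn_integral_cong) (auto simp: indicator_def)
  finally show "emeasure lebesgue (g ` S) = (\<integral>\<^sup>+x. ennreal (J x) * indicator S x \<partial>lborel)" .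
qed

text \<open>Both sides are integrals of \<open>f\<close> against a measure on the target space; the two measures agree on Borel sets by
the formula for the measure of an image. The image of \<open>S\<close> is only known to be Lebesgue measurable, hence the completed
measure on the right.\<close>

lemma nn_integral_change_of_variables:
  fixes g :: "real^'n::{finite,wellorder} \<Rightarrow> real^'n::_" and f :: "real^'n::{finite,wellorder} \<Rightarrow> ennreal"
  assumes S [measurable]: "S \<in> sets borel"
    and g [measurable]: "g \<in> borel_measurable borel"
    and f [measurable]: "f \<in> borel_measurable borel"
    and der: "\<And>x. x \<in> S \<Longrightarrow> (g has_derivative g' x) (at x)"
    and inj: "inj_on g S"
    and J [measurable]: "J \<in> borel_measurable borel"
    and Jg: "\<And>x. x \<in> S \<Longrightarrow> J x = \<bar>det (matrix (g' x))\<bar>"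
  shows "(\<integral>\<^sup>+x. ennreal (J x) * f (g x) * indicator S x \<partial>lborel) = (\<integral>\<^sup>+y. f y * indicator (g ` S) y \<partial>lebesgue)"
proof -
  have im [measurable]: "g ` S \<in> sets lebesgue"
    by (rule emeasure_differentiable_image[OF S der inj J Jg])
  define M1 where "M1 = distr (density lborel (\<lambda>x. ennreal (J x) * indicator S x)) borel g"
  define M2 where "M2 = distr (density lebesgue (indicator (g ` S))) borel (\<lambda>x. x)"
  have [measurable]: "(\<lambda>x. x) \<in> lebesgue \<rightarrow>\<^sub>M borel"
    by (simp add: measurable_completion)
  have [measurable]: "indicator (g ` S) \<in> borel_measurable lebesgue"
    using im by simp
  have "M1 = M2"
  proof (rule measure_eqI)
    show "sets M1 = sets M2" by (simp add: M1_def M2_def)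
    fix A assume "A \<in> sets M1"
    then have A [measurable]: "A \<in> sets borel" by (simp add: M1_def)
    have gA [measurable, simp]: "g -` A \<in> sets borel"
      using measurable_sets[OF g A] by simp
    then have T [measurable]: "S \<inter> g -` A \<in> sets borel" by simp
    have "emeasure M1 A = (\<integral>\<^sup>+x. ennreal (J x) * indicator (S \<inter> g -` A) x \<partial>lborel)"
      unfolding M1_def
      by (subst emeasure_distr, simp, simp, subst emeasure_density)
         (auto intro!: nn_integral_cong simp: indicator_def)
    also have "\<dots> = emeasure lebesgue (g ` (S \<inter> g -` A))"
      by (rule emeasure_differentiable_image(2)[symmetric, where g'=g'])
         (use der Jg inj in \<open>auto intro: inj_on_subset\<close>)
    also have "g ` (S \<inter> g -` A) = g ` S \<inter> A" by auto
    also have "emeasure lebesgue (g ` S \<inter> A) = emeasure M2 A"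
      unfolding M2_def
      by (subst emeasure_distr, simp, simp, subst emeasure_density)
         (auto simp: nn_integral_indicator[symmetric] indicator_inter_arith simp del: nn_integral_indicator
           intro!: nn_integral_cong)
    finally show "emeasure M1 A = emeasure M2 A" .
  qed
  have "(\<integral>\<^sup>+x. ennreal (J x) * f (g x) * indicator S x \<partial>lborel) = (\<integral>\<^sup>+x. f x \<partial>M1)"
    unfolding M1_def
    by (subst nn_integral_distr, simp, simp, subst nn_integral_density)
       (auto intro!: nn_integral_cong simp: ac_simps)
  also have "\<dots> = (\<integral>\<^sup>+y. f y * indicator (g ` S) y \<partial>lebesgue)"
    unfolding \<open>M1 = M2\<close> M2_def
    by (subst nn_integral_distr, simp, simp, subst nn_integral_density)
       (auto intro!: nn_integral_cong simp: ac_simps measurable_completion)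
  finally show ?thesis .
qed

lemma nn_integral_orthogonal_transformation:
  fixes A :: "real^'n::{finite,wellorder} \<Rightarrow> real^'n::_" and f :: "real^'n::{finite,wellorder} \<Rightarrow> ennreal"
  assumes A: "orthogonal_transformation A" and f [measurable]: "f \<in> borel_measurable borel"
  shows "(\<integral>\<^sup>+x. f (A x) \<partial>lborel) = (\<integral>\<^sup>+x. f x \<partial>lborel)"
proof -
  have lin: "linear A" using A by (rule orthogonal_transformation_linear)
  have [measurable]: "A \<in> borel_measurable borel"
    by (intro borel_measurable_continuous_onI linear_continuous_on linear_conv_bounded_linear[THEN iffD1] lin)
  have "lborel = distr lborel borel A"
  proof (rule lborel_eqI)
    fix l u :: "real^'n::{finite,wellorder}" assume le: "\<And>b. b \<in> Basis \<Longrightarrow> l \<bullet> b \<le> u \<bullet> b"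
    have inv: "orthogonal_transformation (inv A)" by (rule orthogonal_transformation_inv[OF A])
    have eq: "A -` box l u = inv A ` box l u"
      by (rule bij_vimage_eq_inv_image) (rule orthogonal_transformation_bij[OF A])
    have lm: "inv A ` box l u \<in> lmeasurable"
      by (rule measurable_orthogonal_image[OF inv]) simp
    have b: "inv A ` box l u \<in> sets borel"
      unfolding eq[symmetric] by (rule measurable_sets_borel[of A borel]) auto
    have "emeasure (distr lborel borel A) (box l u) = emeasure lebesgue (inv A ` box l u)"
      using b by (simp add: emeasure_distr eq)
    also have "\<dots> = ennreal (measure lebesgue (inv A ` box l u))"
      using lm by (simp add: emeasure_eq_measure2)
    also have "\<dots> = ennreal (measure lebesgue (box l u))"
      by (simp add: measure_orthogonal_image[OF inv])
    also have "\<dots> = (\<Prod>b\<in>Basis. (u - l) \<bullet> b)"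
      using le by (simp add: measure_lborel_box_eq)
    finally show "emeasure (distr lborel borel A) (box l u) = (\<Prod>b\<in>Basis. (u - l) \<bullet> b)" .
  qed simp
  then have "(\<integral>\<^sup>+x. f x \<partial>lborel) = (\<integral>\<^sup>+x. f x \<partial>distr lborel borel A)" by simp
  also have "\<dots> = (\<integral>\<^sup>+x. f (A x) \<partial>lborel)" by (simp add: nn_integral_distr)
  finally show ?thesis by simp
qed

text \<open>In polar coordinates \<open>z = r \<kappa>\<close> the transformation \<open>(z, \<sigma>) \<mapsto> (\<bar>z\<bar> \<sigma>, z / \<bar>z\<bar>)\<close> keeps \<open>r\<close> and
exchanges the unit vectors \<open>\<kappa>\<close> and \<open>\<sigma>\<close>.\<close>

lemma nn_integral_exchange_direction:
  fixes G :: "(real^3) \<times> (real^3) \<Rightarrow> ennreal"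
  assumes [measurable]: "G \<in> borel_measurable (borel \<Otimes>\<^sub>M borel)"
  shows "(\<integral>\<^sup>+z. \<integral>\<^sup>+\<sigma>. G (norm z *\<^sub>R \<sigma>, sgn z) \<partial>sph \<partial>lborel) = (\<integral>\<^sup>+z. \<integral>\<^sup>+\<sigma>. G (z, \<sigma>) \<partial>sph \<partial>lborel)"
proof -
  interpret sph2: pair_sigma_finite sph sph by standard
  have [measurable]: "(\<lambda>z::real^3. \<integral>\<^sup>+\<sigma>. G (norm z *\<^sub>R \<sigma>, sgn z) \<partial>sph) \<in> borel_measurable borel"
    by (rule sph.borel_measurable_nn_integral) measurable
  have "(\<integral>\<^sup>+z. \<integral>\<^sup>+\<sigma>. G (norm z *\<^sub>R \<sigma>, sgn z) \<partial>sph \<partial>lborel)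
    = (\<integral>\<^sup>+r. ennreal (r\<^sup>2) * indicator {0<..} r * (\<integral>\<^sup>+\<kappa>. \<integral>\<^sup>+\<sigma>. G (norm (r *\<^sub>R \<kappa>) *\<^sub>R \<sigma>, sgn (r *\<^sub>R \<kappa>)) \<partial>sph \<partial>sph) \<partial>lborel)"
    by (rule nn_integral_polar) measurable
  also have "\<dots> = (\<integral>\<^sup>+r. ennreal (r\<^sup>2) * indicator {0<..} r * (\<integral>\<^sup>+\<kappa>. \<integral>\<^sup>+\<sigma>. G (r *\<^sub>R \<sigma>, \<kappa>) \<partial>sph \<partial>sph) \<partial>lborel)"
  proof (rule nn_integral_cong)
    fix r :: real
    have "(\<integral>\<^sup>+\<kappa>. \<integral>\<^sup>+\<sigma>. G (norm (r *\<^sub>R \<kappa>) *\<^sub>R \<sigma>, sgn (r *\<^sub>R \<kappa>)) \<partial>sph \<partial>sph) = (\<integral>\<^sup>+\<kappa>. \<integral>\<^sup>+\<sigma>. G (r *\<^sub>R \<sigma>, \<kappa>) \<partial>sph \<partial>sph)"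
      if "r > 0"
      by (rule nn_integral_cong_AE, rule AE_mp[OF AE_sph_norm], rule AE_I2)
         (use that in \<open>auto simp: sgn_div_norm\<close>)
    then show "ennreal (r\<^sup>2) * indicator {0<..} r * (\<integral>\<^sup>+\<kappa>. \<integral>\<^sup>+\<sigma>. G (norm (r *\<^sub>R \<kappa>) *\<^sub>R \<sigma>, sgn (r *\<^sub>R \<kappa>)) \<partial>sph \<partial>sph)
      = ennreal (r\<^sup>2) * indicator {0<..} r * (\<integral>\<^sup>+\<kappa>. \<integral>\<^sup>+\<sigma>. G (r *\<^sub>R \<sigma>, \<kappa>) \<partial>sph \<partial>sph)"
      by (cases "r > 0") auto
  qed
  also have "\<dots> = (\<integral>\<^sup>+r. ennreal (r\<^sup>2) * indicator {0<..} r * (\<integral>\<^sup>+\<sigma>. \<integral>\<^sup>+\<kappa>. G (r *\<^sub>R \<sigma>, \<kappa>) \<partial>sph \<partial>sph) \<partial>lborel)"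
  proof (rule nn_integral_cong)
    fix r :: real
    have "(\<integral>\<^sup>+\<kappa>. \<integral>\<^sup>+\<sigma>. G (r *\<^sub>R \<sigma>, \<kappa>) \<partial>sph \<partial>sph) = (\<integral>\<^sup>+\<sigma>. \<integral>\<^sup>+\<kappa>. G (r *\<^sub>R \<sigma>, \<kappa>) \<partial>sph \<partial>sph)"
      by (rule sph2.Fubini') measurable
    then show "ennreal (r\<^sup>2) * indicator {0<..} r * (\<integral>\<^sup>+\<kappa>. \<integral>\<^sup>+\<sigma>. G (r *\<^sub>R \<sigma>, \<kappa>) \<partial>sph \<partial>sph)
      = ennreal (r\<^sup>2) * indicator {0<..} r * (\<integral>\<^sup>+\<sigma>. \<integral>\<^sup>+\<kappa>. G (r *\<^sub>R \<sigma>, \<kappa>) \<partial>sph \<partial>sph)" by simp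
  qed
  also have "\<dots> = (\<integral>\<^sup>+z. \<integral>\<^sup>+\<sigma>. G (z, \<sigma>) \<partial>sph \<partial>lborel)"
    by (rule nn_integral_polar[symmetric]) measurable
  finally show ?thesis .
qed

section \<open>Archimedes' theorem\<close>

text \<open>Three-space as the product of an axis and an orthogonal plane; the pair type makes the product measure available.\<close>

definition cyl :: "real \<times> (real \<times> real) \<Rightarrow> real^3" where
  "cyl p = vector [fst p, fst (snd p), snd (snd p)]"

lemma cyl_measurable [measurable]: "cyl \<in> borel \<rightarrow>\<^sub>M borel"
proof -
  have eq: "cyl = (\<lambda>p. fst p *\<^sub>R axis 1 1 + fst (snd p) *\<^sub>R axis 2 1 + snd (snd p) *\<^sub>R axis 3 1)"
    by (intro ext, simp add: cyl_def vec_eq_iff forall_3 axis_def)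
  show ?thesis
    unfolding eq by (intro borel_measurable_continuous_onI continuous_intros)
qed

lemma inner_axis_cyl: "axis 1 1 \<bullet> cyl (a, y) = a"
  by (simp add: cyl_def inner_vec_def sum_3 axis_def)

lemma norm_cyl: "norm (cyl (a, y)) = sqrt (a\<^sup>2 + (norm y)\<^sup>2)"
  by (cases y) (simp add: cyl_def norm_vec_def L2_set_def sum_3 norm_Pair add.assoc)

lemma lborel_cyl: "lborel = distr (lborel :: (real \<times> (real \<times> real)) measure) borel cyl"
proof (rule lborel_eqI)
  fix l u :: "real^3" assume le: "\<And>b. b \<in> Basis \<Longrightarrow> l \<bullet> b \<le> u \<bullet> b"
  have le': "l $ i \<le> u $ i" for i
    using le[of "axis i 1"] by (simp add: inner_axis axis_in_Basis_iff)
  have box: "box (a1, (a2, a3)) (b1, (b2, b3)) = {p. a1 < fst p \<and> fst p < b1 \<and> a2 < fst (snd p) \<and>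
      fst (snd p) < b2 \<and> a3 < snd (snd p) \<and> snd (snd p) < b3}" for a1 a2 a3 b1 b2 b3 :: real
    by (auto simp: box_def Basis_prod_def)
  have eq: "cyl -` box l u = box (l$1, (l$2, l$3)) (u$1, (u$2, u$3))"
    unfolding box by (auto simp: cyl_def mem_box_cart forall_3)
  have "emeasure (distr lborel borel cyl) (box l u) = emeasure lborel (cyl -` box l u)"
    by (simp add: emeasure_distr)
  also have "\<dots> = (\<Prod>b\<in>Basis. ((u$1, (u$2, u$3)) - (l$1, (l$2, l$3))) \<bullet> b)"
    unfolding eq by (rule emeasure_lborel_box) (use le' in \<open>auto simp: Basis_prod_def\<close>)
  also have "(\<Prod>b\<in>Basis. ((u$1, (u$2, u$3)) - (l$1, (l$2, l$3))) \<bullet> b) = (u$1 - l$1) * ((u$2 - l$2) * (u$3 - l$3))"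
    by (simp add: Basis_prod_def prod.union_disjoint image_image prod.reindex inj_on_def)
  also have "\<dots> = (\<Prod>b\<in>Basis. (u - l) \<bullet> b)"
  proof -
    have B: "(Basis :: (real^3) set) = {axis 1 1, axis 2 1, axis 3 1}"
      by (auto simp: Basis_vec_def UNIV_3)
    show ?thesis unfolding B by (simp add: axis_eq_axis inner_axis)
  qed
  finally show "emeasure (distr lborel borel cyl) (box l u) = (\<Prod>b\<in>Basis. (u - l) \<bullet> b)" .
qed simp

lemma nn_integral_cyl:
  fixes f :: "real^3 \<Rightarrow> ennreal"
  assumes [measurable]: "f \<in> borel_measurable borel"
  shows "(\<integral>\<^sup>+x. f x \<partial>lborel) = (\<integral>\<^sup>+y. \<integral>\<^sup>+a. f (cyl (a, y)) \<partial>lborel \<partial>lborel)"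
proof -
  have [measurable]: "cyl \<in> borel \<Otimes>\<^sub>M borel \<rightarrow>\<^sub>M borel"
    using cyl_measurable by (simp add: borel_prod)
  have "(\<integral>\<^sup>+x. f x \<partial>lborel) = (\<integral>\<^sup>+p. f (cyl p) \<partial>(lborel \<Otimes>\<^sub>M lborel))"
    by (subst lborel_cyl, subst lborel_prod) (simp add: nn_integral_distr)
  also have "\<dots> = (\<integral>\<^sup>+y. \<integral>\<^sup>+a. f (cyl (a, y)) \<partial>lborel \<partial>lborel)"
    by (rule lborel_pair.nn_integral_snd[symmetric]) measurable
  finally show ?thesis .
qed

text \<open>Along a line at distance \<open>r\<close> from the axis, substitute the cosine \<open>t = a / sqrt (a\<^sup>2 + r\<^sup>2)\<close> of the polar angle, that is
\<open>a = r t / sqrt (1 - t\<^sup>2)\<close>. The chord inside the unit ball is \<open>\<bar>a\<bar> < q\<close> with \<open>q\<^sup>2 = 1 - r\<^sup>2\<close>, and its end points are fixed by the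
substitution.\<close>

lemma nn_integral_latitude:
  fixes f :: "real \<Rightarrow> ennreal"
  assumes [measurable]: "f \<in> borel_measurable borel" and r: "0 < r" "r < 1"
  shows "(\<integral>\<^sup>+a. f (a / sqrt (a\<^sup>2 + r\<^sup>2)) * (if a\<^sup>2 + r\<^sup>2 < 1 then 1 else 0) \<partial>lborel)
    = (\<integral>\<^sup>+t. f t * ennreal (r / sqrt (1 - t\<^sup>2) ^ 3) * (if t\<^sup>2 \<le> 1 - r\<^sup>2 then 1 else 0) \<partial>lborel)"
proof -
  define q where "q = sqrt (1 - r\<^sup>2)"
  have r2: "r\<^sup>2 < 1" "0 < r\<^sup>2" using r by (auto simp: power_less_one_iff)
  have q: "0 < q" "q < 1" "q\<^sup>2 = 1 - r\<^sup>2" using r2 by (auto simp: q_def)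
  have iff: "a\<^sup>2 \<le> 1 - r\<^sup>2 \<longleftrightarrow> -q \<le> a \<and> a \<le> q" for a
    unfolding q(3)[symmetric] using q(1) abs_le_square_iff[of a q] by auto
  define g where "g t = r * t / sqrt (1 - t\<^sup>2)" for t
  define g' where "g' t = r / sqrt (1 - t\<^sup>2) ^ 3" for t
  have t2: "0 < 1 - t\<^sup>2" if "t \<in> {-q..q}" for t
    using that iff[of t] r2 unfolding atLeastAtMost_iff by linarith
  have gq: "g q = q" "g (-q) = -q" using q r by (simp_all add: g_def)
  have "(\<integral>\<^sup>+a. f (a / sqrt (a\<^sup>2 + r\<^sup>2)) * (if a\<^sup>2 + r\<^sup>2 < 1 then 1 else 0) \<partial>lborel)
      = (\<integral>\<^sup>+a. f (a / sqrt (a\<^sup>2 + r\<^sup>2)) * indicator {g (-q)..g q} a \<partial>lborel)"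
  proof (rule nn_integral_cong_AE, rule AE_mp[OF AE_lborel_singleton[of q]],
      rule AE_mp[OF AE_lborel_singleton[of "-q"]], rule AE_I2, intro impI)
    fix a :: real assume a: "a \<noteq> q" "a \<noteq> -q"
    then have "a\<^sup>2 \<noteq> 1 - r\<^sup>2" unfolding q(3)[symmetric] by (simp add: power2_eq_iff)
    then have "a\<^sup>2 + r\<^sup>2 < 1 \<longleftrightarrow> a \<in> {-q..q}" using iff[of a] by auto
    then show "f (a / sqrt (a\<^sup>2 + r\<^sup>2)) * (if a\<^sup>2 + r\<^sup>2 < 1 then 1 else 0) = f (a / sqrt (a\<^sup>2 + r\<^sup>2)) * indicator {g (-q)..g q} a"
      by (simp add: gq indicator_def)
  qed
  also have "\<dots> = (\<integral>\<^sup>+t. f (g t / sqrt ((g t)\<^sup>2 + r\<^sup>2)) * ennreal (g' t) * indicator {-q..q} t \<partial>lborel)"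
  proof (rule nn_integral_substitution_aux)
    fix t assume t: "t \<in> {-q..q}"
    have s: "sqrt (1 - t\<^sup>2) > 0" using t2[OF t] by simp
    have s2: "(sqrt (1 - t\<^sup>2))\<^sup>2 = 1 - t\<^sup>2" using t2[OF t] by simp
    have "((\<lambda>t. r * t / sqrt (1 - t\<^sup>2)) has_real_derivative
        (r * sqrt (1 - t\<^sup>2) - r * t * (- (2 * t) * (inverse (sqrt (1 - t\<^sup>2)) / 2))) / (sqrt (1 - t\<^sup>2) * sqrt (1 - t\<^sup>2))) (at t)"
      using t2[OF t] s by (auto intro!: derivative_eq_intros simp: power2_eq_square)
    moreover have "(r * sqrt (1 - t\<^sup>2) - r * t * (- (2 * t) * (inverse (sqrt (1 - t\<^sup>2)) / 2))) / (sqrt (1 - t\<^sup>2) * sqrt (1 - t\<^sup>2)) = g' t"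
      using s s2 by (simp add: g'_def field_simps power2_eq_square power3_eq_cube)
    ultimately show "(g has_real_derivative g' t) (at t)" by (simp add: g_def[abs_def])
    show "0 \<le> g' t" using r s by (simp add: g'_def)
  next
    show "continuous_on {-q..q} g'"
    proof -
      have "sqrt (1 - t\<^sup>2) ^ 3 \<noteq> 0" if "t \<in> {-q..q}" for t using t2[OF that] by simp
      then show ?thesis unfolding g'_def by (intro continuous_intros ballI)
    qed
  qed (use q in auto)
  also have "\<dots> = (\<integral>\<^sup>+t. f t * ennreal (r / sqrt (1 - t\<^sup>2) ^ 3) * (if t\<^sup>2 \<le> 1 - r\<^sup>2 then 1 else 0) \<partial>lborel)"
  proof (rule nn_integral_cong)
    fix t :: real
    show "f (g t / sqrt ((g t)\<^sup>2 + r\<^sup>2)) * ennreal (g' t) * indicator {-q..q} t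
       = f t * ennreal (r / sqrt (1 - t\<^sup>2) ^ 3) * (if t\<^sup>2 \<le> 1 - r\<^sup>2 then 1 else 0)"
    proof (cases "t \<in> {-q..q}")
      case True
      have s: "sqrt (1 - t\<^sup>2) > 0" and s2: "(sqrt (1 - t\<^sup>2))\<^sup>2 = 1 - t\<^sup>2" using t2[OF True] by auto
      have "(g t)\<^sup>2 + r\<^sup>2 = (r / sqrt (1 - t\<^sup>2))\<^sup>2"
        using t2[OF True] by (simp add: g_def power_divide power_mult_distrib s2 field_simps)
      then have "sqrt ((g t)\<^sup>2 + r\<^sup>2) = r / sqrt (1 - t\<^sup>2)" using s r by simp
      then have "g t / sqrt ((g t)\<^sup>2 + r\<^sup>2) = t" using s r by (simp add: g_def)
      then show ?thesis using True iff[of t] by (simp add: g'_def)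
    qed (use iff[of t] in auto)
  qed
  finally show ?thesis .
qed

text \<open>Archimedes' hat-box theorem. After a rotation, integrate over the cone first along lines parallel to the axis and then
over the plane: scaling the plane by \<open>sqrt (1 - t\<^sup>2)\<close> shows that the density in \<open>t\<close> is a constant \<open>c\<close>, and the total
area \<open>4 \<pi>\<close> determines it.\<close>

lemma nn_integral_sph_inner:
  fixes f :: "real \<Rightarrow> ennreal" and \<kappa> :: "real^3"
  assumes [measurable]: "f \<in> borel_measurable borel" and \<kappa>: "norm \<kappa> = 1"
  shows "(\<integral>\<^sup>+\<sigma>. f (\<kappa> \<bullet> \<sigma>) \<partial>sph) = ennreal (2 * pi) * (\<integral>\<^sup>+t. f t * indicator {-1<..<1} t \<partial>lborel)"
proof -
  \<comment> \<open>The density is \<open>2 \<pi>\<close>; it is identified at the end by the choice \<open>h = 1\<close>.\<close>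
  define c :: ennreal where "c = 3 * (\<integral>\<^sup>+(y::real\<times>real). ennreal (norm y) * (if norm y \<le> 1 then 1 else 0) \<partial>lborel)"
  have main: "(\<integral>\<^sup>+\<sigma>. h (\<kappa> \<bullet> \<sigma>) \<partial>sph) = c * (\<integral>\<^sup>+t. h t * indicator {-1<..<1} t \<partial>lborel)"
    if h [measurable]: "h \<in> borel_measurable borel" for h :: "real \<Rightarrow> ennreal"
  proof -
    obtain A :: "real^3 \<Rightarrow> real^3" where A: "orthogonal_transformation A" "A \<kappa> = axis 1 1"
      using orthogonal_transformation_exists[of \<kappa> "axis 1 1"] \<kappa> by auto
    let ?G = "\<lambda>x::real^3. h (axis 1 1 \<bullet> sgn x) * (if norm x < 1 \<and> x \<noteq> 0 then 1 else 0)"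
    have linA: "linear A" using A(1) by (rule orthogonal_transformation_linear)
    have GA: "?G (A x) = h (\<kappa> \<bullet> sgn x) * indicator (ball 0 1 - {0}) x" for x
    proof -
      have n: "norm (A x) = norm x" using A(1) by (simp add: orthogonal_transformation)
      then have "sgn (A x) = A (sgn x)" by (simp add: sgn_div_norm linear_scale[OF linA])
      then have "axis 1 1 \<bullet> sgn (A x) = \<kappa> \<bullet> sgn x"
        using A by (metis orthogonal_transformation_def)
      moreover have "A x \<noteq> 0 \<longleftrightarrow> x \<noteq> 0" using n by (metis norm_eq_zero)
      ultimately show ?thesis using n by (simp add: indicator_def)
    qed
    have "(\<integral>\<^sup>+\<sigma>. h (\<kappa> \<bullet> \<sigma>) \<partial>sph) = 3 * (\<integral>\<^sup>+x. ?G (A x) \<partial>lborel)"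
      by (subst nn_integral_sph) (simp_all only: GA, measurable)
    also have "(\<integral>\<^sup>+x. ?G (A x) \<partial>lborel) = (\<integral>\<^sup>+x. ?G x \<partial>lborel)"
      by (rule nn_integral_orthogonal_transformation[OF A(1)]) measurable
    also have "\<dots> = (\<integral>\<^sup>+y. \<integral>\<^sup>+a. ?G (cyl (a, y)) \<partial>lborel \<partial>lborel)"
      by (rule nn_integral_cyl) measurable
    also have "\<dots> = (\<integral>\<^sup>+(y::real\<times>real). \<integral>\<^sup>+t. h t * ennreal (norm y / sqrt (1 - t\<^sup>2) ^ 3) * (if t\<^sup>2 \<le> 1 - (norm y)\<^sup>2 then 1 else 0) * indicator {-1<..<1} t \<partial>lborel \<partial>lborel)"
    proof (rule nn_integral_cong_AE, rule AE_mp[OF AE_lborel_singleton[of 0]], rule AE_I2, rule impI)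
      fix y :: "real \<times> real" assume y: "y \<noteq> 0"
      have G: "?G (cyl (a, y)) = h (a / sqrt (a\<^sup>2 + (norm y)\<^sup>2)) * (if a\<^sup>2 + (norm y)\<^sup>2 < 1 then 1 else 0)" for a
      proof -
        have "cyl (a, y) \<noteq> 0" using y norm_cyl[of a y] by (auto simp: add_nonneg_eq_0_iff)
        then show ?thesis
          by (simp add: sgn_div_norm inner_axis_cyl norm_cyl divide_inverse mult.commute)
      qed
      show "(\<integral>\<^sup>+a. ?G (cyl (a, y)) \<partial>lborel) = (\<integral>\<^sup>+t. h t * ennreal (norm y / sqrt (1 - t\<^sup>2) ^ 3) * (if t\<^sup>2 \<le> 1 - (norm y)\<^sup>2 then 1 else 0) * indicator {-1<..<1} t \<partial>lborel)"
      proof (cases "norm y < 1")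
        case True
        have "(\<integral>\<^sup>+a. ?G (cyl (a, y)) \<partial>lborel) = (\<integral>\<^sup>+t. h t * ennreal (norm y / sqrt (1 - t\<^sup>2) ^ 3) * (if t\<^sup>2 \<le> 1 - (norm y)\<^sup>2 then 1 else 0) \<partial>lborel)"
          unfolding G by (rule nn_integral_latitude) (use True y in auto)
        also have "\<dots> = (\<integral>\<^sup>+t. h t * ennreal (norm y / sqrt (1 - t\<^sup>2) ^ 3) * (if t\<^sup>2 \<le> 1 - (norm y)\<^sup>2 then 1 else 0) * indicator {-1<..<1} t \<partial>lborel)"
        proof (rule nn_integral_cong)
          fix t :: real
          have "t\<^sup>2 \<le> 1 - (norm y)\<^sup>2 \<Longrightarrow> t \<in> {-1<..<1}"
            using y abs_square_less_1[of t] by (smt (verit) greaterThanLessThan_iff zero_less_norm_iff zero_less_power2)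
          then show "h t * ennreal (norm y / sqrt (1 - t\<^sup>2) ^ 3) * (if t\<^sup>2 \<le> 1 - (norm y)\<^sup>2 then 1 else 0)
            = h t * ennreal (norm y / sqrt (1 - t\<^sup>2) ^ 3) * (if t\<^sup>2 \<le> 1 - (norm y)\<^sup>2 then 1 else 0) * indicator {-1<..<1} t"
            by auto
        qed
        finally show ?thesis .
      next
        case False
        then have n: "(norm y)\<^sup>2 \<ge> 1" by (simp add: one_le_power)
        have "?G (cyl (a, y)) = 0" for a
        proof -
          have "\<not> a\<^sup>2 + (norm y)\<^sup>2 < 1" using n zero_le_power2[of a] by linarith
          then show ?thesis unfolding G by simp
        qed
        moreover have "h t * ennreal (norm y / sqrt (1 - t\<^sup>2) ^ 3) * (if t\<^sup>2 \<le> 1 - (norm y)\<^sup>2 then 1 else 0) * indicator {-1<..<1} t = 0"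
          if "t \<noteq> 0" for t
        proof -
          have "0 < t\<^sup>2" using that by simp
          then have "\<not> t\<^sup>2 \<le> 1 - (norm y)\<^sup>2" using n by linarith
          then show ?thesis by simp
        qed
        then have "(\<integral>\<^sup>+t. h t * ennreal (norm y / sqrt (1 - t\<^sup>2) ^ 3) * (if t\<^sup>2 \<le> 1 - (norm y)\<^sup>2 then 1 else 0) * indicator {-1<..<1} t \<partial>lborel) = (\<integral>\<^sup>+(t::real). 0 \<partial>lborel)"
          by (intro nn_integral_cong_AE eventually_mono[OF AE_lborel_singleton[of 0]])
        ultimately show ?thesis by (simp only: nn_integral_const)
      qed
    qed
    also have "\<dots> = (\<integral>\<^sup>+t. \<integral>\<^sup>+(y::real\<times>real). h t * ennreal (norm y / sqrt (1 - t\<^sup>2) ^ 3) * (if t\<^sup>2 \<le> 1 - (norm y)\<^sup>2 then 1 else 0) * indicator {-1<..<1} t \<partial>lborel \<partial>lborel)"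
      by (rule lborel_pair.Fubini') measurable
    also have "3 * \<dots> = (\<integral>\<^sup>+t. c * (h t * indicator {-1<..<1} t) \<partial>lborel)"
    proof (subst nn_integral_cmult[symmetric], measurable, rule nn_integral_cong)
      fix t :: real
      show "3 * (\<integral>\<^sup>+(y::real\<times>real). h t * ennreal (norm y / sqrt (1 - t\<^sup>2) ^ 3) * (if t\<^sup>2 \<le> 1 - (norm y)\<^sup>2 then 1 else 0) * indicator {-1<..<1} t \<partial>lborel)
        = c * (h t * indicator {-1<..<1} t)"
      proof (cases "t \<in> {-1<..<1}")
        case True
        define R where "R = sqrt (1 - t\<^sup>2)"
        have "t\<^sup>2 < 1" using True by (simp add: abs_square_less_1 abs_less_iff)
        then have R: "R > 0" "R\<^sup>2 = 1 - t\<^sup>2" by (auto simp: R_def)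
        have "(\<integral>\<^sup>+(y::real\<times>real). ennreal (norm y / R ^ 3) * (if t\<^sup>2 \<le> 1 - (norm y)\<^sup>2 then 1 else 0) \<partial>lborel)
          = ennreal (R\<^sup>2) * (\<integral>\<^sup>+(y::real\<times>real). ennreal (norm (R *\<^sub>R y) / R ^ 3) * (if t\<^sup>2 \<le> 1 - (norm (R *\<^sub>R y))\<^sup>2 then 1 else 0) \<partial>lborel)"
          using nn_integral_lborel_scale[of "\<lambda>y::real\<times>real. ennreal (norm y / R ^ 3) * (if t\<^sup>2 \<le> 1 - (norm y)\<^sup>2 then 1 else 0)" R] R
          by (simp add: eval_nat_numeral)
        also have "\<dots> = (\<integral>\<^sup>+(y::real\<times>real). ennreal (norm y) * (if norm y \<le> 1 then 1 else 0) \<partial>lborel)"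
        proof (subst nn_integral_cmult[symmetric], measurable, rule nn_integral_cong)
          fix y :: "real \<times> real"
          have "t\<^sup>2 \<le> 1 - (norm (R *\<^sub>R y))\<^sup>2 \<longleftrightarrow> R\<^sup>2 * (norm y)\<^sup>2 \<le> R\<^sup>2 * 1"
            using R by (auto simp: power_mult_distrib)
          also have "\<dots> \<longleftrightarrow> (norm y)\<^sup>2 \<le> 1" using R(1) by (subst mult_le_cancel_left_pos) auto
          also have "\<dots> \<longleftrightarrow> norm y \<le> 1" by (simp add: abs_square_le_1)
          finally have 1: "t\<^sup>2 \<le> 1 - (norm (R *\<^sub>R y))\<^sup>2 \<longleftrightarrow> norm y \<le> 1" .
          have 2: "ennreal (R\<^sup>2) * ennreal (norm (R *\<^sub>R y) / R ^ 3) = ennreal (norm y)"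
            using R(1) by (simp add: ennreal_mult'[symmetric] field_simps power2_eq_square power3_eq_cube)
          show "ennreal (R\<^sup>2) * (ennreal (norm (R *\<^sub>R y) / R ^ 3) * (if t\<^sup>2 \<le> 1 - (norm (R *\<^sub>R y))\<^sup>2 then 1 else 0)) =
            ennreal (norm y) * (if norm y \<le> 1 then 1 else 0)"
            unfolding 1 mult.assoc[symmetric] 2 ..
        qed
        finally have "3 * (\<integral>\<^sup>+(y::real\<times>real). ennreal (norm y / R ^ 3) * (if t\<^sup>2 \<le> 1 - (norm y)\<^sup>2 then 1 else 0) \<partial>lborel) = c"
          by (simp add: c_def)
        moreover have "(\<integral>\<^sup>+(y::real\<times>real). h t * ennreal (norm y / R ^ 3) * (if t\<^sup>2 \<le> 1 - (norm y)\<^sup>2 then 1 else 0) * indicator {-1<..<1} t \<partial>lborel)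
          = h t * (\<integral>\<^sup>+(y::real\<times>real). ennreal (norm y / R ^ 3) * (if t\<^sup>2 \<le> 1 - (norm y)\<^sup>2 then 1 else 0) \<partial>lborel)"
          using True by (subst nn_integral_cmult[symmetric]) (simp_all add: mult.assoc)
        ultimately show ?thesis
          using True by (simp add: R_def[symmetric] mult.left_commute mult.commute)
      qed simp
    qed
    also have "\<dots> = c * (\<integral>\<^sup>+t. h t * indicator {-1<..<1} t \<partial>lborel)"
      by (rule nn_integral_cmult) measurable
    finally show ?thesis .
  qed
  have "ennreal (2 * (2 * pi)) = c * 2"
    using main[of "\<lambda>_. 1"] emeasure_sph by simp
  then have "2 * ennreal (2 * pi) = 2 * c"
    by (subst (asm) ennreal_mult') (simp_all add: mult.commute)
  then have "c = ennreal (2 * pi)"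
    by (subst (asm) ennreal_mult_cancel_left) auto
  then show ?thesis using main[of f] by simp
qed

section \<open>The segment between pre- and post-collisional relative velocity\<close>

text \<open>The point \<open>z + t (z' - z)\<close> of the segment from the relative velocity \<open>z = v - v\<^sub>*\<close> to
\<open>z' = (z + \<bar>z\<bar> \<sigma>) / 2\<close>; the post-collisional velocities are \<open>v' = v\<^sub>* + z'\<close> and \<open>v'\<^sub>* = v - z'\<close>.\<close>

definition tilt :: "real \<Rightarrow> real^3 \<Rightarrow> real^3 \<Rightarrow> real^3" where
  "tilt t \<sigma> z = (1 - t / 2) *\<^sub>R z + (t / 2 * norm z) *\<^sub>R \<sigma>"

lemma measurable_tilt [measurable]:
  assumes [measurable]: "f \<in> borel_measurable M" "g \<in> borel_measurable M" "h \<in> borel_measurable M"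
  shows "(\<lambda>x. tilt (f x) (g x) (h x)) \<in> borel_measurable M"
  unfolding tilt_def by measurable

lemma tilt_affine: "tilt t \<sigma> z = z + t *\<^sub>R (tilt 1 \<sigma> z - z)"
  by (simp add: tilt_def vec_eq_iff field_simps)

context
  fixes t :: real and \<sigma> :: "real^3"
  assumes t: "0 \<le> t" "t \<le> 1" and \<sigma>: "norm \<sigma> = 1"
begin

lemma sigma_inner: "\<sigma> \<bullet> \<sigma> = 1"
  using \<sigma> by (simp add: norm_eq_1)

lemma tilt_inner: "tilt t \<sigma> z \<bullet> \<sigma> = (1 - t / 2) * (z \<bullet> \<sigma>) + t / 2 * norm z"
  by (simp add: tilt_def inner_add_left sigma_inner)

lemma norm_tilt_sq:
  "(norm (tilt t \<sigma> z))\<^sup>2 = ((1 - t / 2)\<^sup>2 + (t / 2)\<^sup>2) * (norm z)\<^sup>2 + 2 * (1 - t / 2) * (t / 2) * (norm z * (z \<bullet> \<sigma>))"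
proof -
  have "(a *\<^sub>R z + c *\<^sub>R \<sigma>) \<bullet> (a *\<^sub>R z + c *\<^sub>R \<sigma>) = a\<^sup>2 * (z \<bullet> z) + 2 * a * c * (z \<bullet> \<sigma>) + c\<^sup>2" for a c
    by (simp add: inner_add_left inner_add_right sigma_inner inner_commute power2_eq_square algebra_simps)
  then have "(norm (tilt t \<sigma> z))\<^sup>2 = (1 - t / 2)\<^sup>2 * (norm z)\<^sup>2 + 2 * (1 - t / 2) * (t / 2 * norm z) * (z \<bullet> \<sigma>) + (t / 2 * norm z)\<^sup>2"
    unfolding power2_norm_eq_inner tilt_def by blast
  then show ?thesis by (simp add: field_simps power2_eq_square)
qed

lemma norm_tilt_le: "norm (tilt t \<sigma> z) \<le> norm z"
proof -
  have "norm (tilt t \<sigma> z) \<le> \<bar>1 - t / 2\<bar> * norm z + \<bar>t / 2 * norm z\<bar> * norm \<sigma>"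
    unfolding tilt_def by (rule order_trans[OF norm_triangle_ineq]) simp
  then show ?thesis using t \<sigma> by (simp add: algebra_simps)
qed

lemma norm_le_tilt:
  assumes "z \<bullet> \<sigma> \<ge> 0"
  shows "norm z \<le> sqrt 2 * norm (tilt t \<sigma> z)"
proof -
  have "(1 - t / 2)\<^sup>2 + (t / 2)\<^sup>2 - 1 / 2 = (1 - t)\<^sup>2 / 2" by (simp add: power2_eq_square field_simps)
  then have "1 / 2 \<le> (1 - t / 2)\<^sup>2 + (t / 2)\<^sup>2" using zero_le_power2[of "1 - t"] by linarith
  then have "1 / 2 * (norm z)\<^sup>2 \<le> ((1 - t / 2)\<^sup>2 + (t / 2)\<^sup>2) * (norm z)\<^sup>2"
    by (rule mult_right_mono) simp
  moreover have "0 \<le> 2 * (1 - t / 2) * (t / 2) * (norm z * (z \<bullet> \<sigma>))" using t assms by simp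
  ultimately have "(norm z)\<^sup>2 \<le> (sqrt 2 * norm (tilt t \<sigma> z))\<^sup>2"
    using norm_tilt_sq[of z] by (simp add: power_mult_distrib)
  then show ?thesis by (rule power2_le_imp_le) simp
qed

text \<open>Moving along the segment decreases the angle to \<open>\<sigma>\<close> without making it zero. Hence a weight that blows up at angle
zero only grows when it is evaluated at the end of the substitution.\<close>

lemma sgn_tilt_inner:
  assumes "z \<bullet> \<sigma> > 0"
  shows "sgn z \<bullet> \<sigma> \<le> sgn (tilt t \<sigma> z) \<bullet> \<sigma>"
    and "sgn z \<bullet> \<sigma> < 1 \<Longrightarrow> sgn (tilt t \<sigma> z) \<bullet> \<sigma> < 1"
proof -
  define u where "u = sgn z \<bullet> \<sigma>"
  have z: "z \<noteq> 0" using assms by auto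
  have zu: "z \<bullet> \<sigma> = norm z * u" using z by (simp add: u_def sgn_div_norm)
  have u: "0 < u" using assms z by (simp add: zu zero_less_mult_iff)
  have u1: "u \<le> 1" using norm_cauchy_schwarz[of "sgn z" \<sigma>] \<sigma> z by (simp add: u_def norm_sgn)
  define y where "y = tilt t \<sigma> z"
  have yp: "norm y > 0" using norm_le_tilt[of z] assms z by (cases "y = 0") (simp_all add: y_def)
  have yi: "y \<bullet> \<sigma> = norm z * ((1 - t / 2) * u + t / 2)"
    unfolding y_def tilt_inner zu by (simp add: algebra_simps)
  have "u * norm y \<le> u * norm z" using norm_tilt_le[of z] u by (simp add: y_def)
  also have "\<dots> \<le> y \<bullet> \<sigma>"
  proof -
    have "u \<le> (1 - t / 2) * u + t / 2"
      using mult_left_mono[OF u1, of "t / 2"] t by (simp add: algebra_simps)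
    then have "norm z * u \<le> norm z * ((1 - t / 2) * u + t / 2)" by (rule mult_left_mono) simp
    then show ?thesis unfolding yi by (simp add: mult.commute)
  qed
  finally show "u \<le> sgn (tilt t \<sigma> z) \<bullet> \<sigma>"
    using yp by (simp add: y_def[symmetric] sgn_div_norm field_simps)
  show "sgn (tilt t \<sigma> z) \<bullet> \<sigma> < 1" if "u < 1"
  proof -
    have *: "(norm y)\<^sup>2 - (y \<bullet> \<sigma>)\<^sup>2 = (norm z)\<^sup>2 * ((1 - t / 2)\<^sup>2 * (1 - u\<^sup>2))"
      unfolding yi norm_tilt_sq[of z, folded y_def] zu by (simp add: power2_eq_square field_simps)
    have "u\<^sup>2 < 1" using that u by (simp add: power_less_one_iff)
    have "(y \<bullet> \<sigma>)\<^sup>2 < (norm y)\<^sup>2"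
    proof -
      have "0 < (norm z)\<^sup>2 * ((1 - t / 2)\<^sup>2 * (1 - u\<^sup>2))"
        using z t \<open>u\<^sup>2 < 1\<close> by (intro mult_pos_pos) auto
      then show ?thesis using * by linarith
    qed
    then have "y \<bullet> \<sigma> < norm y" by (rule power2_less_imp_less) simp
    then show ?thesis using yp by (simp add: y_def[symmetric] sgn_div_norm field_simps)
  qed
qed

text \<open>Given \<open>y = tilt t \<sigma> z\<close>, the length of \<open>z\<close> solves \<open>(1 - t) \<rho>\<^sup>2 + t (y \<bullet> \<sigma>) \<rho> = \<bar>y\<bar>\<^sup>2\<close>, whose left-hand side is
strictly increasing for \<open>\<rho> \<ge> 0\<close>; the length determines \<open>z\<close>.\<close>

lemma inj_on_tilt: "inj_on (tilt t \<sigma>) {z. z \<bullet> \<sigma> > 0}"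
proof -
  have less: "tilt t \<sigma> z1 \<noteq> tilt t \<sigma> z2"
    if z: "z1 \<bullet> \<sigma> > 0" "z2 \<bullet> \<sigma> > 0" and n: "norm z1 < norm z2" for z1 z2
  proof
    assume eq: "tilt t \<sigma> z1 = tilt t \<sigma> z2"
    define y where "y = tilt t \<sigma> z1"
    have quad: "(1 - t) * (norm z)\<^sup>2 + t * (y \<bullet> \<sigma>) * norm z = (norm y)\<^sup>2" if "tilt t \<sigma> z = y" for z
      unfolding that[symmetric] norm_tilt_sq tilt_inner by (simp add: power2_eq_square field_simps)
    have yp: "y \<bullet> \<sigma> > 0"
      using t z by (simp add: y_def tilt_inner add_pos_nonneg)
    have n2: "(norm z1)\<^sup>2 < (norm z2)\<^sup>2" using n by (simp add: power_strict_mono)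
    have "(1 - t) * (norm z1)\<^sup>2 + t * (y \<bullet> \<sigma>) * norm z1 = (1 - t) * (norm z2)\<^sup>2 + t * (y \<bullet> \<sigma>) * norm z2"
      using quad[of z1] quad[of z2] eq y_def by simp
    moreover have "(1 - t) * (norm z1)\<^sup>2 + t * (y \<bullet> \<sigma>) * norm z1 < (1 - t) * (norm z2)\<^sup>2 + t * (y \<bullet> \<sigma>) * norm z2"
    proof (cases "t = 0")
      case True then show ?thesis using n2 by simp
    next
      case False
      have "(1 - t) * (norm z1)\<^sup>2 \<le> (1 - t) * (norm z2)\<^sup>2" using t n by (intro mult_left_mono power_mono) auto
      moreover have "t * (y \<bullet> \<sigma>) * norm z1 < t * (y \<bullet> \<sigma>) * norm z2"
        using False t yp n by (intro mult_strict_left_mono) auto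
      ultimately show ?thesis by linarith
    qed
    ultimately show False by simp
  qed
  show ?thesis
  proof (rule inj_onI)
    fix z1 z2 assume z: "z1 \<in> {z. z \<bullet> \<sigma> > 0}" "z2 \<in> {z. z \<bullet> \<sigma> > 0}" and eq: "tilt t \<sigma> z1 = tilt t \<sigma> z2"
    have "norm z1 = norm z2"
      using less[of z1 z2] less[of z2 z1] z eq by (metis mem_Collect_eq linorder_neqE_linordered_idom)
    then have "(1 - t / 2) *\<^sub>R z1 = (1 - t / 2) *\<^sub>R z2" using eq by (simp add: tilt_def)
    then show "z1 = z2" using t by simp
  qed
qed

lemma tilt_has_derivative:
  assumes "z \<noteq> 0"
  shows "(tilt t \<sigma> has_derivative (\<lambda>w. (1 - t / 2) *\<^sub>R w + (t / 2 * (sgn z \<bullet> w)) *\<^sub>R \<sigma>)) (at z)"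
  unfolding tilt_def[abs_def]
  by (auto intro!: derivative_eq_intros has_derivative_norm assms simp: inner_commute)

text \<open>A multiple of the identity plus a matrix of rank one.\<close>

lemma det_tilt:
  "det (matrix (\<lambda>w. (1 - t / 2) *\<^sub>R w + (t / 2 * (n \<bullet> w)) *\<^sub>R \<sigma>)) = (1 - t / 2)\<^sup>2 * (1 - t / 2 + t / 2 * (n \<bullet> \<sigma>))"
  by (simp add: det_3 matrix_def inner_axis inner_vec_def sum_3 axis_def power2_eq_square field_simps)

lemma tilt_measurable_z [measurable]: "tilt t \<sigma> \<in> borel_measurable borel"
  unfolding tilt_def[abs_def] by measurable

lemma half_space_borel [measurable]: "{z. z \<bullet> \<sigma> > 0} \<in> sets borel"
  by measurable

lemma nn_integral_tilt:
  fixes f :: "real^3 \<Rightarrow> ennreal"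
  assumes [measurable]: "f \<in> borel_measurable borel"
  shows "(\<integral>\<^sup>+z. ennreal ((1 - t / 2)\<^sup>2 * (1 - t / 2 + t / 2 * (sgn z \<bullet> \<sigma>))) * f (tilt t \<sigma> z) * indicator {z. z \<bullet> \<sigma> > 0} z \<partial>lborel)
    = (\<integral>\<^sup>+y. f y * indicator (tilt t \<sigma> ` {z. z \<bullet> \<sigma> > 0}) y \<partial>lebesgue)"
proof (rule nn_integral_change_of_variables)
  show "(\<lambda>z. (1 - t / 2)\<^sup>2 * (1 - t / 2 + t / 2 * (sgn z \<bullet> \<sigma>))) \<in> borel_measurable borel"
    by measurable
  show "(tilt t \<sigma> has_derivative (\<lambda>w. (1 - t / 2) *\<^sub>R w + (t / 2 * (sgn z \<bullet> w)) *\<^sub>R \<sigma>)) (at z)"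
    if "z \<in> {z. z \<bullet> \<sigma> > 0}" for z
    by (rule tilt_has_derivative) (use that in auto)
  show "(1 - t / 2)\<^sup>2 * (1 - t / 2 + t / 2 * (sgn z \<bullet> \<sigma>)) = \<bar>det (matrix (\<lambda>w. (1 - t / 2) *\<^sub>R w + (t / 2 * (sgn z \<bullet> w)) *\<^sub>R \<sigma>))\<bar>"
    if "z \<in> {z. z \<bullet> \<sigma> > 0}" for z
  proof -
    have "0 \<le> sgn z \<bullet> \<sigma>" using that by (simp add: sgn_div_norm)
    then show ?thesis unfolding det_tilt using t by (subst abs_of_nonneg) auto
  qed
qed (simp_all add: inj_on_tilt)

text \<open>On the half space \<open>z \<bullet> \<sigma> > 0\<close> the Jacobian is at least \<open>(1/2)\<^sup>2 (1/2)\<close>.\<close>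

lemma nn_integral_tilt_le:
  fixes f :: "real^3 \<Rightarrow> ennreal"
  assumes [measurable]: "f \<in> borel_measurable borel"
  shows "(\<integral>\<^sup>+z. f (tilt t \<sigma> z) * indicator {z. z \<bullet> \<sigma> > 0} z \<partial>lborel) \<le> 8 * (\<integral>\<^sup>+y. f y \<partial>lborel)"
proof -
  have "(\<integral>\<^sup>+z. f (tilt t \<sigma> z) * indicator {z. z \<bullet> \<sigma> > 0} z \<partial>lborel)
    \<le> (\<integral>\<^sup>+z. 8 * (ennreal ((1 - t / 2)\<^sup>2 * (1 - t / 2 + t / 2 * (sgn z \<bullet> \<sigma>))) * f (tilt t \<sigma> z) * indicator {z. z \<bullet> \<sigma> > 0} z) \<partial>lborel)"
  proof (rule nn_integral_mono)
    fix z :: "real^3"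
    show "f (tilt t \<sigma> z) * indicator {z. z \<bullet> \<sigma> > 0} z \<le> 8 * (ennreal ((1 - t / 2)\<^sup>2 * (1 - t / 2 + t / 2 * (sgn z \<bullet> \<sigma>))) * f (tilt t \<sigma> z) * indicator {z. z \<bullet> \<sigma> > 0} z)"
    proof (cases "z \<bullet> \<sigma> > 0")
      case True
      then have "0 \<le> sgn z \<bullet> \<sigma>" by (simp add: sgn_div_norm)
      then have "1 / 2 \<le> 1 - t / 2 + t / 2 * (sgn z \<bullet> \<sigma>)" using t mult_nonneg_nonneg[of "t / 2" "sgn z \<bullet> \<sigma>"] by linarith
      moreover have "(1 / 2)\<^sup>2 \<le> (1 - t / 2)\<^sup>2" using t by (intro power_mono) auto
      ultimately have "(1 / 2)\<^sup>2 * (1 / 2) \<le> (1 - t / 2)\<^sup>2 * (1 - t / 2 + t / 2 * (sgn z \<bullet> \<sigma>))"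
        by (intro mult_mono) auto
      then have "1 \<le> 8 * ((1 - t / 2)\<^sup>2 * (1 - t / 2 + t / 2 * (sgn z \<bullet> \<sigma>)))" by (simp add: power2_eq_square)
      then have "ennreal 1 \<le> ennreal (8 * ((1 - t / 2)\<^sup>2 * (1 - t / 2 + t / 2 * (sgn z \<bullet> \<sigma>))))" by (rule ennreal_leI)
      then have "1 \<le> 8 * ennreal ((1 - t / 2)\<^sup>2 * (1 - t / 2 + t / 2 * (sgn z \<bullet> \<sigma>)))"
        by (simp add: ennreal_mult')
      from mult_right_mono[OF this, of "f (tilt t \<sigma> z)"] show ?thesis using True by (simp add: mult.assoc)
    qed simp
  qed
  also have "\<dots> = 8 * (\<integral>\<^sup>+z. ennreal ((1 - t / 2)\<^sup>2 * (1 - t / 2 + t / 2 * (sgn z \<bullet> \<sigma>))) * f (tilt t \<sigma> z) * indicator {z. z \<bullet> \<sigma> > 0} z \<partial>lborel)"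
    by (rule nn_integral_cmult) measurable
  also have "\<dots> \<le> 8 * (\<integral>\<^sup>+y. f y \<partial>lebesgue)"
    unfolding nn_integral_tilt[OF assms]
    by (intro mult_left_mono nn_integral_mono) (auto simp: indicator_def)
  finally show ?thesis by (simp add: nn_integral_completion)
qed

end

text \<open>The post-collisional map halves the angle to \<open>\<sigma>\<close>, so it maps the half space onto the cone of half-angle \<open>\<pi>/4\<close>. The inverse
is \<open>z = 2 y - \<rho> \<sigma>\<close> with \<open>\<rho> = \<bar>y\<bar>\<^sup>2 / (y \<bullet> \<sigma>)\<close>.\<close>

lemma tilt_1_image:
  assumes \<sigma>: "norm \<sigma> = 1"
  shows "tilt 1 \<sigma> ` {z. z \<bullet> \<sigma> > 0} = {y. y \<bullet> \<sigma> > 0 \<and> (norm y)\<^sup>2 < 2 * (y \<bullet> \<sigma>)\<^sup>2}"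
proof (intro set_eqI iffI)
  have ss: "\<sigma> \<bullet> \<sigma> = 1" using \<sigma> by (simp add: norm_eq_1)
  {
    fix y assume "y \<in> tilt 1 \<sigma> ` {z. z \<bullet> \<sigma> > 0}"
    then obtain z where z: "z \<bullet> \<sigma> > 0" "y = tilt 1 \<sigma> z" by auto
    have yi: "y \<bullet> \<sigma> = (z \<bullet> \<sigma> + norm z) / 2" using tilt_inner[of 1 \<sigma> z] \<sigma> z by (simp add: field_simps)
    have yn: "(norm y)\<^sup>2 = norm z * (y \<bullet> \<sigma>)"
      unfolding yi using norm_tilt_sq[of 1 \<sigma> z] \<sigma> z by (simp add: power2_eq_square field_simps)
    have p: "y \<bullet> \<sigma> > 0" unfolding yi using z by (intro divide_pos_pos add_pos_nonneg) auto
    have "2 * (y \<bullet> \<sigma>)\<^sup>2 - (norm y)\<^sup>2 = (y \<bullet> \<sigma>) * (z \<bullet> \<sigma>)"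
      unfolding yn yi by (simp add: power2_eq_square field_simps)
    then have "(norm y)\<^sup>2 < 2 * (y \<bullet> \<sigma>)\<^sup>2" using mult_pos_pos[OF p z(1)] by linarith
    then show "y \<in> {y. y \<bullet> \<sigma> > 0 \<and> (norm y)\<^sup>2 < 2 * (y \<bullet> \<sigma>)\<^sup>2}"
      using p by simp
  next
    fix y assume "y \<in> {y. y \<bullet> \<sigma> > 0 \<and> (norm y)\<^sup>2 < 2 * (y \<bullet> \<sigma>)\<^sup>2}"
    then have y: "y \<bullet> \<sigma> > 0" "(norm y)\<^sup>2 < 2 * (y \<bullet> \<sigma>)\<^sup>2" by auto
    define \<rho> where "\<rho> = (norm y)\<^sup>2 / (y \<bullet> \<sigma>)"
    define z where "z = 2 *\<^sub>R y - \<rho> *\<^sub>R \<sigma>"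
    have \<rho>: "\<rho> \<ge> 0" "\<rho> * (y \<bullet> \<sigma>) = (norm y)\<^sup>2" using y by (auto simp: \<rho>_def)
    have "(norm z)\<^sup>2 = 4 * (norm y)\<^sup>2 - 4 * (\<rho> * (y \<bullet> \<sigma>)) + \<rho>\<^sup>2"
      unfolding power2_norm_eq_inner z_def
      by (simp add: inner_diff_left inner_diff_right inner_commute ss power2_eq_square algebra_simps)
    then have "(norm z)\<^sup>2 = \<rho>\<^sup>2" unfolding \<rho>(2) by simp
    then have nz: "norm z = \<rho>" using \<rho>(1) by (simp add: power2_eq_iff_nonneg)
    have "\<rho> < 2 * (y \<bullet> \<sigma>)" using y by (simp add: \<rho>_def field_simps power2_eq_square)
    then have "z \<bullet> \<sigma> > 0" by (simp add: z_def inner_diff_left ss)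
    moreover have "tilt 1 \<sigma> z = y" unfolding tilt_def nz by (simp add: z_def algebra_simps)
    ultimately show "y \<in> tilt 1 \<sigma> ` {z. z \<bullet> \<sigma> > 0}" by (auto intro!: image_eqI[of _ _ z])
  }
qed

section \<open>Integrals of angular kernels\<close>

interpretation lborel_sph: pair_sigma_finite "lborel :: (real^3) measure" sph
  by standard

lemma nn_integral_one_minus_powr:
  fixes a :: real
  assumes a: "-1 < a"
  shows "(\<integral>\<^sup>+t. ennreal ((1 - t) powr a) * indicator {-1<..<1} t \<partial>lborel) = ennreal (2 powr (a + 1) / (a + 1))"
proof -
  have "(\<integral>\<^sup>+x. ennreal (x powr a) * indicator {0..2} x \<partial>lborel) = ennreal (2 powr (a + 1) / (a + 1))"
    by (rule nn_integral_has_integral_lebesgue') (use a in \<open>auto intro!: has_integral_powr_from_0\<close>)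
  moreover have "(\<integral>\<^sup>+x. ennreal (x powr a) * indicator {0..2} x \<partial>lborel)
      = ennreal \<bar>-1\<bar> * (\<integral>\<^sup>+t. ennreal ((1 + -1 * t) powr a) * indicator {0..2} (1 + -1 * t) \<partial>lborel)"
    by (rule nn_integral_real_affine) auto
  moreover have "(\<integral>\<^sup>+t. ennreal ((1 + -1 * t) powr a) * indicator {0..2} (1 + -1 * t) \<partial>lborel)
      = (\<integral>\<^sup>+t. ennreal ((1 - t) powr a) * indicator {-1<..<1} t \<partial>lborel)"
    by (rule nn_integral_cong_AE, rule AE_mp[OF AE_lborel_singleton[of 1]],
        rule AE_mp[OF AE_lborel_singleton[of "-1"]], rule AE_I2) (auto simp: indicator_def)
  ultimately show ?thesis by simp
qed

lemma nn_integral_kernel_pre: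
  fixes f :: "real^3 \<Rightarrow> ennreal" and p :: "real \<Rightarrow> real"
  assumes [measurable]: "f \<in> borel_measurable borel" "p \<in> borel_measurable borel"
    and supp: "\<And>u. \<not> (0 < u \<and> u < 1) \<Longrightarrow> p u = 0" and nn: "\<And>u. 0 \<le> p u"
  shows "(\<integral>\<^sup>+\<sigma>. \<integral>\<^sup>+z. ennreal (norm z powr \<gamma> * p (sgn z \<bullet> \<sigma>)) * f z \<partial>lborel \<partial>sph)
    = ennreal (2 * pi) * (\<integral>\<^sup>+u. ennreal (p u) \<partial>lborel) * (\<integral>\<^sup>+z. ennreal (norm z powr \<gamma>) * f z \<partial>lborel)"
proof -
  have "(\<integral>\<^sup>+\<sigma>. \<integral>\<^sup>+z. ennreal (norm z powr \<gamma> * p (sgn z \<bullet> \<sigma>)) * f z \<partial>lborel \<partial>sph)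
     = (\<integral>\<^sup>+z. \<integral>\<^sup>+\<sigma>. ennreal (norm z powr \<gamma> * p (sgn z \<bullet> \<sigma>)) * f z \<partial>sph \<partial>lborel)"
    by (rule lborel_sph.Fubini') measurable
  also have "\<dots> = (\<integral>\<^sup>+z. (ennreal (2 * pi) * (\<integral>\<^sup>+u. ennreal (p u) \<partial>lborel)) * (ennreal (norm z powr \<gamma>) * f z) \<partial>lborel)"
  proof (rule nn_integral_cong_AE, rule AE_mp[OF AE_lborel_singleton[of 0]], rule AE_I2, rule impI)
    fix z :: "real^3" assume z: "z \<noteq> 0"
    have "(\<integral>\<^sup>+\<sigma>. ennreal (norm z powr \<gamma> * p (sgn z \<bullet> \<sigma>)) * f z \<partial>sph)
      = (\<integral>\<^sup>+\<sigma>. (ennreal (norm z powr \<gamma>) * f z) * ennreal (p (sgn z \<bullet> \<sigma>)) \<partial>sph)"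
      by (simp add: ennreal_mult' ac_simps)
    also have "\<dots> = (ennreal (norm z powr \<gamma>) * f z) * (\<integral>\<^sup>+\<sigma>. ennreal (p (sgn z \<bullet> \<sigma>)) \<partial>sph)"
      by (rule nn_integral_cmult) measurable
    also have "(\<integral>\<^sup>+\<sigma>. ennreal (p (sgn z \<bullet> \<sigma>)) \<partial>sph) = ennreal (2 * pi) * (\<integral>\<^sup>+u. ennreal (p u) * indicator {-1<..<1} u \<partial>lborel)"
      by (rule nn_integral_sph_inner) (use z in \<open>auto simp: norm_sgn\<close>)
    also have "(\<integral>\<^sup>+u. ennreal (p u) * indicator {-1<..<1} u \<partial>lborel) = (\<integral>\<^sup>+u. ennreal (p u) \<partial>lborel)"
      by (rule nn_integral_cong) (use supp in \<open>force simp: indicator_def\<close>)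
    finally show "(\<integral>\<^sup>+\<sigma>. ennreal (norm z powr \<gamma> * p (sgn z \<bullet> \<sigma>)) * f z \<partial>sph)
       = (ennreal (2 * pi) * (\<integral>\<^sup>+u. ennreal (p u) \<partial>lborel)) * (ennreal (norm z powr \<gamma>) * f z)"
      by (simp add: ac_simps)
  qed
  also have "\<dots> = ennreal (2 * pi) * (\<integral>\<^sup>+u. ennreal (p u) \<partial>lborel) * (\<integral>\<^sup>+z. ennreal (norm z powr \<gamma>) * f z \<partial>lborel)"
    by (rule nn_integral_cmult) measurable
  finally show ?thesis .
qed

text \<open>The substitution \<open>u = 2 \<tau>\<^sup>2 - 1\<close>, where \<open>u = cos \<theta>\<close> and \<open>\<tau> = cos (\<theta>/2)\<close>.\<close>

lemma nn_integral_half_angle: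
  fixes p :: "real \<Rightarrow> real"
  assumes [measurable]: "p \<in> borel_measurable borel"
    and supp: "\<And>u. \<not> (0 < u \<and> u < 1) \<Longrightarrow> p u = 0" and nn: "\<And>u. 0 \<le> p u"
  shows "(\<integral>\<^sup>+\<tau>. ennreal (4 * \<tau> powr (- 2 - \<gamma>) * p (2 * \<tau>\<^sup>2 - 1)) * (if 0 < \<tau> then 1 else 0) * indicator {-1<..<1} \<tau> \<partial>lborel)
    = (\<integral>\<^sup>+u. ennreal (p u * ((1 + u) / 2) powr (- (3 + \<gamma>) / 2)) \<partial>lborel)"
proof -
  let ?f = "\<lambda>u. ennreal (p u * ((1 + u) / 2) powr (- (3 + \<gamma>) / 2))"
  let ?g = "\<lambda>\<tau>::real. 2 * \<tau>\<^sup>2 - 1"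
  have "(\<integral>\<^sup>+u. ?f u \<partial>lborel) = (\<integral>\<^sup>+u. ?f u * indicator {?g (sqrt (1/2))..?g 1} u \<partial>lborel)"
    by (rule nn_integral_cong) (use supp in \<open>force simp: indicator_def\<close>)
  also have "\<dots> = (\<integral>\<^sup>+\<tau>. ?f (?g \<tau>) * ennreal (4 * \<tau>) * indicator {sqrt (1/2)..1} \<tau> \<partial>lborel)"
  proof (rule nn_integral_substitution_aux)
    have "0 \<le> sqrt (1 / 2 :: real)" by simp
    then show "0 \<le> 4 * \<tau>" if "\<tau> \<in> {sqrt (1/2)..1}" for \<tau> using that by (simp del: real_sqrt_ge_0_iff)
    show "(?g has_real_derivative 4 * \<tau>) (at \<tau>)" for \<tau>
      by (auto intro!: derivative_eq_intros)
  qed (auto intro!: continuous_intros)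
  also have "\<dots> = (\<integral>\<^sup>+\<tau>. ennreal (4 * \<tau> powr (- 2 - \<gamma>) * p (2 * \<tau>\<^sup>2 - 1)) * (if 0 < \<tau> then 1 else 0) * indicator {-1<..<1} \<tau> \<partial>lborel)"
  proof (rule nn_integral_cong)
    fix \<tau> :: real
    show "?f (?g \<tau>) * ennreal (4 * \<tau>) * indicator {sqrt (1/2)..1} \<tau>
      = ennreal (4 * \<tau> powr (- 2 - \<gamma>) * p (2 * \<tau>\<^sup>2 - 1)) * (if 0 < \<tau> then 1 else 0) * indicator {-1<..<1} \<tau>"
    proof (cases "0 < \<tau> \<and> 0 < ?g \<tau> \<and> ?g \<tau> < 1")
      case True
      have "\<tau>\<^sup>2 < 1\<^sup>2" using True by simp
      then have t1: "\<tau> < 1" by (rule power2_less_imp_less) simp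
      have "(sqrt (1/2))\<^sup>2 \<le> \<tau>\<^sup>2" using True by (simp add: power_divide)
      then have t2: "sqrt (1/2) \<le> \<tau>" by (rule power2_le_imp_le) (use True in simp)
      have "((1 + ?g \<tau>) / 2) powr (- (3 + \<gamma>) / 2) * (4 * \<tau>) = 4 * \<tau> powr (- 2 - \<gamma>)"
      proof -
        have "((1 + ?g \<tau>) / 2) powr (- (3 + \<gamma>) / 2) = (\<tau> powr 2) powr (- (3 + \<gamma>) / 2)"
          using True by (simp add: powr_numeral)
        also have "\<dots> = \<tau> powr (2 * (- (3 + \<gamma>) / 2))" by (rule powr_powr)
        also have "2 * (- (3 + \<gamma>) / 2) = - (3 + \<gamma>)" by simp
        finally have "((1 + ?g \<tau>) / 2) powr (- (3 + \<gamma>) / 2) * (4 * \<tau>) = 4 * (\<tau> powr (- (3 + \<gamma>)) * \<tau> powr 1)"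
          using True by simp
        also have "\<dots> = 4 * \<tau> powr (- (3 + \<gamma>) + 1)" unfolding powr_add ..
        finally show ?thesis by simp
      qed
      then have e: "p (?g \<tau>) * ((1 + ?g \<tau>) / 2) powr (- (3 + \<gamma>) / 2) * (4 * \<tau>) = 4 * \<tau> powr (- 2 - \<gamma>) * p (?g \<tau>)"
        by (subst mult.assoc) (simp only: mult.commute[of "p (?g \<tau>)"])
      have m: "?f (?g \<tau>) * ennreal (4 * \<tau>) = ennreal (p (?g \<tau>) * ((1 + ?g \<tau>) / 2) powr (- (3 + \<gamma>) / 2) * (4 * \<tau>))"
        by (rule ennreal_mult[symmetric]) (use True nn in auto)
      show ?thesis unfolding m e using True t1 t2 by simp
    next
      case False
      moreover have "0 < sqrt (1 / 2 :: real)" by simp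
      ultimately show ?thesis
        using supp[of "?g \<tau>"] by (cases "0 < \<tau>") (auto simp: indicator_def simp del: real_sqrt_gt_0_iff)
    qed
  qed
  finally show ?thesis by simp
qed

text \<open>At fixed \<open>\<sigma>\<close> substitute \<open>y = tilt 1 \<sigma> z\<close>. With \<open>\<tau>\<close> the cosine of the angle between \<open>y\<close> and \<open>\<sigma>\<close> one has
\<open>\<bar>y\<bar> = \<tau> \<bar>z\<bar>\<close>, \<open>u = 2 \<tau>\<^sup>2 - 1\<close> and Jacobian \<open>\<tau>\<^sup>2 / 4\<close>. The remaining integral over \<open>\<sigma>\<close> has the same value for all \<open>y\<close>.\<close>

lemma nn_integral_kernel_post:
  fixes f :: "real^3 \<Rightarrow> ennreal" and p :: "real \<Rightarrow> real"
  assumes [measurable]: "f \<in> borel_measurable borel" "p \<in> borel_measurable borel"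
    and supp: "\<And>u. \<not> (0 < u \<and> u < 1) \<Longrightarrow> p u = 0" and nn: "\<And>u. 0 \<le> p u"
  shows "(\<integral>\<^sup>+\<sigma>. \<integral>\<^sup>+z. ennreal (norm z powr \<gamma> * p (sgn z \<bullet> \<sigma>)) * f (tilt 1 \<sigma> z) \<partial>lborel \<partial>sph)
    = ennreal (2 * pi) * (\<integral>\<^sup>+u. ennreal (p u * ((1 + u) / 2) powr (- (3 + \<gamma>) / 2)) \<partial>lborel)
      * (\<integral>\<^sup>+z. ennreal (norm z powr \<gamma>) * f z \<partial>lborel)"
proof -
  define H where "H \<tau> = ennreal (4 * \<tau> powr (- 2 - \<gamma>) * p (2 * \<tau>\<^sup>2 - 1)) * (if 0 < \<tau> then 1 else 0)" for \<tau>
  have [measurable]: "H \<in> borel_measurable borel" unfolding H_def by measurable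
  have inner: "(\<integral>\<^sup>+z. ennreal (norm z powr \<gamma> * p (sgn z \<bullet> \<sigma>)) * f (tilt 1 \<sigma> z) \<partial>lborel)
      = (\<integral>\<^sup>+y. H (sgn y \<bullet> \<sigma>) * (ennreal (norm y powr \<gamma>) * f y) \<partial>lborel)"
    if \<sigma>: "norm \<sigma> = 1" for \<sigma>
  proof -
    have [measurable]: "tilt 1 \<sigma> \<in> borel_measurable borel"
      using tilt_measurable_z[of 1 \<sigma>] \<sigma> by simp
    let ?g = "\<lambda>y. H (sgn y \<bullet> \<sigma>) * (ennreal (norm y powr \<gamma>) * f y)"
    have "(\<integral>\<^sup>+z. ennreal (norm z powr \<gamma> * p (sgn z \<bullet> \<sigma>)) * f (tilt 1 \<sigma> z) \<partial>lborel)
      = (\<integral>\<^sup>+z. ennreal ((1 - 1 / 2)\<^sup>2 * (1 - 1 / 2 + 1 / 2 * (sgn z \<bullet> \<sigma>))) * ?g (tilt 1 \<sigma> z) * indicator {z. z \<bullet> \<sigma> > 0} z \<partial>lborel)"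
    proof (rule nn_integral_cong)
      fix z :: "real^3"
      show "ennreal (norm z powr \<gamma> * p (sgn z \<bullet> \<sigma>)) * f (tilt 1 \<sigma> z)
        = ennreal ((1 - 1 / 2)\<^sup>2 * (1 - 1 / 2 + 1 / 2 * (sgn z \<bullet> \<sigma>))) * ?g (tilt 1 \<sigma> z) * indicator {z. z \<bullet> \<sigma> > 0} z"
      proof (cases "z \<bullet> \<sigma> > 0")
        case True
        define y where "y = tilt 1 \<sigma> z"
        define u where "u = sgn z \<bullet> \<sigma>"
        define \<tau> where "\<tau> = sgn y \<bullet> \<sigma>"
        have z: "norm z > 0" using True by auto
        have u: "u > 0" using True z by (simp add: u_def sgn_div_norm)
        have zu: "z \<bullet> \<sigma> = norm z * u" using z by (simp add: u_def sgn_div_norm)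
        have yi: "y \<bullet> \<sigma> = norm z * ((1 + u) / 2)"
          using tilt_inner[of 1 \<sigma> z] \<sigma> by (simp add: y_def zu field_simps)
        have yn: "(norm y)\<^sup>2 = (norm z)\<^sup>2 * ((1 + u) / 2)"
          using norm_tilt_sq[of 1 \<sigma> z] \<sigma> by (simp add: y_def zu power2_eq_square field_simps)
        have "(norm y)\<^sup>2 > 0" unfolding yn using z u by (intro mult_pos_pos) auto
        then have yp: "norm y > 0" by simp
        have \<tau>y: "norm y * \<tau> = y \<bullet> \<sigma>" using yp by (simp add: \<tau>_def sgn_div_norm)
        have "(norm z * \<tau>) * norm y = norm z * (y \<bullet> \<sigma>)" by (simp add: \<tau>y[symmetric])
        also have "\<dots> = norm y * norm y" unfolding power2_eq_square[symmetric] yn yi by (simp add: power2_eq_square)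
        finally have zt: "norm z * \<tau> = norm y" using yp by simp
        then have \<tau>: "\<tau> > 0" using yp z zero_less_mult_pos[of "norm z" \<tau>] by simp
        have t2: "\<tau>\<^sup>2 = (1 + u) / 2"
        proof -
          have "(norm z)\<^sup>2 * \<tau>\<^sup>2 = (norm z)\<^sup>2 * ((1 + u) / 2)"
            using yn unfolding zt[symmetric] power_mult_distrib .
          then show ?thesis using z by simp
        qed
        have "(1 - 1 / 2)\<^sup>2 * (1 - 1 / 2 + 1 / 2 * u) * ((4 * \<tau> powr (- 2 - \<gamma>) * p (2 * \<tau>\<^sup>2 - 1)) * norm y powr \<gamma>)
          = norm z powr \<gamma> * p u"
        proof -
          have "norm y powr \<gamma> = norm z powr \<gamma> * \<tau> powr \<gamma>" unfolding zt[symmetric] using z \<tau> by (simp add: powr_mult)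
          moreover have "\<tau>\<^sup>2 * (\<tau> powr (- 2 - \<gamma>) * \<tau> powr \<gamma>) = 1"
          proof -
            have "\<tau>\<^sup>2 * (\<tau> powr (- 2 - \<gamma>) * \<tau> powr \<gamma>) = \<tau> powr 2 * (\<tau> powr (- 2 - \<gamma>) * \<tau> powr \<gamma>)"
              using \<tau> by (simp add: powr_numeral)
            also have "\<dots> = \<tau> powr 0" unfolding powr_add[symmetric] by simp
            finally show ?thesis using \<tau> by simp
          qed
          moreover have "2 * \<tau>\<^sup>2 - 1 = u" unfolding t2 by (simp add: field_simps)
          moreover have "(1 - 1 / 2)\<^sup>2 * (1 - 1 / 2 + 1 / 2 * u) = \<tau>\<^sup>2 / 4" 
            unfolding t2 by (simp add: power2_eq_square)
          ultimately have "(1 - 1 / 2)\<^sup>2 * (1 - 1 / 2 + 1 / 2 * u) * ((4 * \<tau> powr (- 2 - \<gamma>) * p (2 * \<tau>\<^sup>2 - 1)) * norm y powr \<gamma>)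
             = \<tau>\<^sup>2 / 4 * ((4 * \<tau> powr (- 2 - \<gamma>) * p u) * (norm z powr \<gamma> * \<tau> powr \<gamma>))"
            by (simp only:)
          also have "\<dots> = (\<tau>\<^sup>2 * (\<tau> powr (- 2 - \<gamma>) * \<tau> powr \<gamma>)) * (norm z powr \<gamma> * p u)"
            by (simp only: mult_ac times_divide_eq_left times_divide_eq_right)
          finally have "(1 - 1 / 2)\<^sup>2 * (1 - 1 / 2 + 1 / 2 * u) * ((4 * \<tau> powr (- 2 - \<gamma>) * p (2 * \<tau>\<^sup>2 - 1)) * norm y powr \<gamma>)
             = (\<tau>\<^sup>2 * (\<tau> powr (- 2 - \<gamma>) * \<tau> powr \<gamma>)) * (norm z powr \<gamma> * p u)" .
          then show ?thesis using \<open>\<tau>\<^sup>2 * (\<tau> powr (- 2 - \<gamma>) * \<tau> powr \<gamma>) = 1\<close> by simp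
        qed
        then have "ennreal (norm z powr \<gamma> * p u) * f y
          = ennreal ((1 - 1 / 2)\<^sup>2 * (1 - 1 / 2 + 1 / 2 * u) * ((4 * \<tau> powr (- 2 - \<gamma>) * p (2 * \<tau>\<^sup>2 - 1)) * norm y powr \<gamma>)) * f y"
          by simp
        also have "\<dots> = ennreal ((1 - 1 / 2)\<^sup>2 * (1 - 1 / 2 + 1 / 2 * u)) * (H \<tau> * (ennreal (norm y powr \<gamma>) * f y))"
          using u \<tau> nn[of "2 * \<tau>\<^sup>2 - 1"] unfolding H_def
          by (subst ennreal_mult, simp, simp, subst ennreal_mult[of _ "norm y powr \<gamma>"]) (simp_all add: mult.assoc)
        finally show ?thesis using True by (simp add: y_def[symmetric] u_def[symmetric] \<tau>_def[symmetric])
      next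
        case False
        then have "\<not> 0 < sgn z \<bullet> \<sigma>" by (auto simp: sgn_div_norm zero_less_mult_iff)
        then show ?thesis using False supp[of "sgn z \<bullet> \<sigma>"] by simp
      qed
    qed
    also have "\<dots> = (\<integral>\<^sup>+y. ?g y * indicator (tilt 1 \<sigma> ` {z. z \<bullet> \<sigma> > 0}) y \<partial>lebesgue)"
      by (rule nn_integral_tilt) (use \<sigma> in auto)
    also have "\<dots> = (\<integral>\<^sup>+y. ?g y \<partial>lborel)"
      unfolding nn_integral_completion
    proof (rule nn_integral_cong)
      fix y :: "real^3"
      show "?g y * indicator (tilt 1 \<sigma> ` {z. z \<bullet> \<sigma> > 0}) y = ?g y"
      proof (cases "y \<in> tilt 1 \<sigma> ` {z. z \<bullet> \<sigma> > 0}")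
        case False
        then have F: "\<not> (y \<bullet> \<sigma> > 0 \<and> (norm y)\<^sup>2 < 2 * (y \<bullet> \<sigma>)\<^sup>2)"
          unfolding tilt_1_image[OF \<sigma>] by simp
        have "H (sgn y \<bullet> \<sigma>) = 0"
        proof (cases "sgn y \<bullet> \<sigma> > 0")
          case True
          then have y: "y \<noteq> 0" by auto
          then have eq: "sgn y \<bullet> \<sigma> = (y \<bullet> \<sigma>) / norm y" by (simp add: sgn_div_norm field_simps)
          have "y \<bullet> \<sigma> > 0" using True y by (simp add: eq zero_less_divide_iff)
          with F have "2 * (y \<bullet> \<sigma>)\<^sup>2 \<le> (norm y)\<^sup>2" by simp
          then have "2 * (sgn y \<bullet> \<sigma>)\<^sup>2 - 1 \<le> 0" using y by (simp add: eq power_divide field_simps)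
          then show ?thesis using supp[of "2 * (sgn y \<bullet> \<sigma>)\<^sup>2 - 1"] by (simp add: H_def)
        qed (simp add: H_def)
        then show ?thesis by simp
      qed simp
    qed
    finally show ?thesis .
  qed
  have "(\<integral>\<^sup>+\<sigma>. \<integral>\<^sup>+z. ennreal (norm z powr \<gamma> * p (sgn z \<bullet> \<sigma>)) * f (tilt 1 \<sigma> z) \<partial>lborel \<partial>sph)
    = (\<integral>\<^sup>+\<sigma>. \<integral>\<^sup>+y. H (sgn y \<bullet> \<sigma>) * (ennreal (norm y powr \<gamma>) * f y) \<partial>lborel \<partial>sph)"
    by (rule nn_integral_cong_AE, rule AE_mp[OF AE_sph_norm], rule AE_I2) (simp add: inner)
  also have "\<dots> = (\<integral>\<^sup>+y. \<integral>\<^sup>+\<sigma>. H (sgn y \<bullet> \<sigma>) * (ennreal (norm y powr \<gamma>) * f y) \<partial>sph \<partial>lborel)"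
    by (rule lborel_sph.Fubini') measurable
  also have "\<dots> = (\<integral>\<^sup>+y. (ennreal (2 * pi) * (\<integral>\<^sup>+\<tau>. H \<tau> * indicator {-1<..<1} \<tau> \<partial>lborel)) * (ennreal (norm y powr \<gamma>) * f y) \<partial>lborel)"
  proof (rule nn_integral_cong_AE, rule AE_mp[OF AE_lborel_singleton[of 0]], rule AE_I2, rule impI)
    fix y :: "real^3" assume y: "y \<noteq> 0"
    have "(\<integral>\<^sup>+\<sigma>. H (sgn y \<bullet> \<sigma>) * (ennreal (norm y powr \<gamma>) * f y) \<partial>sph)
      = (\<integral>\<^sup>+\<sigma>. H (sgn y \<bullet> \<sigma>) \<partial>sph) * (ennreal (norm y powr \<gamma>) * f y)"
      by (rule nn_integral_multc) measurable
    also have "(\<integral>\<^sup>+\<sigma>. H (sgn y \<bullet> \<sigma>) \<partial>sph) = ennreal (2 * pi) * (\<integral>\<^sup>+\<tau>. H \<tau> * indicator {-1<..<1} \<tau> \<partial>lborel)"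
      by (rule nn_integral_sph_inner) (use y in \<open>auto simp: norm_sgn\<close>)
    finally show "(\<integral>\<^sup>+\<sigma>. H (sgn y \<bullet> \<sigma>) * (ennreal (norm y powr \<gamma>) * f y) \<partial>sph)
      = (ennreal (2 * pi) * (\<integral>\<^sup>+\<tau>. H \<tau> * indicator {-1<..<1} \<tau> \<partial>lborel)) * (ennreal (norm y powr \<gamma>) * f y)" .
  qed
  also have "\<dots> = (ennreal (2 * pi) * (\<integral>\<^sup>+\<tau>. H \<tau> * indicator {-1<..<1} \<tau> \<partial>lborel)) * (\<integral>\<^sup>+y. ennreal (norm y powr \<gamma>) * f y \<partial>lborel)"
    by (rule nn_integral_cmult) measurable
  also have "(\<integral>\<^sup>+\<tau>. H \<tau> * indicator {-1<..<1} \<tau> \<partial>lborel) = (\<integral>\<^sup>+u. ennreal (p u * ((1 + u) / 2) powr (- (3 + \<gamma>) / 2)) \<partial>lborel)"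
    unfolding H_def by (rule nn_integral_half_angle[OF _ supp nn]) measurable
  finally show ?thesis .
qed

lemma norm_tilt_diff:
  assumes \<sigma>: "norm \<sigma> = 1"
  shows "norm (tilt 1 \<sigma> z - z) = norm z * sqrt ((1 - sgn z \<bullet> \<sigma>) / 2)"
proof (cases "z = 0")
  case False
  then have zu: "z \<bullet> \<sigma> = norm z * (sgn z \<bullet> \<sigma>)" by (simp add: sgn_div_norm)
  have ss: "\<sigma> \<bullet> \<sigma> = 1" using \<sigma> by (simp add: norm_eq_1)
  have "tilt 1 \<sigma> z - z = (1 / 2) *\<^sub>R (norm z *\<^sub>R \<sigma> - z)"
    by (simp add: tilt_def vec_eq_iff field_simps)
  then have "norm (tilt 1 \<sigma> z - z) = norm (norm z *\<^sub>R \<sigma> - z) / 2" by simp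
  then have "(norm (tilt 1 \<sigma> z - z))\<^sup>2 = (norm (norm z *\<^sub>R \<sigma> - z))\<^sup>2 / 4" by (simp only: power_divide) simp
  also have "(norm (norm z *\<^sub>R \<sigma> - z))\<^sup>2 = 2 * (norm z)\<^sup>2 - 2 * norm z * (z \<bullet> \<sigma>)"
  proof -
    have "(norm (norm z *\<^sub>R \<sigma> - z))\<^sup>2 = norm z * norm z * (\<sigma> \<bullet> \<sigma>) - 2 * norm z * (z \<bullet> \<sigma>) + z \<bullet> z"
      unfolding power2_norm_eq_inner
      by (simp add: inner_diff_left inner_diff_right inner_commute algebra_simps)
    then show ?thesis using ss by (simp add: power2_norm_eq_inner[symmetric] power2_eq_square)
  qed
  also have "(2 * (norm z)\<^sup>2 - 2 * norm z * (z \<bullet> \<sigma>)) / 4 = (norm z)\<^sup>2 * ((1 - sgn z \<bullet> \<sigma>) / 2)"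
    unfolding zu by (simp add: field_simps power2_eq_square)
  finally have "(norm (tilt 1 \<sigma> z - z))\<^sup>2 = (norm z)\<^sup>2 * ((1 - sgn z \<bullet> \<sigma>) / 2)" .
  then have "sqrt ((norm (tilt 1 \<sigma> z - z))\<^sup>2) = sqrt ((norm z)\<^sup>2 * ((1 - sgn z \<bullet> \<sigma>) / 2))"
    by (rule arg_cong)
  then show ?thesis by (simp only: real_sqrt_mult real_sqrt_abs abs_norm_cancel)
qed (simp add: tilt_def)

text \<open>The part of the collision kernel that matters almost everywhere: \<open>q\<close> is the angular function restricted to
\<open>0 < u < 1\<close>, as a function of the cosine \<open>u\<close> of the deviation angle.\<close>

locale angular_kernel =
  fixes \<gamma> s K :: real and q :: "real \<Rightarrow> real"
  assumes \<gamma>: "0 < \<gamma>" "\<gamma> < 1" and s: "0 < s" "s < 1 / 2" and K: "0 \<le> K"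
    and q_measurable [measurable]: "q \<in> borel_measurable borel"
    and q_nonneg: "0 \<le> q u"
    and q_supp: "\<not> (0 < u \<and> u < 1) \<Longrightarrow> q u = 0"
    and q_le: "0 < u \<Longrightarrow> u < 1 \<Longrightarrow> q u \<le> K * (1 - u) powr (- 1 - s)"
begin

definition kern :: "real^3 \<Rightarrow> real^3 \<Rightarrow> real" where
  "kern z \<sigma> = norm z powr \<gamma> * q (sgn z \<bullet> \<sigma>)"

text \<open>The mass of \<open>(1 - u) powr (- 1 / 2 - s)\<close> on \<open>(-1, 1)\<close>; it is finite because \<open>s < 1/2\<close>.\<close>

definition A :: real where
  "A = 2 powr (1 / 2 - s) / (1 / 2 - s)"

lemma A_pos: "0 < A"
  using s by (simp add: A_def)

lemma kern_nonneg: "0 \<le> kern z \<sigma>"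
  by (simp add: kern_def q_nonneg)

lemma measurable_kern [measurable]:
  assumes [measurable]: "f \<in> borel_measurable M" "g \<in> borel_measurable M"
  shows "(\<lambda>x. kern (f x) (g x)) \<in> borel_measurable M"
  unfolding kern_def by measurable

lemma nn_integral_singularity:
  "(\<integral>\<^sup>+u. ennreal ((1 - u) powr (- 1 / 2 - s)) * indicator {-1<..<1} u \<partial>lborel) = ennreal A"
  using nn_integral_one_minus_powr[of "- 1 / 2 - s"] s by (simp add: A_def)

lemma q_sqrt_le:
  assumes "0 < u" "u < 1"
  shows "q u * sqrt ((1 - u) / 2) \<le> K * (1 - u) powr (- 1 / 2 - s)"
proof -
  have "q u * sqrt ((1 - u) / 2) \<le> (K * (1 - u) powr (- 1 - s)) * (1 - u) powr (1 / 2)"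
  proof (rule mult_mono)
    have "sqrt ((1 - u) / 2) \<le> sqrt (1 - u)" using assms by simp
    then show "sqrt ((1 - u) / 2) \<le> (1 - u) powr (1 / 2)" using assms by (simp add: powr_half_sqrt)
  qed (use q_le assms K in auto)
  also have "\<dots> = K * (1 - u) powr ((- 1 - s) + 1 / 2)" unfolding powr_add by simp
  finally show ?thesis by simp
qed

text \<open>The deflection contributes \<open>sqrt (1 - u)\<close>, which lowers the order of the singularity to \<open>1/2 + s < 1\<close>.\<close>

lemma kern_deflection_le:
  assumes \<sigma>: "norm \<sigma> = 1"
  shows "kern z \<sigma> * norm (tilt 1 \<sigma> z - z)
    \<le> (if 0 < sgn z \<bullet> \<sigma> \<and> sgn z \<bullet> \<sigma> < 1 then K * norm z powr (\<gamma> + 1) * (1 - sgn z \<bullet> \<sigma>) powr (- 1 / 2 - s) else 0)"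
proof (cases "0 < sgn z \<bullet> \<sigma> \<and> sgn z \<bullet> \<sigma> < 1")
  case True
  have z: "norm z > 0" using True by auto
  have "kern z \<sigma> * norm (tilt 1 \<sigma> z - z) = (norm z powr \<gamma> * norm z) * (q (sgn z \<bullet> \<sigma>) * sqrt ((1 - sgn z \<bullet> \<sigma>) / 2))"
    by (simp add: kern_def norm_tilt_diff[OF \<sigma>])
  also have "\<dots> \<le> (norm z powr \<gamma> * norm z) * (K * (1 - sgn z \<bullet> \<sigma>) powr (- 1 / 2 - s))"
    using q_sqrt_le[of "sgn z \<bullet> \<sigma>"] True by (intro mult_left_mono) auto
  also have "norm z powr \<gamma> * norm z = norm z powr (\<gamma> + 1)"
    using z by (simp add: powr_add)
  finally show ?thesis using True by (simp add: mult_ac)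
qed (auto simp: kern_def q_supp)

lemma nn_integral_kern_deflection:
  "(\<integral>\<^sup>+\<sigma>. ennreal (kern z \<sigma> * norm (tilt 1 \<sigma> z - z)) \<partial>sph) \<le> ennreal (2 * pi * K * A * norm z powr (\<gamma> + 1))"
proof (cases "z = 0")
  case False
  have "(\<integral>\<^sup>+\<sigma>. ennreal (kern z \<sigma> * norm (tilt 1 \<sigma> z - z)) \<partial>sph)
    \<le> (\<integral>\<^sup>+\<sigma>. ennreal (K * norm z powr (\<gamma> + 1)) * ennreal ((1 - sgn z \<bullet> \<sigma>) powr (- 1 / 2 - s)) \<partial>sph)"
  proof (rule nn_integral_mono_AE, rule AE_mp[OF AE_sph_norm], rule AE_I2, rule impI)
    fix \<sigma> :: "real^3" assume "norm \<sigma> = 1"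
    from order_trans[OF kern_deflection_le[OF this, of z]]
    have "kern z \<sigma> * norm (tilt 1 \<sigma> z - z) \<le> K * norm z powr (\<gamma> + 1) * (1 - sgn z \<bullet> \<sigma>) powr (- 1 / 2 - s)"
      using K by simp
    then show "ennreal (kern z \<sigma> * norm (tilt 1 \<sigma> z - z)) \<le> ennreal (K * norm z powr (\<gamma> + 1)) * ennreal ((1 - sgn z \<bullet> \<sigma>) powr (- 1 / 2 - s))"
      using K by (simp add: ennreal_mult'[symmetric] ennreal_leI)
  qed
  also have "\<dots> = ennreal (K * norm z powr (\<gamma> + 1)) * (\<integral>\<^sup>+\<sigma>. ennreal ((1 - sgn z \<bullet> \<sigma>) powr (- 1 / 2 - s)) \<partial>sph)"
    by (rule nn_integral_cmult) measurable
  also have "(\<integral>\<^sup>+\<sigma>. ennreal ((1 - sgn z \<bullet> \<sigma>) powr (- 1 / 2 - s)) \<partial>sph) = ennreal (2 * pi) * ennreal A"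
    using nn_integral_sph_inner[of "\<lambda>u. ennreal ((1 - u) powr (- 1 / 2 - s))" "sgn z"] False nn_integral_singularity
    by (simp add: norm_sgn)
  also have "ennreal (K * norm z powr (\<gamma> + 1)) * (ennreal (2 * pi) * ennreal A) = ennreal (2 * pi * K * A * norm z powr (\<gamma> + 1))"
    using K A_pos by (simp add: ennreal_mult'[symmetric] mult_ac)
  finally show ?thesis .
qed (simp add: tilt_def)

definition tilt_const :: real where
  "tilt_const = 8 * (K * (sqrt 2 powr (\<gamma> + 1) * (2 * pi * A)))"

lemma tilt_const_nonneg: "0 \<le> tilt_const"
  using K A_pos by (simp add: tilt_const_def)

text \<open>Bound the kernel by a function of the intermediate point \<open>y = tilt t \<sigma> z\<close> alone, using that \<open>\<bar>z\<bar> \<le> sqrt 2 \<bar>y\<bar>\<close> and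
that \<open>y\<close> makes a smaller angle with \<open>\<sigma>\<close> than \<open>z\<close>; then substitute \<open>y\<close> for \<open>z\<close> and integrate over \<open>\<sigma>\<close> first.\<close>

lemma nn_integral_kern_deflection_tilt:
  fixes G :: "real^3 \<Rightarrow> ennreal"
  assumes t: "0 \<le> t" "t \<le> 1" and [measurable]: "G \<in> borel_measurable borel"
  shows "(\<integral>\<^sup>+\<sigma>. \<integral>\<^sup>+z. ennreal (kern z \<sigma> * norm (tilt 1 \<sigma> z - z)) * G (tilt t \<sigma> z) \<partial>lborel \<partial>sph)
    \<le> ennreal tilt_const * (\<integral>\<^sup>+y. ennreal (norm y powr (\<gamma> + 1)) * G y \<partial>lborel)"
proof -
  define c where "c = K * sqrt 2 powr (\<gamma> + 1)"
  have c: "0 \<le> c" using K by (simp add: c_def)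
  define \<Phi> where "\<Phi> \<sigma> y = ennreal (c * norm y powr (\<gamma> + 1) * (1 - sgn y \<bullet> \<sigma>) powr (- 1 / 2 - s)) * G y" for \<sigma> y
  have [measurable]: "(\<lambda>(\<sigma>, y). \<Phi> \<sigma> y) \<in> borel_measurable (borel \<Otimes>\<^sub>M borel)"
    unfolding \<Phi>_def by measurable
  have "(\<integral>\<^sup>+\<sigma>. \<integral>\<^sup>+z. ennreal (kern z \<sigma> * norm (tilt 1 \<sigma> z - z)) * G (tilt t \<sigma> z) \<partial>lborel \<partial>sph)
    \<le> (\<integral>\<^sup>+\<sigma>. 8 * (\<integral>\<^sup>+y. \<Phi> \<sigma> y \<partial>lborel) \<partial>sph)"
  proof (rule nn_integral_mono_AE, rule AE_mp[OF AE_sph_norm], rule AE_I2, rule impI)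
    fix \<sigma> :: "real^3" assume \<sigma>: "norm \<sigma> = 1"
    have "(\<integral>\<^sup>+z. ennreal (kern z \<sigma> * norm (tilt 1 \<sigma> z - z)) * G (tilt t \<sigma> z) \<partial>lborel)
      \<le> (\<integral>\<^sup>+z. \<Phi> \<sigma> (tilt t \<sigma> z) * indicator {z. z \<bullet> \<sigma> > 0} z \<partial>lborel)"
    proof (rule nn_integral_mono)
      fix z :: "real^3"
      let ?u = "sgn z \<bullet> \<sigma>" and ?y = "tilt t \<sigma> z"
      show "ennreal (kern z \<sigma> * norm (tilt 1 \<sigma> z - z)) * G ?y \<le> \<Phi> \<sigma> ?y * indicator {z. z \<bullet> \<sigma> > 0} z"
      proof (cases "0 < ?u \<and> ?u < 1")
        case True
        then have z: "z \<noteq> 0" by auto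
        then have zs: "z \<bullet> \<sigma> > 0" using True by (simp add: sgn_div_norm zero_less_mult_iff)
        have 1: "norm z powr (\<gamma> + 1) \<le> sqrt 2 powr (\<gamma> + 1) * norm ?y powr (\<gamma> + 1)"
        proof -
          have "norm z powr (\<gamma> + 1) \<le> (sqrt 2 * norm ?y) powr (\<gamma> + 1)"
            using norm_le_tilt[OF t \<sigma>, of z] zs \<gamma> by (intro powr_mono2) auto
          then show ?thesis by (simp add: powr_mult)
        qed
        have 2: "(1 - ?u) powr (- 1 / 2 - s) \<le> (1 - sgn ?y \<bullet> \<sigma>) powr (- 1 / 2 - s)"
          using sgn_tilt_inner[OF t \<sigma> zs] True s by (intro powr_mono2') auto
        have "kern z \<sigma> * norm (tilt 1 \<sigma> z - z) \<le> K * norm z powr (\<gamma> + 1) * (1 - ?u) powr (- 1 / 2 - s)"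
          using kern_deflection_le[OF \<sigma>, of z] True by simp
        also have "\<dots> \<le> K * (sqrt 2 powr (\<gamma> + 1) * norm ?y powr (\<gamma> + 1)) * (1 - sgn ?y \<bullet> \<sigma>) powr (- 1 / 2 - s)"
          using 1 2 K by (intro mult_mono mult_left_mono) auto
        also have "\<dots> = c * norm ?y powr (\<gamma> + 1) * (1 - sgn ?y \<bullet> \<sigma>) powr (- 1 / 2 - s)"
          by (simp add: c_def)
        finally have "ennreal (kern z \<sigma> * norm (tilt 1 \<sigma> z - z)) \<le> ennreal (c * norm ?y powr (\<gamma> + 1) * (1 - sgn ?y \<bullet> \<sigma>) powr (- 1 / 2 - s))"
          by (rule ennreal_leI)
        then show ?thesis using zs by (simp add: \<Phi>_def mult_right_mono)
      next
        case False
        then have "kern z \<sigma> = 0" by (simp add: kern_def q_supp)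
        then show ?thesis by simp
      qed
    qed
    also have "\<dots> \<le> 8 * (\<integral>\<^sup>+y. \<Phi> \<sigma> y \<partial>lborel)"
      by (rule nn_integral_tilt_le[OF t \<sigma>]) measurable
    finally show "(\<integral>\<^sup>+z. ennreal (kern z \<sigma> * norm (tilt 1 \<sigma> z - z)) * G (tilt t \<sigma> z) \<partial>lborel) \<le> 8 * (\<integral>\<^sup>+y. \<Phi> \<sigma> y \<partial>lborel)" .
  qed
  also have "\<dots> = 8 * (\<integral>\<^sup>+\<sigma>. \<integral>\<^sup>+y. \<Phi> \<sigma> y \<partial>lborel \<partial>sph)"
    by (rule nn_integral_cmult) measurable
  also have "(\<integral>\<^sup>+\<sigma>. \<integral>\<^sup>+y. \<Phi> \<sigma> y \<partial>lborel \<partial>sph) = (\<integral>\<^sup>+y. \<integral>\<^sup>+\<sigma>. \<Phi> \<sigma> y \<partial>sph \<partial>lborel)"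
    by (rule lborel_sph.Fubini') measurable
  also have "\<dots> = (\<integral>\<^sup>+y. ennreal (c * (2 * pi * A)) * (ennreal (norm y powr (\<gamma> + 1)) * G y) \<partial>lborel)"
  proof (rule nn_integral_cong_AE, rule AE_mp[OF AE_lborel_singleton[of 0]], rule AE_I2, rule impI)
    fix y :: "real^3" assume y: "y \<noteq> 0"
    have "(\<integral>\<^sup>+\<sigma>. \<Phi> \<sigma> y \<partial>sph) = (\<integral>\<^sup>+\<sigma>. (ennreal (c * norm y powr (\<gamma> + 1)) * G y) * ennreal ((1 - sgn y \<bullet> \<sigma>) powr (- 1 / 2 - s)) \<partial>sph)"
      unfolding \<Phi>_def using c by (intro nn_integral_cong) (simp add: ennreal_mult mult_ac)
    also have "\<dots> = (ennreal (c * norm y powr (\<gamma> + 1)) * G y) * (\<integral>\<^sup>+\<sigma>. ennreal ((1 - sgn y \<bullet> \<sigma>) powr (- 1 / 2 - s)) \<partial>sph)"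
      by (rule nn_integral_cmult) measurable
    also have "(\<integral>\<^sup>+\<sigma>. ennreal ((1 - sgn y \<bullet> \<sigma>) powr (- 1 / 2 - s)) \<partial>sph) = ennreal (2 * pi) * ennreal A"
      using nn_integral_sph_inner[of "\<lambda>u. ennreal ((1 - u) powr (- 1 / 2 - s))" "sgn y"] y nn_integral_singularity
      by (simp add: norm_sgn)
    also have "(ennreal (c * norm y powr (\<gamma> + 1)) * G y) * (ennreal (2 * pi) * ennreal A) = ennreal (c * (2 * pi * A)) * (ennreal (norm y powr (\<gamma> + 1)) * G y)"
      using c A_pos by (simp add: ennreal_mult mult_ac)
    finally show "(\<integral>\<^sup>+\<sigma>. \<Phi> \<sigma> y \<partial>sph) = ennreal (c * (2 * pi * A)) * (ennreal (norm y powr (\<gamma> + 1)) * G y)" .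
  qed
  also have "\<dots> = ennreal (c * (2 * pi * A)) * (\<integral>\<^sup>+y. ennreal (norm y powr (\<gamma> + 1)) * G y \<partial>lborel)"
    by (rule nn_integral_cmult) measurable
  also have "8 * (ennreal (c * (2 * pi * A)) * (\<integral>\<^sup>+y. ennreal (norm y powr (\<gamma> + 1)) * G y \<partial>lborel))
    = ennreal tilt_const * (\<integral>\<^sup>+y. ennreal (norm y powr (\<gamma> + 1)) * G y \<partial>lborel)"
  proof -
    have "8 * ennreal (c * (2 * pi * A)) = ennreal tilt_const"
      using c A_pos by (simp add: tilt_const_def c_def mult.assoc ennreal_mult'[symmetric] flip: ennreal_numeral)
    then show ?thesis by (simp add: mult.assoc[symmetric])
  qed
  finally show ?thesis .
qed

section \<open>The cancellation lemma\<close>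

text \<open>The kernel without grazing collisions. Its gain and loss parts converge separately, with angular masses
\<open>\<integral> cut n (u) du\<close> and \<open>\<integral> cut n (u) ((1 + u) / 2) powr (- (3 + \<gamma>) / 2) du\<close>, and these differ by a quantity bounded uniformly in \<open>n\<close>.\<close>

definition cut :: "nat \<Rightarrow> real \<Rightarrow> real" where
  "cut n u = (if u \<le> 1 - 1 / (real n + 2) then q u else 0)"

lemma cut_measurable [measurable]: "cut n \<in> borel_measurable borel"
  unfolding cut_def by measurable

lemma cut_nonneg: "0 \<le> cut n u" and cut_le: "cut n u \<le> q u"
  and cut_supp: "\<not> (0 < u \<and> u < 1) \<Longrightarrow> cut n u = 0"
  by (auto simp: cut_def q_nonneg q_supp)

lemma cut_tendsto: "(\<lambda>n. cut n u) \<longlonglongrightarrow> q u"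
proof (cases "u < 1")
  case True
  have "(\<lambda>n. 1 - 1 / (real n + 2)) \<longlonglongrightarrow> 1" by real_asymp
  then have "\<forall>\<^sub>F n in sequentially. u < 1 - 1 / (real n + 2)" using True by (rule order_tendstoD)
  then have "\<forall>\<^sub>F n in sequentially. cut n u = q u" by eventually_elim (simp add: cut_def)
  then show ?thesis by (rule tendsto_eventually)
next
  case False
  then have "q u = 0" by (simp add: q_supp)
  then show ?thesis by (simp add: cut_def cong: if_cong)
qed

text \<open>The power of \<open>cos (\<theta>/2)\<close> by which the angular density of the gain part exceeds that of the loss part.\<close>

definition cut_weight :: "real \<Rightarrow> real" where
  "cut_weight u = ((1 + u) / 2) powr (- (3 + \<gamma>) / 2)"

text \<open>With \<open>x = (1 + u) / 2 > 1/2\<close> the weight is at most \<open>1 / x\<^sup>2\<close>, and \<open>1 / x\<^sup>2 - 1 = (1 - x) (1 + x) / x\<^sup>2\<close>. The factor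
\<open>1 - u\<close> is what makes the difference of the angular masses finite.\<close>

lemma cut_weight_bounds:
  assumes "0 < u" "u < 1"
  shows "1 \<le> cut_weight u" "cut_weight u - 1 \<le> 4 * (1 - u)"
proof -
  define x where "x = (1 + u) / 2"
  have x: "1 / 2 < x" "x < 1" using assms by (auto simp: x_def)
  have "x powr 0 \<le> x powr (- (3 + \<gamma>) / 2)" using x \<gamma> by (intro powr_mono') auto
  then show "1 \<le> cut_weight u" using x by (simp add: cut_weight_def x_def)
  have "x powr (- (3 + \<gamma>) / 2) \<le> x powr (- 2)" using x \<gamma> by (intro powr_mono') auto
  also have "\<dots> = 1 / x\<^sup>2" unfolding powr_minus_divide using x by simp
  also have "1 / x\<^sup>2 \<le> 1 + 8 * (1 - x)"
  proof -
    have "1 + x \<le> 8 * x\<^sup>2"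
    proof -
      have "1 / 2 * (1 / 2) \<le> x * x" using x by (intro mult_mono) auto
      then show ?thesis using x unfolding power2_eq_square by linarith
    qed
    then have "(1 - x) * (1 + x) \<le> (1 - x) * (8 * x\<^sup>2)" using x by (intro mult_left_mono) auto
    then have "1 \<le> (1 + 8 * (1 - x)) * x\<^sup>2" by (simp add: algebra_simps power2_eq_square)
    then show ?thesis using x by (simp add: divide_le_eq)
  qed
  finally have "cut_weight u \<le> 1 + 8 * (1 - x)" unfolding cut_weight_def x_def .
  moreover have "8 * (1 - x) = 4 * (1 - u)" by (simp add: x_def field_simps)
  ultimately show "cut_weight u - 1 \<le> 4 * (1 - u)" by linarith
qed

lemma cut_masses:
  obtains p p' where "0 \<le> p" "p \<le> p'" "p' \<le> p + 4 * K * A"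
    "(\<integral>\<^sup>+u. ennreal (cut n u) \<partial>lborel) = ennreal p"
    "(\<integral>\<^sup>+u. ennreal (cut n u * ((1 + u) / 2) powr (- (3 + \<gamma>) / 2)) \<partial>lborel) = ennreal p'"
proof -
  define \<epsilon> where "\<epsilon> = 1 / (real n + 2)"
  have \<epsilon>: "0 < \<epsilon>" by (simp add: \<epsilon>_def)
  have b: "cut n u \<le> K * \<epsilon> powr (- 1 - s) * indicator {0..1} u" for u
  proof (cases "0 < u \<and> u < 1 \<and> u \<le> 1 - \<epsilon>")
    case True
    then have "(1 - u) powr (- 1 - s) \<le> \<epsilon> powr (- 1 - s)" using \<epsilon> s by (intro powr_mono2') auto
    then show ?thesis using True q_le[of u] K
      by (simp add: cut_def \<epsilon>_def[symmetric]) (meson mult_left_mono order_trans)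
  next
    case False
    then have "cut n u = 0" using q_supp[of u] by (auto simp: cut_def \<epsilon>_def[symmetric])
    then show ?thesis using K by simp
  qed
  have fin: "(\<integral>\<^sup>+u. ennreal (cut n u) \<partial>lborel) < \<infinity>"
  proof -
    have "(\<integral>\<^sup>+u. ennreal (cut n u) \<partial>lborel) \<le> (\<integral>\<^sup>+u. ennreal (K * \<epsilon> powr (- 1 - s)) * indicator {0..1::real} u \<partial>lborel)"
    proof (rule nn_integral_mono)
      fix u :: real
      show "ennreal (cut n u) \<le> ennreal (K * \<epsilon> powr (- 1 - s)) * indicator {0..1} u"
        using ennreal_leI[OF b[of u]] by (cases "u \<in> {0..1}") simp_all
    qed
    also have "\<dots> < \<infinity>" by (simp add: nn_integral_cmult_indicator ennreal_mult_less_top)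
    finally show ?thesis .
  qed
  then obtain p where p: "0 \<le> p" "(\<integral>\<^sup>+u. ennreal (cut n u) \<partial>lborel) = ennreal p"
    by (cases "\<integral>\<^sup>+u. ennreal (cut n u) \<partial>lborel") auto
  have [measurable]: "cut_weight \<in> borel_measurable borel" unfolding cut_weight_def by measurable
  have le: "ennreal p \<le> (\<integral>\<^sup>+u. ennreal (cut n u * cut_weight u) \<partial>lborel)"
    unfolding p(2)[symmetric]
  proof (intro nn_integral_mono ennreal_leI)
    fix u show "cut n u \<le> cut n u * cut_weight u"
      using cut_supp[of u n] cut_weight_bounds(1)[of u] cut_nonneg[of n u] mult_left_mono[of 1 "cut_weight u" "cut n u"] by fastforce
  qed
  have "(\<integral>\<^sup>+u. ennreal (cut n u * cut_weight u) \<partial>lborel)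
    \<le> (\<integral>\<^sup>+u. ennreal (cut n u) + ennreal (4 * K) * (ennreal ((1 - u) powr (- 1 / 2 - s)) * indicator {-1<..<1} u) \<partial>lborel)"
  proof (rule nn_integral_mono)
    fix u :: real
    show "ennreal (cut n u * cut_weight u) \<le> ennreal (cut n u) + ennreal (4 * K) * (ennreal ((1 - u) powr (- 1 / 2 - s)) * indicator {-1<..<1} u)"
    proof (cases "0 < u \<and> u < 1")
      case True
      then have u: "0 < u" "u < 1" by auto
      have "cut n u * (cut_weight u - 1) \<le> (K * (1 - u) powr (- 1 - s)) * (4 * (1 - u))"
        using cut_weight_bounds[OF u] cut_le[of n u] q_le[OF u] K u by (intro mult_mono) auto
      also have "\<dots> = 4 * K * (1 - u) powr (- 1 - s + 1)" using u unfolding powr_add by simp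
      also have "\<dots> \<le> 4 * K * (1 - u) powr (- 1 / 2 - s)"
        using u K by (intro mult_left_mono powr_mono') auto
      finally have "cut n u * cut_weight u \<le> cut n u + 4 * K * (1 - u) powr (- 1 / 2 - s)"
        by (simp add: algebra_simps)
      then have "ennreal (cut n u * cut_weight u) \<le> ennreal (cut n u + 4 * K * (1 - u) powr (- 1 / 2 - s))" by (rule ennreal_leI)
      also have "\<dots> = ennreal (cut n u) + ennreal (4 * K) * ennreal ((1 - u) powr (- 1 / 2 - s))"
        using K cut_nonneg by (simp add: ennreal_mult)
      finally show ?thesis using u by simp
    qed (use cut_supp in simp)
  qed
  also have "\<dots> = ennreal p + ennreal (4 * K) * ennreal A"
    by (subst nn_integral_add, simp, simp, subst nn_integral_cmult, simp, simp only: nn_integral_singularity p(2))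
  also have "\<dots> = ennreal (p + 4 * K * A)" using p K A_pos by (simp add: ennreal_mult)
  finally have up: "(\<integral>\<^sup>+u. ennreal (cut n u * cut_weight u) \<partial>lborel) \<le> ennreal (p + 4 * K * A)" .
  then obtain p' where p': "0 \<le> p'" "(\<integral>\<^sup>+u. ennreal (cut n u * cut_weight u) \<partial>lborel) = ennreal p'"
    by (cases "\<integral>\<^sup>+u. ennreal (cut n u * cut_weight u) \<partial>lborel") (auto simp: top_unique)
  show thesis
  proof (rule that[OF p(1) _ _ p(2) p'(2)[unfolded cut_weight_def]])
    show "p \<le> p'" using le p p' by simp
    have "0 \<le> p + 4 * K * A" using p K A_pos by simp
    then show "p' \<le> p + 4 * K * A" using up unfolding p'(2) by (simp only: ennreal_le_iff)
  qed
qed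

lemma cut_pair_integrals:
  fixes f :: "real^3 \<Rightarrow> real"
  assumes [measurable]: "f \<in> borel_measurable borel" and f: "\<And>x. 0 \<le> f x"
    and m: "(\<integral>\<^sup>+z. ennreal (norm z powr \<gamma> * f z) \<partial>lborel) = ennreal m" "0 \<le> m"
    and p: "0 \<le> p" "0 \<le> p'" "(\<integral>\<^sup>+u. ennreal (cut n u) \<partial>lborel) = ennreal p"
    "(\<integral>\<^sup>+u. ennreal (cut n u * ((1 + u) / 2) powr (- (3 + \<gamma>) / 2)) \<partial>lborel) = ennreal p'"
  shows "has_bochner_integral (lborel \<Otimes>\<^sub>M sph) (\<lambda>(z, \<sigma>). norm z powr \<gamma> * cut n (sgn z \<bullet> \<sigma>) * f z) (2 * pi * p * m)"
    and "has_bochner_integral (lborel \<Otimes>\<^sub>M sph) (\<lambda>(z, \<sigma>). norm z powr \<gamma> * cut n (sgn z \<bullet> \<sigma>) * f (tilt 1 \<sigma> z)) (2 * pi * p' * m)"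
proof -
  have m': "(\<integral>\<^sup>+z. ennreal (norm z powr \<gamma>) * ennreal (f z) \<partial>lborel) = ennreal m"
    unfolding m(1)[symmetric] by (intro nn_integral_cong) (simp add: ennreal_mult f)
  show "has_bochner_integral (lborel \<Otimes>\<^sub>M sph) (\<lambda>(z, \<sigma>). norm z powr \<gamma> * cut n (sgn z \<bullet> \<sigma>) * f z) (2 * pi * p * m)"
  proof (rule has_bochner_integral_nn_integral)
    have "(\<integral>\<^sup>+(z, \<sigma>). ennreal (norm z powr \<gamma> * cut n (sgn z \<bullet> \<sigma>) * f z) \<partial>(lborel \<Otimes>\<^sub>M sph))
      = (\<integral>\<^sup>+\<sigma>. \<integral>\<^sup>+z. ennreal (norm z powr \<gamma> * cut n (sgn z \<bullet> \<sigma>)) * ennreal (f z) \<partial>lborel \<partial>sph)"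
      by (subst lborel_sph.nn_integral_snd[symmetric]) (simp_all add: ennreal_mult cut_nonneg f)
    also have "\<dots> = ennreal (2 * pi) * ennreal p * ennreal m"
      by (subst nn_integral_kernel_pre) (simp_all add: cut_supp cut_nonneg p m')
    finally show "(\<integral>\<^sup>+x. ennreal (case x of (z, \<sigma>) \<Rightarrow> norm z powr \<gamma> * cut n (sgn z \<bullet> \<sigma>) * f z) \<partial>(lborel \<Otimes>\<^sub>M sph)) = ennreal (2 * pi * p * m)"
      using p m by (simp add: case_prod_beta' ennreal_mult)
  qed (use p m in \<open>auto simp: cut_nonneg f\<close>)
  show "has_bochner_integral (lborel \<Otimes>\<^sub>M sph) (\<lambda>(z, \<sigma>). norm z powr \<gamma> * cut n (sgn z \<bullet> \<sigma>) * f (tilt 1 \<sigma> z)) (2 * pi * p' * m)"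
  proof (rule has_bochner_integral_nn_integral)
    have "(\<integral>\<^sup>+(z, \<sigma>). ennreal (norm z powr \<gamma> * cut n (sgn z \<bullet> \<sigma>) * f (tilt 1 \<sigma> z)) \<partial>(lborel \<Otimes>\<^sub>M sph))
      = (\<integral>\<^sup>+\<sigma>. \<integral>\<^sup>+z. ennreal (norm z powr \<gamma> * cut n (sgn z \<bullet> \<sigma>)) * ennreal (f (tilt 1 \<sigma> z)) \<partial>lborel \<partial>sph)"
      by (subst lborel_sph.nn_integral_snd[symmetric]) (simp_all add: ennreal_mult cut_nonneg f)
    also have "\<dots> = ennreal (2 * pi) * ennreal p' * ennreal m"
    proof -
      have "(\<integral>\<^sup>+\<sigma>. \<integral>\<^sup>+z. ennreal (norm z powr \<gamma> * cut n (sgn z \<bullet> \<sigma>)) * ennreal (f (tilt 1 \<sigma> z)) \<partial>lborel \<partial>sph)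
        = ennreal (2 * pi) * (\<integral>\<^sup>+u. ennreal (cut n u * ((1 + u) / 2) powr (- (3 + \<gamma>) / 2)) \<partial>lborel)
          * (\<integral>\<^sup>+z. ennreal (norm z powr \<gamma>) * ennreal (f z) \<partial>lborel)"
        by (rule nn_integral_kernel_post) (simp_all add: cut_supp cut_nonneg)
      then show ?thesis unfolding p(4) m' .
    qed
    finally show "(\<integral>\<^sup>+x. ennreal (case x of (z, \<sigma>) \<Rightarrow> norm z powr \<gamma> * cut n (sgn z \<bullet> \<sigma>) * f (tilt 1 \<sigma> z)) \<partial>(lborel \<Otimes>\<^sub>M sph)) = ennreal (2 * pi * p' * m)"
      using p m by (simp add: case_prod_beta' ennreal_mult)
  qed (use p m in \<open>auto simp: cut_nonneg f\<close>)
qed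

text \<open>The cancellation lemma: for the truncated kernels the integral is exactly a bounded multiple of
\<open>\<integral> \<bar>z\<bar> powr \<gamma> h(z) dz\<close>, and integrability of the full integrand allows the truncation to be removed by dominated
convergence.\<close>

lemma cancellation:
  fixes h :: "real^3 \<Rightarrow> real"
  assumes [measurable]: "h \<in> borel_measurable borel"
    and fin: "(\<integral>\<^sup>+z. ennreal (norm z powr \<gamma> * \<bar>h z\<bar>) \<partial>lborel) < \<infinity>"
    and int: "integrable (lborel \<Otimes>\<^sub>M sph) (\<lambda>(z, \<sigma>). kern z \<sigma> * (h (tilt 1 \<sigma> z) - h z))"
  shows "ennreal \<bar>\<integral>(z, \<sigma>). kern z \<sigma> * (h (tilt 1 \<sigma> z) - h z) \<partial>(lborel \<Otimes>\<^sub>M sph)\<bar>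
    \<le> ennreal (8 * pi * K * A) * (\<integral>\<^sup>+z. ennreal (norm z powr \<gamma> * \<bar>h z\<bar>) \<partial>lborel)"
proof -
  let ?M = "lborel \<Otimes>\<^sub>M sph :: ((real^3) \<times> (real^3)) measure"
  define hp where "hp x = max (h x) 0" for x
  define hm where "hm x = max (- h x) 0" for x
  have [measurable]: "hp \<in> borel_measurable borel" "hm \<in> borel_measurable borel"
    unfolding hp_def hm_def by measurable
  have h: "h x = hp x - hm x" "\<bar>h x\<bar> = hp x + hm x" "0 \<le> hp x" "0 \<le> hm x" for x
    by (auto simp: hp_def hm_def)
  have sum: "(\<integral>\<^sup>+z. ennreal (norm z powr \<gamma> * \<bar>h z\<bar>) \<partial>lborel)
     = (\<integral>\<^sup>+z. ennreal (norm z powr \<gamma> * hp z) \<partial>lborel) + (\<integral>\<^sup>+z. ennreal (norm z powr \<gamma> * hm z) \<partial>lborel)"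
    by (subst nn_integral_add[symmetric]) (simp_all add: h(2-4) distrib_left)
  obtain mp where mp: "(\<integral>\<^sup>+z. ennreal (norm z powr \<gamma> * hp z) \<partial>lborel) = ennreal mp" "0 \<le> mp"
    using fin unfolding sum by (cases "\<integral>\<^sup>+z. ennreal (norm z powr \<gamma> * hp z) \<partial>lborel") auto
  obtain mm where mm: "(\<integral>\<^sup>+z. ennreal (norm z powr \<gamma> * hm z) \<partial>lborel) = ennreal mm" "0 \<le> mm"
    using fin unfolding sum by (cases "\<integral>\<^sup>+z. ennreal (norm z powr \<gamma> * hm z) \<partial>lborel") auto
  define I where "I n = (\<integral>(z, \<sigma>). norm z powr \<gamma> * cut n (sgn z \<bullet> \<sigma>) * (h (tilt 1 \<sigma> z) - h z) \<partial>?M)" for n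
  have bound: "\<bar>I n\<bar> \<le> 8 * pi * K * A * (mp + mm)" for n
  proof -
    obtain p p' where p: "0 \<le> p" "p \<le> p'" "p' \<le> p + 4 * K * A"
      "(\<integral>\<^sup>+u. ennreal (cut n u) \<partial>lborel) = ennreal p"
      "(\<integral>\<^sup>+u. ennreal (cut n u * ((1 + u) / 2) powr (- (3 + \<gamma>) / 2)) \<partial>lborel) = ennreal p'"
      by (rule cut_masses)
    have p': "0 \<le> p'" using p by simp
    note a = cut_pair_integrals[OF _ h(3) mp p(1) p' p(4,5)]
    note b = cut_pair_integrals[OF _ h(4) mm p(1) p' p(4,5)]
    have "has_bochner_integral ?M (\<lambda>x. ((case x of (z, \<sigma>) \<Rightarrow> norm z powr \<gamma> * cut n (sgn z \<bullet> \<sigma>) * hp (tilt 1 \<sigma> z))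
        - (case x of (z, \<sigma>) \<Rightarrow> norm z powr \<gamma> * cut n (sgn z \<bullet> \<sigma>) * hp z))
      - ((case x of (z, \<sigma>) \<Rightarrow> norm z powr \<gamma> * cut n (sgn z \<bullet> \<sigma>) * hm (tilt 1 \<sigma> z))
        - (case x of (z, \<sigma>) \<Rightarrow> norm z powr \<gamma> * cut n (sgn z \<bullet> \<sigma>) * hm z)))
      ((2 * pi * p' * mp - 2 * pi * p * mp) - (2 * pi * p' * mm - 2 * pi * p * mm))"
      by (intro has_bochner_integral_diff a b) measurable
    moreover have "(\<lambda>x. ((case x of (z, \<sigma>) \<Rightarrow> norm z powr \<gamma> * cut n (sgn z \<bullet> \<sigma>) * hp (tilt 1 \<sigma> z))
        - (case x of (z, \<sigma>) \<Rightarrow> norm z powr \<gamma> * cut n (sgn z \<bullet> \<sigma>) * hp z))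
      - ((case x of (z, \<sigma>) \<Rightarrow> norm z powr \<gamma> * cut n (sgn z \<bullet> \<sigma>) * hm (tilt 1 \<sigma> z))
        - (case x of (z, \<sigma>) \<Rightarrow> norm z powr \<gamma> * cut n (sgn z \<bullet> \<sigma>) * hm z)))
      = (\<lambda>(z, \<sigma>). norm z powr \<gamma> * cut n (sgn z \<bullet> \<sigma>) * (h (tilt 1 \<sigma> z) - h z))"
      by (auto simp: fun_eq_iff h(1) algebra_simps)
    ultimately have "I n = (2 * pi * p' * mp - 2 * pi * p * mp) - (2 * pi * p' * mm - 2 * pi * p * mm)"
      unfolding I_def by (simp add: has_bochner_integral_integral_eq)
    also have "\<dots> = 2 * pi * (p' - p) * (mp - mm)" by (simp add: algebra_simps)
    finally have "\<bar>I n\<bar> = 2 * pi * (p' - p) * \<bar>mp - mm\<bar>" using p by (simp add: abs_mult)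
    also have "\<dots> \<le> 2 * pi * (4 * K * A) * (mp + mm)"
      using p mp mm K A_pos by (intro mult_mono) auto
    finally show ?thesis by simp
  qed
  have lim: "I \<longlonglongrightarrow> (\<integral>(z, \<sigma>). kern z \<sigma> * (h (tilt 1 \<sigma> z) - h z) \<partial>?M)"
    unfolding I_def
  proof (rule integral_dominated_convergence)
    show "integrable ?M (\<lambda>x. \<bar>case x of (z, \<sigma>) \<Rightarrow> kern z \<sigma> * (h (tilt 1 \<sigma> z) - h z)\<bar>)"
      using int by simp
    show "AE x in ?M. (\<lambda>n. case x of (z, \<sigma>) \<Rightarrow> norm z powr \<gamma> * cut n (sgn z \<bullet> \<sigma>) * (h (tilt 1 \<sigma> z) - h z))
        \<longlonglongrightarrow> (case x of (z, \<sigma>) \<Rightarrow> kern z \<sigma> * (h (tilt 1 \<sigma> z) - h z))"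
      unfolding kern_def by (intro AE_I2) (auto intro!: tendsto_intros cut_tendsto)
    show "AE x in ?M. norm (case x of (z, \<sigma>) \<Rightarrow> norm z powr \<gamma> * cut n (sgn z \<bullet> \<sigma>) * (h (tilt 1 \<sigma> z) - h z))
       \<le> \<bar>case x of (z, \<sigma>) \<Rightarrow> kern z \<sigma> * (h (tilt 1 \<sigma> z) - h z)\<bar>" for n
      unfolding kern_def
      by (intro AE_I2) (auto simp: abs_mult cut_nonneg q_nonneg cut_le intro!: mult_mono)
  qed measurable
  have "\<bar>\<integral>(z, \<sigma>). kern z \<sigma> * (h (tilt 1 \<sigma> z) - h z) \<partial>?M\<bar> \<le> 8 * pi * K * A * (mp + mm)"
    by (rule LIMSEQ_le_const2[OF tendsto_rabs[OF lim]]) (use bound in auto)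
  then have "ennreal \<bar>\<integral>(z, \<sigma>). kern z \<sigma> * (h (tilt 1 \<sigma> z) - h z) \<partial>?M\<bar> \<le> ennreal (8 * pi * K * A * (mp + mm))"
    by (rule ennreal_leI)
  also have "\<dots> = ennreal (8 * pi * K * A) * (\<integral>\<^sup>+z. ennreal (norm z powr \<gamma> * \<bar>h z\<bar>) \<partial>lborel)"
    unfolding sum mp mm using mp mm K A_pos by (simp add: ennreal_mult ennreal_plus[symmetric] del: ennreal_plus)
  finally show ?thesis .
qed

end

section \<open>A class of smooth functions\<close>

text \<open>The functions \<open>p(1/t) exp (- 1/t)\<close> extended by zero: a family that is closed under differentiation and contains
cut-offs.\<close>

definition flat :: "real poly \<Rightarrow> real \<Rightarrow> real" where
  "flat p t = (if 0 < t then poly p (1 / t) * exp (- (1 / t)) else 0)"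

lemma poly_exp_tendsto_0: "((\<lambda>y::real. poly p y * exp (- y)) \<longlongrightarrow> 0) at_top"
proof -
  have "((\<lambda>y::real. \<Sum>i\<le>degree p. coeff p i * (y ^ i / exp y)) \<longlongrightarrow> (\<Sum>i\<le>degree p. coeff p i * 0)) at_top"
    by (intro tendsto_intros tendsto_power_div_exp_0)
  then show ?thesis
    by (simp add: poly_altdef sum_distrib_right exp_minus divide_inverse mult.assoc)
qed

text \<open>At the origin both the derivative and the difference quotient tend to zero, since \<open>exp (- 1/t)\<close> beats every power of \<open>1/t\<close>.\<close>

lemma flat_has_derivative:
  "(flat p has_real_derivative flat ((p - pderiv p) * [:0, 0, 1:]) t) (at t)"
proof (cases t "0::real" rule: linorder_cases)
  case less
  have "((\<lambda>t. 0) has_real_derivative 0) (at t)" by simp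
  then have "(flat p has_real_derivative 0) (at t)"
    by (rule has_field_derivative_transform_within_open[of _ _ _ "{..<0}"]) (use less in \<open>auto simp: flat_def\<close>)
  then show ?thesis using less by (simp add: flat_def)
next
  case greater
  have "((\<lambda>t. poly p (1 / t) * exp (- (1 / t))) has_real_derivative
      (poly p (1 / t) * (exp (- (1 / t)) * (1 / t\<^sup>2)) + (poly (pderiv p) (1 / t) * (- (1 / t\<^sup>2))) * exp (- (1 / t)))) (at t)"
    using greater by (auto intro!: derivative_eq_intros poly_DERIV[THEN DERIV_chain2] simp: power2_eq_square)
  then have "((\<lambda>t. poly p (1 / t) * exp (- (1 / t))) has_real_derivative flat ((p - pderiv p) * [:0, 0, 1:]) t) (at t)"
    using greater by (simp add: flat_def algebra_simps power2_eq_square)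
  then show ?thesis
    by (rule has_field_derivative_transform_within_open[of _ _ _ "{0<..}"]) (use greater in \<open>auto simp: flat_def\<close>)
next
  case equal
  have r: "((\<lambda>h. (flat p (0 + h) - flat p 0) / h) \<longlongrightarrow> 0) (at_right 0)"
  proof (rule Lim_transform_eventually)
    show "((\<lambda>h::real. poly (p * [:0, 1:]) (inverse h) * exp (- inverse h)) \<longlongrightarrow> 0) (at_right 0)"
      by (rule filterlim_compose[OF poly_exp_tendsto_0 filterlim_inverse_at_top_right])
    show "\<forall>\<^sub>F h in at_right 0. poly (p * [:0, 1:]) (inverse h) * exp (- inverse h) = (flat p (0 + h) - flat p 0) / h"
      using eventually_at_right_less[of "0::real"]
      by eventually_elim (simp add: flat_def field_simps)
  qed
  have l: "((\<lambda>h. (flat p (0 + h) - flat p 0) / h) \<longlongrightarrow> 0) (at_left 0)"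
  proof (rule Lim_transform_eventually[OF tendsto_const])
    have "\<forall>\<^sub>F h in at_left 0. h < (0::real)" by (simp add: eventually_at_filter)
    then show "\<forall>\<^sub>F h in at_left 0. 0 = (flat p (0 + h) - flat p 0) / h"
      by eventually_elim (simp add: flat_def)
  qed
  have "((\<lambda>h. (flat p (0 + h) - flat p 0) / h) \<longlongrightarrow> 0) (at 0)"
    by (rule filterlim_split_at[OF l r])
  then show ?thesis using equal by (simp add: DERIV_def flat_def)
qed

text \<open>A class of smooth functions closed under partial derivatives, large enough to contain mollifiers and their products
with powers of \<open>jb\<close>. Membership replaces all computations with higher derivatives.\<close>

inductive_set smooth_class :: "(real^3 \<Rightarrow> real) set" where
  const: "(\<lambda>x. c) \<in> smooth_class"
| coord: "(\<lambda>x. x $ i) \<in> smooth_class"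
| bracket: "(\<lambda>x. (1 + (norm x)\<^sup>2) powr a) \<in> smooth_class"
| flat: "(\<lambda>x. flat p (c + a * x $ i)) \<in> smooth_class"
| add: "f \<in> smooth_class \<Longrightarrow> g \<in> smooth_class \<Longrightarrow> (\<lambda>x. f x + g x) \<in> smooth_class"
| mult: "f \<in> smooth_class \<Longrightarrow> g \<in> smooth_class \<Longrightarrow> (\<lambda>x. f x * g x) \<in> smooth_class"

lemma partial_deriv_eq:
  "(f has_derivative f') (at x) \<Longrightarrow> partial_deriv i f x = f' (axis i 1)"
  by (simp add: partial_deriv_def frechet_derivative_at[symmetric])

lemma bracket_has_derivative:
  "((\<lambda>x::real^3. (1 + (norm x)\<^sup>2) powr a) has_derivative (\<lambda>w. (a * (1 + (norm x)\<^sup>2) powr (a - 1)) * (2 * (x \<bullet> w)))) (at x)"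
proof -
  have pos: "0 < 1 + (norm x)\<^sup>2" by (simp add: add_pos_nonneg)
  have n: "((\<lambda>x::real^3. (norm x)\<^sup>2) has_derivative (\<lambda>w. 2 * (x \<bullet> w))) (at x)"
    unfolding power2_norm_eq_inner
    by (auto intro!: derivative_eq_intros simp: inner_commute)
  have o: "((\<lambda>u. u powr a) has_real_derivative a * (1 + (norm x)\<^sup>2) powr (a - 1)) (at (1 + (norm x)\<^sup>2))"
    by (rule has_real_derivative_powr) (rule pos)
  have i: "((\<lambda>x::real^3. 1 + (norm x)\<^sup>2) has_derivative (\<lambda>w. 2 * (x \<bullet> w))) (at x)"
    by (auto intro!: derivative_eq_intros n)
  show ?thesis
    using has_derivative_compose[OF i o[THEN has_field_derivative_imp_has_derivative]] by simp
qed

lemma smooth_class_derivative: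
  assumes "f \<in> smooth_class"
  shows "(\<forall>x. f differentiable (at x)) \<and> (\<forall>i. partial_deriv i f \<in> smooth_class)"
  using assms
proof induction
  case (const c)
  have d: "((\<lambda>x::real^3. c) has_derivative (\<lambda>w. 0)) (at x)" for x by simp
  then have "partial_deriv i (\<lambda>x. c) = (\<lambda>x. 0)" for i by (auto simp: partial_deriv_eq[OF d])
  then show ?case using d smooth_class.const by (auto simp: differentiable_def)
next
  case (coord j)
  have d: "((\<lambda>x::real^3. x $ j) has_derivative (\<lambda>w. w $ j)) (at x)" for x
    by (rule bounded_linear_imp_has_derivative) (rule bounded_linear_vec_nth)
  then have "partial_deriv i (\<lambda>x. x $ j) = (\<lambda>x. axis i 1 $ j)" for i by (auto simp: partial_deriv_eq[OF d])
  then show ?case using d smooth_class.const by (auto simp: differentiable_def)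
next
  case (bracket a)
  note d = bracket_has_derivative[of a]
  have e: "partial_deriv i (\<lambda>x. (1 + (norm x)\<^sup>2) powr a) = (\<lambda>x. (2 * a) * (x $ i * (1 + (norm x)\<^sup>2) powr (a - 1)))" for i
    by (auto simp: partial_deriv_eq[OF d] inner_axis fun_eq_iff)
  have "(\<lambda>x. (2 * a) * (x $ i * (1 + (norm x)\<^sup>2) powr (a - 1))) \<in> smooth_class" for i
    by (intro smooth_class.intros)
  then show ?case unfolding e using d by (auto simp: differentiable_def)
next
  case (flat p c a j)
  let ?p' = "(p - pderiv p) * [:0, 0, 1:]"
  have d: "((\<lambda>x::real^3. flat p (c + a * x $ j)) has_derivative (\<lambda>w. flat ?p' (c + a * x $ j) * (a * w $ j))) (at x)" for x
  proof -
    have i: "((\<lambda>x::real^3. c + a * x $ j) has_derivative (\<lambda>w. a * w $ j)) (at x)"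
      by (auto intro!: derivative_eq_intros bounded_linear_imp_has_derivative bounded_linear_vec_nth)
    show ?thesis
      using has_derivative_compose[OF i flat_has_derivative[THEN has_field_derivative_imp_has_derivative]] .
  qed
  then have e: "partial_deriv i (\<lambda>x. flat p (c + a * x $ j)) = (\<lambda>x. flat ?p' (c + a * x $ j) * (a * axis i 1 $ j))" for i
    by (auto simp: partial_deriv_eq[OF d] fun_eq_iff)
  have "(\<lambda>x. flat ?p' (c + a * x $ j) * (a * axis i 1 $ j)) \<in> smooth_class" for i
    by (rule smooth_class.mult[OF smooth_class.flat smooth_class.const])
  then show ?case unfolding e using d by (auto simp: differentiable_def)
next
  case (add f g)
  have d: "((\<lambda>x. f x + g x) has_derivative (\<lambda>w. frechet_derivative f (at x) w + frechet_derivative g (at x) w)) (at x)" for x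
    using add.IH by (intro has_derivative_add) (auto simp: frechet_derivative_works)
  then have e: "partial_deriv i (\<lambda>x. f x + g x) = (\<lambda>x. partial_deriv i f x + partial_deriv i g x)" for i
    by (auto simp: partial_deriv_eq[OF d] partial_deriv_def fun_eq_iff)
  then show ?case unfolding e using d add.IH smooth_class.add by (auto simp: differentiable_def)
next
  case (mult f g)
  have d: "((\<lambda>x. f x * g x) has_derivative (\<lambda>w. f x * frechet_derivative g (at x) w + frechet_derivative f (at x) w * g x)) (at x)" for x
    using mult.IH by (intro has_derivative_mult) (auto simp: frechet_derivative_works)
  then have e: "partial_deriv i (\<lambda>x. f x * g x) = (\<lambda>x. f x * partial_deriv i g x + partial_deriv i f x * g x)" for i
    by (auto simp: partial_deriv_eq[OF d] partial_deriv_def fun_eq_iff)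
  have "(\<lambda>x. f x * partial_deriv i g x + partial_deriv i f x * g x) \<in> smooth_class" for i
    using mult by (intro smooth_class.intros) auto
  then show ?case unfolding e using d by (auto simp: differentiable_def)
qed

lemma smooth_class_differentiable: "f \<in> smooth_class \<Longrightarrow> f differentiable (at x)"
  and smooth_class_partial: "f \<in> smooth_class \<Longrightarrow> partial_deriv i f \<in> smooth_class"
  using smooth_class_derivative by auto

lemma smooth_class_continuous: "f \<in> smooth_class \<Longrightarrow> continuous_on A f"
  using smooth_class_differentiable by (meson continuous_at_imp_continuous_on differentiable_imp_continuous_within)

lemma smooth_class_measurable: "f \<in> smooth_class \<Longrightarrow> f \<in> borel_measurable borel"
  by (intro borel_measurable_continuous_onI smooth_class_continuous)

lemma partial_deriv_mult:
  assumes "f \<in> smooth_class" "g \<in> smooth_class"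
  shows "partial_deriv i (\<lambda>x. f x * g x) x = f x * partial_deriv i g x + partial_deriv i f x * g x"
proof -
  have "((\<lambda>x. f x * g x) has_derivative (\<lambda>w. f x * frechet_derivative g (at x) w + frechet_derivative f (at x) w * g x)) (at x)"
    using assms by (intro has_derivative_mult) (auto simp: frechet_derivative_works[symmetric] smooth_class_differentiable)
  from partial_deriv_eq[OF this, of i] show ?thesis unfolding partial_deriv_def .
qed

lemma smooth_class_test_function:
  assumes "\<phi> \<in> smooth_class" "compact (closure {x. \<phi> x \<noteq> 0})"
  shows "test_function \<phi>"
proof -
  have "foldr partial_deriv js \<phi> \<in> smooth_class" for js
    by (induction js) (auto simp: assms smooth_class_partial)
  then have "foldr partial_deriv js \<phi> differentiable_on UNIV" for js
    using smooth_class_differentiable by (auto simp: differentiable_on_def)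
  then show ?thesis using assms by (simp add: test_function_def)
qed

lemma smooth_class_has_derivative:
  assumes "f \<in> smooth_class"
  shows "(f has_derivative (\<lambda>w. \<Sum>i\<in>UNIV. w $ i * partial_deriv i f x)) (at x)"
proof -
  have d: "(f has_derivative frechet_derivative f (at x)) (at x)"
    using smooth_class_differentiable[OF assms] by (simp add: frechet_derivative_works)
  then have lin: "linear (frechet_derivative f (at x))" by (rule has_derivative_linear)
  have "frechet_derivative f (at x) w = (\<Sum>i\<in>UNIV. w $ i * partial_deriv i f x)" for w :: "real^3"
  proof -
    have "frechet_derivative f (at x) w = frechet_derivative f (at x) (\<Sum>i\<in>UNIV. w $ i *\<^sub>R axis i 1)"
      using basis_expansion[of w] by (simp add: scalar_mult_eq_scaleR)
    also have "\<dots> = (\<Sum>i\<in>UNIV. w $ i * partial_deriv i f x)"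
      by (simp add: linear_sum[OF lin] linear_scale[OF lin] partial_deriv_def)
    finally show ?thesis .
  qed
  then show ?thesis using d by (metis (no_types, lifting) ext)
qed

lemma smooth_class_prod:
  "finite I \<Longrightarrow> (\<And>i. i \<in> I \<Longrightarrow> f i \<in> smooth_class) \<Longrightarrow> (\<lambda>x. \<Prod>i\<in>I. f i x) \<in> smooth_class"
  by (induction I rule: finite_induct) (auto intro: smooth_class.intros)

section \<open>Mollifiers\<close>

definition bump :: "real \<Rightarrow> real^3 \<Rightarrow> real" where
  "bump \<delta> x = (\<Prod>i\<in>UNIV. flat [:1:] (\<delta> + x $ i) * flat [:1:] (\<delta> - x $ i))"

definition mollifier :: "real \<Rightarrow> real^3 \<Rightarrow> real" where
  "mollifier \<delta> x = bump \<delta> x / (\<integral>y. bump \<delta> y \<partial>lborel)"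

lemma flat_one: "flat [:1:] t = (if 0 < t then exp (- (1 / t)) else 0)"
  by (simp add: flat_def)

lemma bump_nonneg: "0 \<le> bump \<delta> x"
  unfolding bump_def by (intro prod_nonneg) (auto simp: flat_one)

lemma bump_pos_iff: "bump \<delta> x \<noteq> 0 \<longleftrightarrow> (\<forall>i. \<bar>x $ i\<bar> < \<delta>)"
proof -
  have "flat [:1:] (\<delta> + t) * flat [:1:] (\<delta> - t) \<noteq> 0 \<longleftrightarrow> \<bar>t\<bar> < \<delta>" for t
    by (auto simp: flat_one)
  then show ?thesis by (simp add: bump_def)
qed

lemma bump_smooth: "bump \<delta> \<in> smooth_class"
proof -
  have "(\<lambda>x. \<Prod>i\<in>UNIV. flat [:1:] (\<delta> + 1 * x $ i) * flat [:1:] (\<delta> + (-1) * x $ i)) \<in> smooth_class"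
    by (intro smooth_class_prod smooth_class.intros) auto
  then show ?thesis by (simp add: bump_def[abs_def])
qed

lemma bump_shift_smooth: "(\<lambda>y. bump \<delta> (u - y)) \<in> smooth_class"
proof -
  have "(\<lambda>y. \<Prod>i\<in>UNIV. flat [:1:] ((\<delta> + u $ i) + (-1) * y $ i) * flat [:1:] ((\<delta> - u $ i) + 1 * y $ i)) \<in> smooth_class"
    by (intro smooth_class_prod smooth_class.intros) auto
  then show ?thesis by (simp add: bump_def[abs_def] algebra_simps)
qed

lemma bump_minus: "bump \<delta> (- x) = bump \<delta> x"
  unfolding bump_def by (intro prod.cong) (simp_all add: mult.commute)

lemma bump_le_indicator: "bump \<delta> x \<le> indicator (cbox (\<chi> i. - \<delta>) (\<chi> i. \<delta>)) x"
proof (cases "x \<in> cbox (\<chi> i. - \<delta>) (\<chi> i. \<delta>)")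
  case True
  have 01: "0 \<le> flat [:1:] t \<and> flat [:1:] t \<le> 1" for t by (simp add: flat_one)
  have "bump \<delta> x \<le> 1"
    unfolding bump_def by (intro prod_le_1) (auto intro!: mult_nonneg_nonneg mult_le_one simp: 01)
  then show ?thesis using True by simp
next
  case False
  then obtain i where "\<not> (- \<delta> \<le> x $ i \<and> x $ i \<le> \<delta>)" by (auto simp: mem_box_cart)
  then have "\<not> \<bar>x $ i\<bar> < \<delta>" by auto
  then have "bump \<delta> x = 0" using bump_pos_iff[of \<delta> x] by blast
  then show ?thesis by simp
qed

lemma bump_integrable: "integrable lborel (bump \<delta>)"
proof (rule Bochner_Integration.integrable_bound)
  show "integrable lborel (indicat_real (cbox (\<chi> i. - \<delta>) (\<chi> i. \<delta>) :: (real^3) set))"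
    by (rule integrable_real_indicator) (auto intro: emeasure_bounded_finite[unfolded infinity_ennreal_def])
  show "bump \<delta> \<in> borel_measurable lborel" using smooth_class_measurable[OF bump_smooth] by simp
qed (use bump_le_indicator bump_nonneg in auto)

lemma bump_integral_pos:
  assumes "0 < \<delta>"
  shows "0 < (\<integral>y. bump \<delta> y \<partial>lborel)"
proof -
  have "(\<integral>y. bump \<delta> y \<partial>lborel) \<noteq> 0"
  proof
    assume "(\<integral>y. bump \<delta> y \<partial>lborel) = 0"
    then have "AE y in lborel. bump \<delta> y = 0"
      by (subst (asm) integral_nonneg_eq_0_iff_AE[OF bump_integrable]) (auto simp: bump_nonneg)
    then have "AE y in lborel. y \<notin> box (\<chi> i. - \<delta>) (\<chi> i. \<delta> :: real^3)"
    proof eventually_elim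
      case (elim y)
      then show ?case using bump_pos_iff[of \<delta> y] by (auto simp: mem_box_cart abs_less_iff) (metis minus_less_iff)
    qed
    then have "emeasure lborel (box (\<chi> i. - \<delta>) (\<chi> i. \<delta>) :: (real^3) set) = 0"
      by (subst (asm) AE_iff_measurable[OF _ refl]) auto
    moreover have "emeasure lborel (box (\<chi> i. - \<delta>) (\<chi> i. \<delta>) :: (real^3) set) = ennreal (\<Prod>b\<in>Basis. ((\<chi> i. \<delta>) - (\<chi> i. - \<delta>) :: real^3) \<bullet> b)"
      by (rule emeasure_lborel_box) (use assms in \<open>auto simp: Basis_vec_def inner_axis\<close>)
    moreover have "0 < (\<Prod>b\<in>Basis. ((\<chi> i. \<delta>) - (\<chi> i. - \<delta>) :: real^3) \<bullet> b)"
      by (intro prod_pos) (use assms in \<open>auto simp: Basis_vec_def inner_axis\<close>)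
    ultimately show False by (metis ennreal_eq_0_iff not_le)
  qed
  moreover have "0 \<le> (\<integral>y. bump \<delta> y \<partial>lborel)" by (simp add: bump_nonneg)
  ultimately show ?thesis by simp
qed

lemma mollifier_smooth: "mollifier \<delta> \<in> smooth_class"
  using smooth_class.mult[OF smooth_class.const[of "1 / (\<integral>y. bump \<delta> y \<partial>lborel)"] bump_smooth[of \<delta>]]
  by (simp add: mollifier_def[abs_def])

lemma mollifier_shift_smooth: "(\<lambda>y. mollifier \<delta> (x - y)) \<in> smooth_class"
  using smooth_class.mult[OF smooth_class.const[of "1 / (\<integral>y. bump \<delta> y \<partial>lborel)"] bump_shift_smooth[of \<delta> x]]
  by (simp add: mollifier_def[abs_def])

lemma mollifier_measurable [measurable]: "mollifier \<delta> \<in> borel_measurable borel"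
  by (rule smooth_class_measurable[OF mollifier_smooth])

lemma mollifier_partial_measurable [measurable]: "partial_deriv i (mollifier \<delta>) \<in> borel_measurable borel"
  by (rule smooth_class_measurable[OF smooth_class_partial[OF mollifier_smooth]])

context
  fixes \<delta> :: real
  assumes \<delta>: "0 < \<delta>"
begin

lemma mollifier_nonneg: "0 \<le> mollifier \<delta> x"
  using bump_integral_pos[OF \<delta>] by (simp add: mollifier_def bump_nonneg)

lemma mollifier_support: "3 * \<delta> < norm x \<Longrightarrow> mollifier \<delta> x = 0"
proof (rule ccontr)
  assume x: "3 * \<delta> < norm x" and "mollifier \<delta> x \<noteq> 0"
  then have "bump \<delta> x \<noteq> 0" by (auto simp: mollifier_def)
  then have b: "\<bar>x $ i\<bar> < \<delta>" for i using bump_pos_iff by blast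
  have "norm x \<le> (\<Sum>i\<in>UNIV. \<bar>x $ i\<bar>)" by (rule norm_le_l1_cart)
  also have "\<dots> \<le> 3 * \<delta>" using b[of 1] b[of 2] b[of 3] by (simp add: sum_3)
  finally show False using x by simp
qed

lemma nn_integral_mollifier: "(\<integral>\<^sup>+y. ennreal (mollifier \<delta> y) \<partial>lborel) = 1"
proof -
  have i: "integrable lborel (mollifier \<delta>)"
    unfolding mollifier_def[abs_def] using bump_integrable by simp
  have "(\<integral>\<^sup>+y. ennreal (mollifier \<delta> y) \<partial>lborel) = ennreal (\<integral>y. mollifier \<delta> y \<partial>lborel)"
    by (rule nn_integral_eq_integral[OF i]) (simp add: mollifier_nonneg)
  also have "(\<integral>y. mollifier \<delta> y \<partial>lborel) = 1"
    unfolding mollifier_def[abs_def] using bump_integral_pos[OF \<delta>] by simp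
  finally show ?thesis by simp
qed

lemma nn_integral_mollifier_shift:
  "(\<integral>\<^sup>+y. ennreal (mollifier \<delta> (x - y)) \<partial>lborel) = 1" "(\<integral>\<^sup>+x. ennreal (mollifier \<delta> (x - y)) \<partial>lborel) = 1"
proof -
  have a: "(\<integral>\<^sup>+z. ennreal (mollifier \<delta> (c + z)) \<partial>lborel) = 1" for c
    using nn_integral_shift[of "\<lambda>z. ennreal (mollifier \<delta> z)" c] nn_integral_mollifier by simp
  show "(\<integral>\<^sup>+x. ennreal (mollifier \<delta> (x - y)) \<partial>lborel) = 1" using a[of "- y"] by simp
  have "mollifier \<delta> (x - y) = mollifier \<delta> (- x + y)" for y
    using bump_minus[of \<delta> "x - y"] by (simp add: mollifier_def)
  then show "(\<integral>\<^sup>+y. ennreal (mollifier \<delta> (x - y)) \<partial>lborel) = 1" using a[of "- x"] by simp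
qed

lemma mollifier_bounded:
  obtains B where "\<And>x. \<bar>mollifier \<delta> x\<bar> \<le> B" "\<And>i x. \<bar>partial_deriv i (mollifier \<delta>) x\<bar> \<le> B"
proof -
  have bd: "\<exists>B. \<forall>x. \<bar>f x\<bar> \<le> B" if c: "continuous_on UNIV f" and z: "\<And>x. 3 * \<delta> < norm x \<Longrightarrow> f x = 0" for f :: "real^3 \<Rightarrow> real"
  proof -
    have "bounded (f ` cball 0 (3 * \<delta>))"
      by (intro compact_imp_bounded compact_continuous_image continuous_on_subset[OF c]) auto
    then obtain B where "\<forall>y\<in>f ` cball 0 (3 * \<delta>). norm y \<le> B"
      unfolding bounded_iff by blast
    then have B: "\<bar>f x\<bar> \<le> B" if "x \<in> cball 0 (3 * \<delta>)" for x using that by force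
    have "\<bar>f x\<bar> \<le> max B 0" for x
      using B[of x] z[of x] by (cases "norm x \<le> 3 * \<delta>") auto
    then show ?thesis by blast
  qed
  have z: "partial_deriv i (mollifier \<delta>) x = 0" if "3 * \<delta> < norm x" for i x
  proof -
    have o: "open {x :: real^3. 3 * \<delta> < norm x}" by (intro open_Collect_less continuous_intros)
    have "((\<lambda>x. 0) has_derivative (\<lambda>w. 0)) (at x)" by simp
    then have "(mollifier \<delta> has_derivative (\<lambda>w. 0)) (at x)"
      by (rule has_derivative_transform_within_open[OF _ o]) (use that mollifier_support in auto)
    then show ?thesis by (simp add: partial_deriv_eq)
  qed
  obtain B0 where B0: "\<And>x. \<bar>mollifier \<delta> x\<bar> \<le> B0"
    using bd[OF smooth_class_continuous[OF mollifier_smooth] mollifier_support] by blast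
  have "\<forall>i. \<exists>B. \<forall>x. \<bar>partial_deriv i (mollifier \<delta>) x\<bar> \<le> B"
    using bd[OF smooth_class_continuous[OF smooth_class_partial[OF mollifier_smooth]] z] by blast
  then obtain B1 where B1: "\<And>i x. \<bar>partial_deriv i (mollifier \<delta>) x\<bar> \<le> B1 i" by metis
  have "\<bar>partial_deriv i (mollifier \<delta>) x\<bar> \<le> B0 + (\<Sum>i\<in>UNIV. B1 i)" for i x
  proof -
    have "0 \<le> B1 j" for j using B1[of j 0] by linarith
    moreover from this have "B1 i \<le> (\<Sum>i\<in>UNIV. B1 i)" by (intro member_le_sum) auto
    moreover have "0 \<le> B0" using B0[of 0] by linarith
    ultimately show ?thesis using B1[of i x] by linarith
  qed
  moreover have "\<bar>mollifier \<delta> x\<bar> \<le> B0 + (\<Sum>i\<in>UNIV. B1 i)" for x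
  proof -
    have "0 \<le> B1 j" for j using B1[of j 0] by linarith
    then have "0 \<le> (\<Sum>i\<in>UNIV. B1 i)" by (intro sum_nonneg) auto
    then show ?thesis using B0[of x] by linarith
  qed
  ultimately show thesis using that by blast
qed

lemma mollifier_shift_compact: "compact (closure {y. mollifier \<delta> (x - y) \<noteq> 0})"
proof -
  have "{y. mollifier \<delta> (x - y) \<noteq> 0} \<subseteq> cball x (3 * \<delta>)"
  proof
    fix y assume "y \<in> {y. mollifier \<delta> (x - y) \<noteq> 0}"
    then have "\<not> 3 * \<delta> < norm (x - y)" using mollifier_support by blast
    then show "y \<in> cball x (3 * \<delta>)" by (simp add: dist_norm)
  qed
  then have "bounded {y. mollifier \<delta> (x - y) \<noteq> 0}" by (meson bounded_cball bounded_subset)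
  then show ?thesis by (simp add: compact_closure)
qed

lemma partial_deriv_mollifier_shift:
  "partial_deriv i (\<lambda>y. mollifier \<delta> (x - y)) y = - partial_deriv i (mollifier \<delta>) (x - y)"
proof -
  have i: "((\<lambda>y. x - y) has_derivative (\<lambda>w. - w)) (at y)" by (auto intro!: derivative_eq_intros)
  have "((\<lambda>y. mollifier \<delta> (x - y)) has_derivative (\<lambda>w. \<Sum>j\<in>UNIV. (- w) $ j * partial_deriv j (mollifier \<delta>) (x - y))) (at y)"
    by (rule has_derivative_compose[OF i smooth_class_has_derivative[OF mollifier_smooth]])
  then have "partial_deriv i (\<lambda>y. mollifier \<delta> (x - y)) y = (\<Sum>j\<in>UNIV. (- axis i 1) $ j * partial_deriv j (mollifier \<delta>) (x - y))"
    by (rule partial_deriv_eq)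
  also have "\<dots> = - (\<Sum>j\<in>UNIV. if j = i then partial_deriv j (mollifier \<delta>) (x - y) else 0)"
    unfolding sum_negf[symmetric] by (intro sum.cong) (auto simp: axis_def)
  finally show ?thesis by simp
qed

end

section \<open>Mollification of weakly differentiable functions\<close>

text \<open>Integration by parts against the smooth class instead of all test functions: below it is applied
to translated mollifiers.\<close>

definition weak_gradient :: "(real^3 \<Rightarrow> real) \<Rightarrow> (3 \<Rightarrow> real^3 \<Rightarrow> real) \<Rightarrow> bool" where
  "weak_gradient F G \<longleftrightarrow> integrable lborel F \<and> (\<forall>i. integrable lborel (G i)) \<and>
    (\<forall>\<phi>\<in>smooth_class. compact (closure {x. \<phi> x \<noteq> 0}) \<longrightarrow>
      (\<forall>i. (\<integral>x. F x * partial_deriv i \<phi> x \<partial>lborel) = - (\<integral>x. G i x * \<phi> x \<partial>lborel)))"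

lemma integrable_mult_bounded:
  fixes f g :: "real^3 \<Rightarrow> real"
  assumes "integrable lborel f" and [measurable]: "g \<in> borel_measurable borel" and "0 \<le> B" "\<And>x. \<bar>g x\<bar> \<le> B"
  shows "integrable lborel (\<lambda>x. f x * g x)"
proof (rule Bochner_Integration.integrable_bound[OF integrable_mult_right[OF assms(1), of B]])
  have [measurable]: "f \<in> borel_measurable borel" using borel_measurable_integrable[OF assms(1)] by simp
  show "(\<lambda>x. f x * g x) \<in> borel_measurable lborel" by measurable
  show "AE x in lborel. norm (f x * g x) \<le> norm (B * f x)"
    using assms(3,4) by (intro AE_I2) (auto simp: abs_mult mult.commute[of B] intro!: mult_left_mono)
qed

lemma weak_gradientD:
  assumes "weak_gradient F G" "\<phi> \<in> smooth_class" "compact (closure {x. \<phi> x \<noteq> 0})"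
  shows "(\<integral>x. F x * partial_deriv i \<phi> x \<partial>lborel) = - (\<integral>x. G i x * \<phi> x \<partial>lborel)"
  using assms by (simp add: weak_gradient_def)

definition mollify :: "real \<Rightarrow> (real^3 \<Rightarrow> real) \<Rightarrow> real^3 \<Rightarrow> real" where
  "mollify \<delta> F x = (\<integral>y. F y * mollifier \<delta> (x - y) \<partial>lborel)"

definition mollify_nn :: "real \<Rightarrow> (real^3 \<Rightarrow> real) \<Rightarrow> real^3 \<Rightarrow> ennreal" where
  "mollify_nn \<delta> F x = (\<integral>\<^sup>+y. ennreal \<bar>F y\<bar> * ennreal (mollifier \<delta> (x - y)) \<partial>lborel)"

lemma mollify_nn_measurable [measurable]:
  assumes [measurable]: "F \<in> borel_measurable borel"
  shows "mollify_nn \<delta> F \<in> borel_measurable borel"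
  unfolding mollify_nn_def by measurable

lemma mollify_measurable [measurable]:
  assumes [measurable]: "F \<in> borel_measurable borel"
  shows "mollify \<delta> F \<in> borel_measurable borel"
  unfolding mollify_def by measurable

text \<open>Apply the fundamental theorem of calculus to the mollifier along the segment from \<open>p\<close> to \<open>q\<close>, exchange the integrals,
and move the derivative from the mollifier to \<open>F\<close>. This avoids differentiating the convolution.\<close>

lemma mollify_difference:
  assumes \<delta>: "0 < \<delta>" and W: "weak_gradient F G"
  shows "ennreal \<bar>mollify \<delta> F q - mollify \<delta> F p\<bar>
    \<le> (\<integral>\<^sup>+t. indicator {0..1} t * (ennreal (norm (q - p)) * mollify_nn \<delta> (\<lambda>y. \<Sum>i\<in>UNIV. \<bar>G i y\<bar>) (p + t *\<^sub>R (q - p))) \<partial>lborel)"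
proof -
  let ?\<eta> = "mollifier \<delta>"
  define w where "w = q - p"
  define D where "D t y = (\<Sum>i\<in>UNIV. w $ i * partial_deriv i ?\<eta> (p + t *\<^sub>R w - y))" for t :: real and y
  have F: "integrable lborel F" and G: "\<And>i. integrable lborel (G i)" using W by (auto simp: weak_gradient_def)
  have [measurable]: "F \<in> borel_measurable borel" "\<And>i. G i \<in> borel_measurable borel"
    using borel_measurable_integrable[OF F] borel_measurable_integrable[OF G] by auto
  obtain B where B: "\<And>x. \<bar>?\<eta> x\<bar> \<le> B" "\<And>i x. \<bar>partial_deriv i ?\<eta> x\<bar> \<le> B"
    using mollifier_bounded[OF \<delta>] by blast
  have B0: "0 \<le> B" using B(1)[of 0] by linarith
  define B' where "B' = (\<Sum>i\<in>UNIV. \<bar>w $ i\<bar> * B)"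
  have D_le: "\<bar>D t y\<bar> \<le> B'" for t y
    unfolding D_def B'_def by (rule order_trans[OF sum_abs]) (auto simp: abs_mult intro!: sum_mono mult_left_mono B)
  have [measurable]: "(\<lambda>(t, y). D t y) \<in> borel_measurable (borel \<Otimes>\<^sub>M borel)"
    unfolding D_def by measurable
  have ftc: "?\<eta> (q - y) - ?\<eta> (p - y) = (\<integral>t. indicator {0..1} t *\<^sub>R D t y \<partial>lborel)" for y
  proof -
    have "(\<integral>t. indicator {0..1} t *\<^sub>R D t y \<partial>lborel) = ?\<eta> (p + 1 *\<^sub>R w - y) - ?\<eta> (p + 0 *\<^sub>R w - y)"
    proof (rule integral_FTC_atLeastAtMost)
      fix t :: real
      have i: "((\<lambda>t. p + t *\<^sub>R w - y) has_derivative (\<lambda>h. h *\<^sub>R w)) (at t)" by (auto intro!: derivative_eq_intros)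
      have "((\<lambda>t. ?\<eta> (p + t *\<^sub>R w - y)) has_derivative (\<lambda>h. \<Sum>i\<in>UNIV. (h *\<^sub>R w) $ i * partial_deriv i ?\<eta> (p + t *\<^sub>R w - y))) (at t)"
        by (rule has_derivative_compose[OF i smooth_class_has_derivative[OF mollifier_smooth]])
      also have "(\<lambda>h. \<Sum>i\<in>UNIV. (h *\<^sub>R w) $ i * partial_deriv i ?\<eta> (p + t *\<^sub>R w - y)) = (\<lambda>h. h *\<^sub>R D t y)"
        by (simp add: D_def sum_distrib_left mult.assoc)
      finally show "((\<lambda>t. ?\<eta> (p + t *\<^sub>R w - y)) has_vector_derivative D t y) (at t within {0..1})"
        unfolding has_vector_derivative_def by (rule has_derivative_at_withinI)
    next
      have "continuous_on UNIV (partial_deriv i ?\<eta>)" for i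
        by (rule smooth_class_continuous[OF smooth_class_partial[OF mollifier_smooth]])
      then have "continuous_on {0..1} (\<lambda>t. partial_deriv i ?\<eta> (p + t *\<^sub>R w - y))" for i
        by (rule continuous_on_compose2) (auto intro!: continuous_intros)
      then show "continuous_on {0..1} (\<lambda>t. D t y)"
        unfolding D_def by (intro continuous_intros)
    qed simp
    then show ?thesis by (simp add: w_def)
  qed
  define H where "H t y = F y * (indicator {0..1} t *\<^sub>R D t y)" for t y
  have H: "integrable (lborel \<Otimes>\<^sub>M lborel) (\<lambda>(t, y). H t y)"
  proof (rule integrableI_bounded)
    show "(\<lambda>(t, y). H t y) \<in> borel_measurable (lborel \<Otimes>\<^sub>M lborel)" unfolding H_def by measurable
    have "(\<integral>\<^sup>+x. ennreal (norm (case x of (t, y) \<Rightarrow> H t y)) \<partial>(lborel \<Otimes>\<^sub>M lborel))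
      \<le> (\<integral>\<^sup>+x. (case x of (t, y) \<Rightarrow> indicator {0..1::real} t * (ennreal B' * ennreal \<bar>F y\<bar>)) \<partial>(lborel \<Otimes>\<^sub>M lborel))"
    proof (rule nn_integral_mono)
      fix x :: "real \<times> (real^3)"
      obtain t y where x: "x = (t, y)" by (cases x)
      have "\<bar>F y\<bar> * \<bar>D t y\<bar> \<le> B' * \<bar>F y\<bar>" using D_le[of t y] by (subst mult.commute) (rule mult_right_mono, auto)
      then show "ennreal (norm (case x of (t, y) \<Rightarrow> H t y)) \<le> (case x of (t, y) \<Rightarrow> indicator {0..1::real} t * (ennreal B' * ennreal \<bar>F y\<bar>))"
        unfolding x by (cases "t \<in> {0..1}") (auto simp: H_def abs_mult ennreal_mult''[symmetric] intro!: ennreal_leI)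
    qed
    also have "\<dots> = (\<integral>\<^sup>+t. \<integral>\<^sup>+y. indicator {0..1::real} t * (ennreal B' * ennreal \<bar>F y\<bar>) \<partial>lborel \<partial>lborel)"
      by (subst lborel.nn_integral_fst[symmetric]) auto
    also have "\<dots> = ennreal B' * (\<integral>\<^sup>+y. ennreal \<bar>F y\<bar> \<partial>lborel)"
      by (simp add: nn_integral_cmult nn_integral_multc)
    also have "\<dots> < \<infinity>"
      using F by (simp add: integrable_iff_bounded ennreal_mult_less_top)
    finally show "(\<integral>\<^sup>+x. ennreal (norm (case x of (t, y) \<Rightarrow> H t y)) \<partial>(lborel \<Otimes>\<^sub>M lborel)) < \<infinity>" .
  qed
  have int_mol: "integrable lborel (\<lambda>y. f y * ?\<eta> (x - y))" if "integrable lborel f" for f x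
    by (rule integrable_mult_bounded[OF that _ B0]) (use B in auto)
  have int_part: "integrable lborel (\<lambda>y. F y * partial_deriv i ?\<eta> (x - y))" for x i
    by (rule integrable_mult_bounded[OF F _ B0]) (use B in auto)
  have ibp: "(\<integral>y. F y * partial_deriv i ?\<eta> (x - y) \<partial>lborel) = (\<integral>y. G i y * ?\<eta> (x - y) \<partial>lborel)" for x i
  proof -
    have "(\<integral>y. F y * partial_deriv i (\<lambda>y. ?\<eta> (x - y)) y \<partial>lborel) = - (\<integral>y. G i y * ?\<eta> (x - y) \<partial>lborel)"
      by (rule weak_gradientD[OF W mollifier_shift_smooth mollifier_shift_compact[OF \<delta>]])
    then show ?thesis by (simp add: partial_deriv_mollifier_shift[OF \<delta>])
  qed
  define X where "X t = (\<integral>y. H t y \<partial>lborel)" for t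
  have "mollify \<delta> F q - mollify \<delta> F p = (\<integral>y. F y * (?\<eta> (q - y) - ?\<eta> (p - y)) \<partial>lborel)"
    unfolding mollify_def
    by (subst Bochner_Integration.integral_diff[symmetric]) (simp_all add: int_mol F right_diff_distrib)
  also have "\<dots> = (\<integral>y. \<integral>t. H t y \<partial>lborel \<partial>lborel)"
    unfolding ftc H_def by simp
  also have "\<dots> = (\<integral>t. X t \<partial>lborel)"
    unfolding X_def by (rule lborel_pair.Fubini_integral[OF H])
  finally have eq: "mollify \<delta> F q - mollify \<delta> F p = (\<integral>t. X t \<partial>lborel)" .
  have X_int: "integrable lborel X"
    unfolding X_def using lborel_pair.integrable_fst[OF H] by simp
  have "ennreal \<bar>mollify \<delta> F q - mollify \<delta> F p\<bar> \<le> (\<integral>\<^sup>+t. ennreal (norm (X t)) \<partial>lborel)"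
    unfolding eq using integral_norm_bound_ennreal[OF X_int] by simp
  also have "\<dots> \<le> (\<integral>\<^sup>+t. indicator {0..1} t * (ennreal (norm (q - p)) * mollify_nn \<delta> (\<lambda>y. \<Sum>i\<in>UNIV. \<bar>G i y\<bar>) (p + t *\<^sub>R (q - p))) \<partial>lborel)"
  proof (rule nn_integral_mono)
    fix t :: real
    define x where "x = p + t *\<^sub>R w"
    have "X t = indicator {0..1} t * (\<Sum>i\<in>UNIV. w $ i * (\<integral>y. G i y * ?\<eta> (x - y) \<partial>lborel))"
    proof -
      have "X t = (\<integral>y. indicator {0..1} t * (\<Sum>i\<in>UNIV. w $ i * (F y * partial_deriv i ?\<eta> (x - y))) \<partial>lborel)"
        unfolding X_def H_def D_def x_def[symmetric]
        by (intro Bochner_Integration.integral_cong) (auto simp: sum_distrib_left mult_ac)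
      also have "\<dots> = indicator {0..1} t * (\<Sum>i\<in>UNIV. w $ i * (\<integral>y. F y * partial_deriv i ?\<eta> (x - y) \<partial>lborel))"
        by (simp add: int_part)
      finally show ?thesis unfolding ibp .
    qed
    then have nX: "norm (X t) = indicator {0..1} t * \<bar>\<Sum>i\<in>UNIV. w $ i * (\<integral>y. G i y * ?\<eta> (x - y) \<partial>lborel)\<bar>"
      by (simp add: abs_mult)
    have "norm (X t) \<le> indicator {0..1} t * (norm w * (\<Sum>i\<in>UNIV. \<bar>\<integral>y. G i y * ?\<eta> (x - y) \<partial>lborel\<bar>))"
    proof -
      have "\<bar>\<Sum>i\<in>UNIV. w $ i * (\<integral>y. G i y * ?\<eta> (x - y) \<partial>lborel)\<bar> \<le> norm w * (\<Sum>i\<in>UNIV. \<bar>\<integral>y. G i y * ?\<eta> (x - y) \<partial>lborel\<bar>)"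
        unfolding sum_distrib_left by (rule order_trans[OF sum_abs]) (auto simp: abs_mult intro!: sum_mono mult_right_mono component_le_norm_cart)
      then show ?thesis unfolding nX by (rule mult_left_mono) simp
    qed
    then have "ennreal (norm (X t)) \<le> ennreal (indicator {0..1} t * (norm w * (\<Sum>i\<in>UNIV. \<bar>\<integral>y. G i y * ?\<eta> (x - y) \<partial>lborel\<bar>)))"
      by (rule ennreal_leI)
    also have "\<dots> = indicator {0..1} t * (ennreal (norm w) * (\<Sum>i\<in>UNIV. ennreal \<bar>\<integral>y. G i y * ?\<eta> (x - y) \<partial>lborel\<bar>))"
      by (cases "t \<in> {0..1}") (simp_all add: ennreal_mult' sum_ennreal)
    also have "\<dots> \<le> indicator {0..1} t * (ennreal (norm w) * mollify_nn \<delta> (\<lambda>y. \<Sum>i\<in>UNIV. \<bar>G i y\<bar>) x)"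
    proof (intro mult_left_mono)
      have "(\<Sum>i\<in>UNIV. ennreal \<bar>\<integral>y. G i y * ?\<eta> (x - y) \<partial>lborel\<bar>) \<le> (\<Sum>i\<in>UNIV. \<integral>\<^sup>+y. ennreal (norm (G i y * ?\<eta> (x - y))) \<partial>lborel)"
        using integral_norm_bound_ennreal[OF int_mol[OF G]] by (intro sum_mono) simp
      also have "\<dots> = (\<integral>\<^sup>+y. (\<Sum>i\<in>UNIV. ennreal (norm (G i y * ?\<eta> (x - y)))) \<partial>lborel)"
        by (rule nn_integral_sum[symmetric]) measurable
      also have "\<dots> = mollify_nn \<delta> (\<lambda>y. \<Sum>i\<in>UNIV. \<bar>G i y\<bar>) x"
        unfolding mollify_nn_def
        by (intro nn_integral_cong) (simp add: abs_mult mollifier_nonneg[OF \<delta>] sum_ennreal ennreal_mult[symmetric] sum_nonneg sum_distrib_right)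
      finally show "(\<Sum>i\<in>UNIV. ennreal \<bar>\<integral>y. G i y * ?\<eta> (x - y) \<partial>lborel\<bar>) \<le> mollify_nn \<delta> (\<lambda>y. \<Sum>i\<in>UNIV. \<bar>G i y\<bar>) x" .
    qed auto
    finally show "ennreal (norm (X t)) \<le> indicator {0..1} t * (ennreal (norm (q - p)) * mollify_nn \<delta> (\<lambda>y. \<Sum>i\<in>UNIV. \<bar>G i y\<bar>) (p + t *\<^sub>R (q - p)))"
      by (simp add: x_def w_def)
  qed
  finally show ?thesis .
qed

section \<open>Convergence of mollifications\<close>

definition translation_continuous :: "(real^3 \<Rightarrow> real) \<Rightarrow> bool" where
  "translation_continuous f \<longleftrightarrow>
    (\<forall>\<epsilon>>0. \<exists>d>0. \<forall>y. norm y < d \<longrightarrow> (\<integral>\<^sup>+x. ennreal \<bar>f (y + x) - f x\<bar> \<partial>lborel) \<le> ennreal \<epsilon>)"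

text \<open>Approximate \<open>A\<close> by a compact \<open>K\<close> from inside and an open \<open>U\<close> from outside. A translation shorter than the
distance of \<open>K\<close> to the complement of \<open>U\<close> changes the indicator only on \<open>U - K\<close> and its translate.\<close>

lemma translation_continuous_indicator:
  assumes A [measurable]: "A \<in> sets borel" and fin: "emeasure lborel A < \<infinity>"
  shows "translation_continuous (\<lambda>x. indicator A x * c)"
  unfolding translation_continuous_def
proof (intro allI impI)
  fix \<epsilon> :: real assume \<epsilon>: "0 < \<epsilon>"
  \<comment> \<open>Three approximation errors of size \<open>e\<close>, counted for the set and for its translate, times \<open>\<bar>c\<bar>\<close>.\<close>
  define e where "e = \<epsilon> / (6 * (1 + \<bar>c\<bar>))"
  have e: "0 < e" using \<epsilon> by (simp add: e_def add_pos_nonneg)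
  have ec: "6 * e * \<bar>c\<bar> \<le> \<epsilon>" using \<epsilon> by (simp add: e_def divide_le_eq add_pos_nonneg mult_left_mono)
  obtain U where U: "open U" "A \<subseteq> U" "emeasure lborel (U - A) < e"
    using outer_regular_lborel[OF A e] by blast
  obtain T where T: "closed T" "T \<subseteq> A" "emeasure lebesgue (A - T) < ennreal e"
    using sets_lebesgue_inner_closed[of A e] e by (metis A sets_completionI_sets sets_lborel)
  have [measurable]: "U \<in> sets borel" "T \<in> sets borel" using U T by auto
  have "(\<lambda>n. emeasure lborel (A - cball 0 (real n))) \<longlonglongrightarrow> emeasure lborel (\<Inter>n. A - cball 0 (real n))"
  proof (rule Lim_emeasure_decseq)
    show "decseq (\<lambda>n. A - cball 0 (real n))" by (auto simp: decseq_def)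
    show "emeasure lborel (A - cball 0 (real n)) \<noteq> \<infinity>" for n
      using fin emeasure_mono[of "A - cball 0 (real n)" A lborel] by (auto simp: top_unique)
  qed auto
  moreover have "(\<Inter>n. A - cball 0 (real n)) = {}"
  proof -
    have "\<exists>n. x \<in> cball 0 (real n)" for x :: "real^3"
      using real_arch_simple[of "norm x"] by auto
    then show ?thesis by blast
  qed
  ultimately have "(\<lambda>n. emeasure lborel (A - cball 0 (real n))) \<longlonglongrightarrow> 0" by (simp only: emeasure_empty)
  then have "\<forall>\<^sub>F n in sequentially. emeasure lborel (A - cball 0 (real n)) < ennreal e"
    by (rule order_tendstoD) (use e in simp)
  then obtain n where n: "emeasure lborel (A - cball 0 (real n)) < ennreal e"
    by (auto simp: eventually_sequentially)
  define K where "K = T \<inter> cball 0 (real n)"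
  have K: "compact K" "K \<subseteq> A" using T by (auto simp: K_def closed_Int_compact)
  have [measurable]: "K \<in> sets borel" by (simp add: K_def)
  have "emeasure lborel (U - K) \<le> emeasure lborel ((U - A) \<union> ((A - T) \<union> (A - cball 0 (real n))))"
    by (rule emeasure_mono) (use U in \<open>auto simp: K_def\<close>)
  also have "\<dots> \<le> emeasure lborel (U - A) + (emeasure lborel (A - T) + emeasure lborel (A - cball 0 (real n)))"
    by (intro order_trans[OF emeasure_subadditive] add_left_mono emeasure_subadditive) auto
  also have "\<dots> \<le> ennreal e + (ennreal e + ennreal e)"
    using U T n by (intro add_mono) auto
  also have "\<dots> = ennreal (3 * e)" using e by (simp flip: ennreal_plus)
  finally have UK: "emeasure lborel (U - K) \<le> ennreal (3 * e)" .
  have KU0: "K \<inter> - U = {}" using K(2) U(2) by auto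
  obtain d where d: "d > 0" "\<And>x y. x \<in> K \<Longrightarrow> y \<in> - U \<Longrightarrow> d \<le> dist x y"
    using separate_compact_closed[OF K(1), of "- U"] KU0 closed_Compl[OF U(1)] by blast
  show "\<exists>d>0. \<forall>y. norm y < d \<longrightarrow> (\<integral>\<^sup>+x. ennreal \<bar>indicator A (y + x) * c - indicator A x * c\<bar> \<partial>lborel) \<le> ennreal \<epsilon>"
  proof (intro exI conjI allI impI)
    show "d > 0" by fact
    fix y :: "real^3" assume y: "norm y < d"
    have KU: "x \<in> K \<Longrightarrow> y + x \<in> U" for x using d(2)[of x "y + x"] y by (force simp: dist_norm)
    have KU': "y + x \<in> K \<Longrightarrow> x \<in> U" for x using d(2)[of "y + x" x] y by (force simp: dist_norm)
    have "(\<integral>\<^sup>+x. ennreal \<bar>indicator A (y + x) * c - indicator A x * c\<bar> \<partial>lborel)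
      \<le> (\<integral>\<^sup>+x. ennreal \<bar>c\<bar> * (indicator (U - K) (y + x) + indicator (U - K) x) \<partial>lborel)"
    proof (rule nn_integral_mono)
      fix x
      have "ennreal \<bar>c\<bar> \<le> ennreal \<bar>c\<bar> * (1 + indicator (U - K) x)"
        by (metis add_increasing2 mult.right_neutral mult_left_mono order_refl zero_le)
      then show "ennreal \<bar>indicator A (y + x) * c - indicator A x * c\<bar> \<le> ennreal \<bar>c\<bar> * (indicator (U - K) (y + x) + indicator (U - K) x)"
        using KU[of x] KU'[of x] K(2) U(2) by (auto simp: indicator_def)
    qed
    also have "\<dots> = ennreal \<bar>c\<bar> * ((\<integral>\<^sup>+x. indicator (U - K) (y + x) \<partial>lborel) + (\<integral>\<^sup>+x. indicator (U - K) x \<partial>lborel))"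
      by (subst nn_integral_cmult, measurable, subst nn_integral_add) auto
    also have "\<dots> = ennreal \<bar>c\<bar> * (emeasure lborel (U - K) + emeasure lborel (U - K))"
      by (subst nn_integral_shift) simp_all
    also have "\<dots> \<le> ennreal \<bar>c\<bar> * (ennreal (3 * e) + ennreal (3 * e))"
      by (intro mult_left_mono add_mono UK) auto
    also have "\<dots> = ennreal (6 * e * \<bar>c\<bar>)" using e by (simp add: ennreal_mult[symmetric] mult_ac flip: ennreal_plus)
    also have "\<dots> \<le> ennreal \<epsilon>" using ec by (rule ennreal_leI)
    finally show "(\<integral>\<^sup>+x. ennreal \<bar>indicator A (y + x) * c - indicator A x * c\<bar> \<partial>lborel) \<le> ennreal \<epsilon>" .
  qed
qed

text \<open>Translations act continuously on \<open>L\<^sup>1\<close>: the property passes from indicators to sums and to dominated limits.\<close>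

lemma integrable_translation_continuous:
  assumes "integrable lborel f"
  shows "translation_continuous f"
  using assms
proof (induction rule: integrable_induct)
  case (base A c)
  then show ?case using translation_continuous_indicator[of A c] by simp
next
  case (add f g)
  have [measurable]: "f \<in> borel_measurable borel" "g \<in> borel_measurable borel"
    using borel_measurable_integrable[OF add.hyps(1)] borel_measurable_integrable[OF add.hyps(2)] by auto
  show ?case unfolding translation_continuous_def
  proof (intro allI impI)
    fix \<epsilon> :: real assume "0 < \<epsilon>"
    then have e: "0 < \<epsilon> / 2" by simp
    have "\<exists>d>0. \<forall>y. norm y < d \<longrightarrow> (\<integral>\<^sup>+x. ennreal \<bar>f (y + x) - f x\<bar> \<partial>lborel) \<le> ennreal (\<epsilon> / 2)"
      using add.IH(1)[unfolded translation_continuous_def, THEN spec, THEN mp, OF e] .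
    then obtain d1 where d1: "d1 > 0"
      "\<And>y. norm y < d1 \<Longrightarrow> (\<integral>\<^sup>+x. ennreal \<bar>f (y + x) - f x\<bar> \<partial>lborel) \<le> ennreal (\<epsilon> / 2)" by blast
    have "\<exists>d>0. \<forall>y. norm y < d \<longrightarrow> (\<integral>\<^sup>+x. ennreal \<bar>g (y + x) - g x\<bar> \<partial>lborel) \<le> ennreal (\<epsilon> / 2)"
      using add.IH(2)[unfolded translation_continuous_def, THEN spec, THEN mp, OF e] .
    then obtain d2 where d2: "d2 > 0"
      "\<And>y. norm y < d2 \<Longrightarrow> (\<integral>\<^sup>+x. ennreal \<bar>g (y + x) - g x\<bar> \<partial>lborel) \<le> ennreal (\<epsilon> / 2)" by blast
    have "(\<integral>\<^sup>+x. ennreal \<bar>f (y + x) + g (y + x) - (f x + g x)\<bar> \<partial>lborel) \<le> ennreal \<epsilon>" if "norm y < min d1 d2" for y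
    proof -
      have "(\<integral>\<^sup>+x. ennreal \<bar>f (y + x) + g (y + x) - (f x + g x)\<bar> \<partial>lborel)
        \<le> (\<integral>\<^sup>+x. ennreal \<bar>f (y + x) - f x\<bar> + ennreal \<bar>g (y + x) - g x\<bar> \<partial>lborel)"
        by (intro nn_integral_mono) (auto simp flip: ennreal_plus intro!: ennreal_leI)
      also have "\<dots> = (\<integral>\<^sup>+x. ennreal \<bar>f (y + x) - f x\<bar> \<partial>lborel) + (\<integral>\<^sup>+x. ennreal \<bar>g (y + x) - g x\<bar> \<partial>lborel)"
        by (rule nn_integral_add) measurable
      also have "\<dots> \<le> ennreal (\<epsilon> / 2) + ennreal (\<epsilon> / 2)" using that by (intro add_mono d1 d2) auto
      also have "\<dots> = ennreal \<epsilon>" using e by (simp flip: ennreal_plus)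
      finally show ?thesis .
    qed
    then show "\<exists>d>0. \<forall>y. norm y < d \<longrightarrow> (\<integral>\<^sup>+x. ennreal \<bar>f (y + x) + g (y + x) - (f x + g x)\<bar> \<partial>lborel) \<le> ennreal \<epsilon>"
      using d1(1) d2(1) by (intro exI[of _ "min d1 d2"]) auto
  qed
next
  case (lim f s)
  have [measurable]: "f \<in> borel_measurable borel" "\<And>i. s i \<in> borel_measurable borel"
    using borel_measurable_integrable[OF lim.hyps(4)] borel_measurable_integrable[OF lim.hyps(1)] by auto
  have "(\<lambda>i. \<integral>\<^sup>+x. norm (f x - s i x) \<partial>lborel) \<longlonglongrightarrow> 0"
  proof (rule nn_integral_dominated_convergence_norm[where w="\<lambda>x. 2 * norm (f x)"])
    show "(\<integral>\<^sup>+x. ennreal (2 * norm (f x)) \<partial>lborel) < \<infinity>"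
      using lim.hyps(4) by (simp add: integrable_iff_bounded ennreal_mult nn_integral_cmult ennreal_mult_less_top)
  qed (use lim in auto)
  note conv = this
  show ?case unfolding translation_continuous_def
  proof (intro allI impI)
    fix \<epsilon> :: real assume "0 < \<epsilon>"
    then have e: "0 < \<epsilon> / 3" by simp
    have "\<forall>\<^sub>F i in sequentially. (\<integral>\<^sup>+x. norm (f x - s i x) \<partial>lborel) < ennreal (\<epsilon> / 3)"
      by (rule order_tendstoD[OF conv]) (use e in simp)
    then obtain i where i: "(\<integral>\<^sup>+x. norm (f x - s i x) \<partial>lborel) < ennreal (\<epsilon> / 3)"
      by (auto simp: eventually_sequentially)
    obtain d where d: "d > 0" "\<And>y. norm y < d \<Longrightarrow> (\<integral>\<^sup>+x. ennreal \<bar>s i (y + x) - s i x\<bar> \<partial>lborel) \<le> ennreal (\<epsilon> / 3)"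
      using lim.IH[of i] e unfolding translation_continuous_def by blast
    have "(\<integral>\<^sup>+x. ennreal \<bar>f (y + x) - f x\<bar> \<partial>lborel) \<le> ennreal \<epsilon>" if "norm y < d" for y
    proof -
      have "(\<integral>\<^sup>+x. ennreal \<bar>f (y + x) - f x\<bar> \<partial>lborel)
        \<le> (\<integral>\<^sup>+x. ennreal (norm (f (y + x) - s i (y + x))) + (ennreal \<bar>s i (y + x) - s i x\<bar> + ennreal (norm (f x - s i x))) \<partial>lborel)"
        by (intro nn_integral_mono) (auto simp flip: ennreal_plus intro!: ennreal_leI)
      also have "\<dots> = (\<integral>\<^sup>+x. ennreal (norm (f (y + x) - s i (y + x))) \<partial>lborel)
          + ((\<integral>\<^sup>+x. ennreal \<bar>s i (y + x) - s i x\<bar> \<partial>lborel) + (\<integral>\<^sup>+x. ennreal (norm (f x - s i x)) \<partial>lborel))"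
        by (simp add: nn_integral_add)
      also have "(\<integral>\<^sup>+x. ennreal (norm (f (y + x) - s i (y + x))) \<partial>lborel) = (\<integral>\<^sup>+x. ennreal (norm (f x - s i x)) \<partial>lborel)"
        by (rule nn_integral_shift) measurable
      also have "(\<integral>\<^sup>+x. ennreal (norm (f x - s i x)) \<partial>lborel) + ((\<integral>\<^sup>+x. ennreal \<bar>s i (y + x) - s i x\<bar> \<partial>lborel) + (\<integral>\<^sup>+x. ennreal (norm (f x - s i x)) \<partial>lborel))
         \<le> ennreal (\<epsilon> / 3) + (ennreal (\<epsilon> / 3) + ennreal (\<epsilon> / 3))"
        using i that by (intro add_mono d) auto
      also have "\<dots> = ennreal \<epsilon>" using e by (simp flip: ennreal_plus)
      finally show ?thesis .
    qed
    then show "\<exists>d>0. \<forall>y. norm y < d \<longrightarrow> (\<integral>\<^sup>+x. ennreal \<bar>f (y + x) - f x\<bar> \<partial>lborel) \<le> ennreal \<epsilon>"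
      using d(1) by blast
  qed
qed

text \<open>The error is an average of translation errors, weighted by the mollifier.\<close>

lemma mollify_error:
  assumes \<delta>: "0 < \<delta>" and F: "integrable lborel F"
    and \<epsilon>: "\<And>y. norm y \<le> 3 * \<delta> \<Longrightarrow> (\<integral>\<^sup>+x. ennreal \<bar>F (y + x) - F x\<bar> \<partial>lborel) \<le> ennreal \<epsilon>"
  shows "(\<integral>\<^sup>+x. ennreal \<bar>mollify \<delta> F x - F x\<bar> \<partial>lborel) \<le> ennreal \<epsilon>"
proof -
  let ?\<eta> = "mollifier \<delta>"
  have [measurable]: "F \<in> borel_measurable borel" using borel_measurable_integrable[OF F] by simp
  have sym: "?\<eta> (- z) = ?\<eta> z" for z by (simp add: mollifier_def bump_minus)
  have "ennreal \<bar>mollify \<delta> F x - F x\<bar> \<le> (\<integral>\<^sup>+z. ennreal (?\<eta> z) * ennreal \<bar>F (z + x) - F x\<bar> \<partial>lborel)" for x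
  proof -
    have mol: "integrable lborel (\<lambda>y. ?\<eta> (x - y))"
    proof (rule integrableI_bounded)
      show "(\<integral>\<^sup>+y. ennreal (norm (?\<eta> (x - y))) \<partial>lborel) < \<infinity>"
        using nn_integral_mollifier_shift(1)[OF \<delta>, of x] by (simp add: mollifier_nonneg[OF \<delta>])
    qed measurable
    have one: "(\<integral>y. ?\<eta> (x - y) \<partial>lborel) = 1"
    proof -
      have "(\<integral>y. ?\<eta> (x - y) \<partial>lborel) = enn2real (\<integral>\<^sup>+y. ennreal (?\<eta> (x - y)) \<partial>lborel)"
        by (rule integral_eq_nn_integral) (auto intro: AE_I2 mollifier_nonneg[OF \<delta>])
      then show ?thesis unfolding nn_integral_mollifier_shift(1)[OF \<delta>] by simp
    qed
    obtain B where B: "\<And>x. \<bar>?\<eta> x\<bar> \<le> B" "\<And>i x. \<bar>partial_deriv i ?\<eta> x\<bar> \<le> B"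
      using mollifier_bounded[OF \<delta>] by blast
    have B0: "0 \<le> B" using B(1)[of 0] by linarith
    have Fmol: "integrable lborel (\<lambda>y. F y * ?\<eta> (x - y))"
      by (rule integrable_mult_bounded[OF F _ B0]) (use B in auto)
    have int: "integrable lborel (\<lambda>y. F y * ?\<eta> (x - y) - F x * ?\<eta> (x - y))"
      using Fmol mol by (intro Bochner_Integration.integrable_diff integrable_mult_right)
    have "mollify \<delta> F x - F x = (\<integral>y. F y * ?\<eta> (x - y) \<partial>lborel) - (\<integral>y. F x * ?\<eta> (x - y) \<partial>lborel)"
      using one by (simp add: mollify_def)
    also have "\<dots> = (\<integral>y. F y * ?\<eta> (x - y) - F x * ?\<eta> (x - y) \<partial>lborel)"
      using Fmol mol by (intro Bochner_Integration.integral_diff[symmetric] integrable_mult_right)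
    finally have "ennreal \<bar>mollify \<delta> F x - F x\<bar> \<le> (\<integral>\<^sup>+y. ennreal (norm (F y * ?\<eta> (x - y) - F x * ?\<eta> (x - y))) \<partial>lborel)"
      using integral_norm_bound_ennreal[OF int] by simp
    also have "\<dots> = (\<integral>\<^sup>+y. ennreal (?\<eta> (x - y)) * ennreal \<bar>F y - F x\<bar> \<partial>lborel)"
      by (intro nn_integral_cong)
         (simp add: left_diff_distrib[symmetric] abs_mult mollifier_nonneg[OF \<delta>] ennreal_mult mult.commute)
    also have "\<dots> = (\<integral>\<^sup>+z. ennreal (?\<eta> (x - (x + z))) * ennreal \<bar>F (x + z) - F x\<bar> \<partial>lborel)"
      by (rule nn_integral_shift[symmetric]) measurable
    also have "\<dots> = (\<integral>\<^sup>+z. ennreal (?\<eta> z) * ennreal \<bar>F (z + x) - F x\<bar> \<partial>lborel)"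
      by (simp add: sym add.commute)
    finally show ?thesis .
  qed
  then have "(\<integral>\<^sup>+x. ennreal \<bar>mollify \<delta> F x - F x\<bar> \<partial>lborel) \<le> (\<integral>\<^sup>+x. \<integral>\<^sup>+z. ennreal (?\<eta> z) * ennreal \<bar>F (z + x) - F x\<bar> \<partial>lborel \<partial>lborel)"
    by (intro nn_integral_mono)
  also have "\<dots> = (\<integral>\<^sup>+z. \<integral>\<^sup>+x. ennreal (?\<eta> z) * ennreal \<bar>F (z + x) - F x\<bar> \<partial>lborel \<partial>lborel)"
    by (rule lborel_pair.Fubini') measurable
  also have "\<dots> \<le> (\<integral>\<^sup>+z. ennreal (?\<eta> z) * ennreal \<epsilon> \<partial>lborel)"
  proof (rule nn_integral_mono)
    fix z
    show "(\<integral>\<^sup>+x. ennreal (?\<eta> z) * ennreal \<bar>F (z + x) - F x\<bar> \<partial>lborel) \<le> ennreal (?\<eta> z) * ennreal \<epsilon>"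
    proof (cases "norm z \<le> 3 * \<delta>")
      case True
      then show ?thesis using \<epsilon>[of z] by (subst nn_integral_cmult) (auto intro!: mult_left_mono)
    next
      case False
      then show ?thesis using mollifier_support[OF \<delta>, of z] by simp
    qed
  qed
  also have "\<dots> = ennreal \<epsilon>" by (simp add: nn_integral_multc nn_integral_mollifier[OF \<delta>])
  finally show ?thesis .
qed

lemma mollify_AE_convergent:
  assumes F: "integrable lborel F"
  obtains \<delta> :: "nat \<Rightarrow> real" where "\<And>n. 0 < \<delta> n" "\<And>n. 3 * \<delta> n \<le> 1"
    "AE x in lborel. (\<lambda>n. mollify (\<delta> n) F x) \<longlonglongrightarrow> F x"
proof -
  have [measurable]: "F \<in> borel_measurable borel" using borel_measurable_integrable[OF F] by simp
  have "\<exists>\<delta>>0. 3 * \<delta> \<le> 1 \<and> (\<integral>\<^sup>+x. ennreal \<bar>mollify \<delta> F x - F x\<bar> \<partial>lborel) \<le> ennreal (1 / (real n + 1))" for n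
  proof -
    have "0 < 1 / (real n + 1)" by simp
    then obtain d where d: "d > 0" "\<And>y. norm y < d \<Longrightarrow> (\<integral>\<^sup>+x. ennreal \<bar>F (y + x) - F x\<bar> \<partial>lborel) \<le> ennreal (1 / (real n + 1))"
      using integrable_translation_continuous[OF F] unfolding translation_continuous_def by blast
    define \<delta> where "\<delta> = min (d / 4) (1 / 3)"
    have \<delta>: "0 < \<delta>" "3 * \<delta> \<le> 1" "3 * \<delta> < d" using d by (auto simp: \<delta>_def)
    then show ?thesis
      using mollify_error[OF \<delta>(1) F, of "1 / (real n + 1)"] d(2) by (intro exI[of _ \<delta>]) auto
  qed
  then obtain \<delta> where \<delta>: "\<And>n. 0 < \<delta> n" "\<And>n. 3 * \<delta> n \<le> (1::real)"
    "\<And>n. (\<integral>\<^sup>+x. ennreal \<bar>mollify (\<delta> n) F x - F x\<bar> \<partial>lborel) \<le> ennreal (1 / (real n + 1))" by metis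
  have int: "integrable lborel (\<lambda>x. mollify (\<delta> n) F x - F x)" for n
  proof (rule integrableI_bounded)
    show "(\<integral>\<^sup>+x. ennreal (norm (mollify (\<delta> n) F x - F x)) \<partial>lborel) < \<infinity>"
      using \<delta>(3)[of n] by (simp add: le_less_trans)
  qed measurable
  have "(\<lambda>n. \<integral>x. norm (mollify (\<delta> n) F x - F x) \<partial>lborel) \<longlonglongrightarrow> 0"
  proof (rule tendsto_sandwich[OF _ _ tendsto_const])
    show "\<forall>\<^sub>F n in sequentially. (\<integral>x. norm (mollify (\<delta> n) F x - F x) \<partial>lborel) \<le> 1 / (real n + 1)"
    proof (rule always_eventually, rule allI)
      fix n
      have "ennreal (\<integral>x. norm (mollify (\<delta> n) F x - F x) \<partial>lborel) = (\<integral>\<^sup>+x. ennreal (norm (mollify (\<delta> n) F x - F x)) \<partial>lborel)"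
        by (rule nn_integral_eq_integral[symmetric]) (use int in auto)
      then have "ennreal (\<integral>x. norm (mollify (\<delta> n) F x - F x) \<partial>lborel) \<le> ennreal (1 / (real n + 1))"
        using \<delta>(3)[of n] by simp
      then show "(\<integral>x. norm (mollify (\<delta> n) F x - F x) \<partial>lborel) \<le> 1 / (real n + 1)"
        by (subst (asm) ennreal_le_iff) auto
    qed
    show "(\<lambda>n. 1 / (real n + 1)) \<longlonglongrightarrow> 0" by real_asymp
  qed auto
  then obtain r where r: "strict_mono r" "AE x in lborel. (\<lambda>n. mollify (\<delta> (r n)) F x - F x) \<longlonglongrightarrow> 0"
    using tendsto_L1_AE_subseq[of lborel "\<lambda>n x. mollify (\<delta> n) F x - F x"] int by blast
  show thesis
  proof (rule that[of "\<lambda>n. \<delta> (r n)"])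
    show "AE x in lborel. (\<lambda>n. mollify (\<delta> (r n)) F x) \<longlonglongrightarrow> F x"
      using r(2) by eventually_elim (simp add: LIM_zero_iff)
  qed (use \<delta> in auto)
qed

section \<open>Differences along collisions\<close>

lemma jb_ge_1: "1 \<le> jb v"
  by (simp add: jb_def)

lemma jb_pos: "0 < jb v"
  using jb_ge_1[of v] by linarith

lemma norm_le_jb: "norm v \<le> jb v"
  unfolding jb_def by (rule real_le_rsqrt) simp

lemma jb_measurable [measurable]: "jb \<in> borel_measurable borel"
  unfolding jb_def by measurable

lemma norm_diff_le_jb: "norm (y - a) + 1 \<le> 3 * (jb y * jb a)"
proof -
  have "norm (y - a) + 1 \<le> jb y + jb a + 1"
    using norm_triangle_ineq4[of y a] norm_le_jb[of y] norm_le_jb[of a] by linarith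
  moreover have "jb y \<le> jb y * jb a" using mult_left_mono[OF jb_ge_1[of a], of "jb y"] jb_pos[of y] by simp
  moreover have "jb a \<le> jb y * jb a" using mult_right_mono[OF jb_ge_1[of y], of "jb a"] jb_pos[of a] by simp
  ultimately show ?thesis using jb_ge_1[of y] by linarith
qed

lemma nn_integral_affine_isometry:
  fixes g :: "real^3 \<Rightarrow> ennreal"
  assumes e: "e = 1 \<or> e = (-1::real)" and [measurable]: "g \<in> borel_measurable borel"
  shows "(\<integral>\<^sup>+y. g (a + e *\<^sub>R y) \<partial>lborel) = (\<integral>\<^sup>+x. g x \<partial>lborel)"
proof -
  have "e * e = 1" using e by auto
  then have "orthogonal_transformation (\<lambda>y::real^3. e *\<^sub>R y)"
    unfolding orthogonal_transformation_def by (auto intro: linear_scale_self simp: mult.assoc[symmetric])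
  then have "(\<integral>\<^sup>+y. g (a + e *\<^sub>R y) \<partial>lborel) = (\<integral>\<^sup>+y. g (a + y) \<partial>lborel)"
    by (rule nn_integral_orthogonal_transformation) measurable
  then show ?thesis by (simp add: nn_integral_shift)
qed

text \<open>The mollifier moves points by at most one, which changes the polynomial weights by a bounded factor only.\<close>

lemma nn_integral_mollify_weight:
  assumes \<delta>: "0 < \<delta>" "3 * \<delta> \<le> 1" and p: "0 \<le> p" "p \<le> 2" and [measurable]: "G \<in> borel_measurable borel"
  shows "(\<integral>\<^sup>+x. ennreal (norm (x - a) powr p) * mollify_nn \<delta> G x \<partial>lborel)
    \<le> ennreal (9 * jb a powr p) * (\<integral>\<^sup>+y. ennreal (jb y powr p * \<bar>G y\<bar>) \<partial>lborel)"
proof -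
  let ?\<eta> = "mollifier \<delta>"
  have "(\<integral>\<^sup>+x. ennreal (norm (x - a) powr p) * mollify_nn \<delta> G x \<partial>lborel)
    = (\<integral>\<^sup>+x. \<integral>\<^sup>+y. ennreal (norm (x - a) powr p) * (ennreal \<bar>G y\<bar> * ennreal (?\<eta> (x - y))) \<partial>lborel \<partial>lborel)"
    unfolding mollify_nn_def by (simp add: nn_integral_cmult)
  also have "\<dots> = (\<integral>\<^sup>+y. \<integral>\<^sup>+x. ennreal (norm (x - a) powr p) * (ennreal \<bar>G y\<bar> * ennreal (?\<eta> (x - y))) \<partial>lborel \<partial>lborel)"
    by (rule lborel_pair.Fubini') measurable
  also have "\<dots> \<le> (\<integral>\<^sup>+y. \<integral>\<^sup>+x. (ennreal (9 * jb a powr p) * ennreal (jb y powr p * \<bar>G y\<bar>)) * ennreal (?\<eta> (x - y)) \<partial>lborel \<partial>lborel)"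
  proof (intro nn_integral_mono)
    fix x y :: "real^3"
    show "ennreal (norm (x - a) powr p) * (ennreal \<bar>G y\<bar> * ennreal (?\<eta> (x - y)))
      \<le> (ennreal (9 * jb a powr p) * ennreal (jb y powr p * \<bar>G y\<bar>)) * ennreal (?\<eta> (x - y))"
    proof (cases "norm (x - y) \<le> 1")
      case True
      have "norm (x - a) \<le> norm (x - y) + norm (y - a)" using norm_triangle_ineq[of "x - y" "y - a"] by simp
      also have "\<dots> \<le> 3 * (jb y * jb a)" using norm_diff_le_jb[of y a] True by linarith
      finally have "norm (x - a) powr p \<le> (3 * (jb y * jb a)) powr p" using p by (intro powr_mono2) auto
      also have "\<dots> = 3 powr p * (jb y powr p * jb a powr p)" using jb_pos by (simp add: powr_mult less_imp_le)
      also have "\<dots> \<le> 9 * (jb y powr p * jb a powr p)"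
      proof (rule mult_right_mono)
        have "3 powr p \<le> (3::real) powr 2" using p by (intro powr_mono) auto
        then show "3 powr p \<le> (9::real)" by simp
      qed auto
      finally have "norm (x - a) powr p * \<bar>G y\<bar> \<le> 9 * (jb y powr p * jb a powr p) * \<bar>G y\<bar>" by (rule mult_right_mono) simp
      then have "ennreal (norm (x - a) powr p) * ennreal \<bar>G y\<bar> \<le> ennreal (9 * jb a powr p) * ennreal (jb y powr p * \<bar>G y\<bar>)"
        by (simp add: ennreal_mult'[symmetric] ennreal_leI mult_ac)
      then show ?thesis unfolding mult.assoc[symmetric] by (rule mult_right_mono) simp
    next
      case False
      then show ?thesis using mollifier_support[OF \<delta>(1), of "x - y"] \<delta>(2) by simp
    qed
  qed
  also have "\<dots> = (\<integral>\<^sup>+y. (ennreal (9 * jb a powr p) * ennreal (jb y powr p * \<bar>G y\<bar>)) \<partial>lborel)"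
    by (simp add: nn_integral_cmult nn_integral_mollifier_shift(2)[OF \<delta>(1)])
  also have "\<dots> = ennreal (9 * jb a powr p) * (\<integral>\<^sup>+y. ennreal (jb y powr p * \<bar>G y\<bar>) \<partial>lborel)"
    by (rule nn_integral_cmult) measurable
  finally show ?thesis .
qed

interpretation sph_lborel: pair_sigma_finite sph "lborel :: real measure"
  by standard

context angular_kernel
begin

lemma kern_difference_mollified:
  assumes \<delta>: "0 < \<delta>" "3 * \<delta> \<le> 1" and W: "weak_gradient F G" and e: "e = 1 \<or> e = (-1::real)"
  shows "(\<integral>\<^sup>+\<sigma>. \<integral>\<^sup>+z. ennreal (kern z \<sigma> * \<bar>mollify \<delta> F (a + e *\<^sub>R tilt 1 \<sigma> z) - mollify \<delta> F (a + e *\<^sub>R z)\<bar>) \<partial>lborel \<partial>sph)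
    \<le> ennreal (9 * tilt_const * jb a powr (\<gamma> + 1)) * (\<integral>\<^sup>+y. ennreal (jb y powr (\<gamma> + 1) * (\<Sum>i\<in>UNIV. \<bar>G i y\<bar>)) \<partial>lborel)"
proof -
  have [measurable]: "F \<in> borel_measurable borel" "\<And>i. G i \<in> borel_measurable borel"
    using W by (auto simp: weak_gradient_def dest!: borel_measurable_integrable)
  define S where "S y = (\<Sum>i\<in>UNIV. \<bar>G i y\<bar>)" for y
  have S: "\<bar>S y\<bar> = S y" for y by (simp add: S_def sum_nonneg)
  have [measurable]: "S \<in> borel_measurable borel" unfolding S_def by measurable
  define g where "g = mollify_nn \<delta> S"
  have [measurable]: "g \<in> borel_measurable borel" unfolding g_def by measurable
  define R where "R t \<sigma> z = indicator {0..1} t * (ennreal (kern z \<sigma> * norm (tilt 1 \<sigma> z - z)) * g (a + e *\<^sub>R tilt t \<sigma> z))" for t :: real and \<sigma> z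
  have pt: "ennreal (kern z \<sigma> * \<bar>mollify \<delta> F (a + e *\<^sub>R tilt 1 \<sigma> z) - mollify \<delta> F (a + e *\<^sub>R z)\<bar>) \<le> (\<integral>\<^sup>+t. R t \<sigma> z \<partial>lborel)" for z \<sigma>
  proof -
    let ?p = "a + e *\<^sub>R z" and ?q = "a + e *\<^sub>R tilt 1 \<sigma> z"
    have d: "?q - ?p = e *\<^sub>R (tilt 1 \<sigma> z - z)" by (simp add: scaleR_diff_right)
    have n: "norm (?q - ?p) = norm (tilt 1 \<sigma> z - z)" unfolding d using e by auto
    have l: "?p + t *\<^sub>R (?q - ?p) = a + e *\<^sub>R tilt t \<sigma> z" for t
      unfolding d by (subst tilt_affine[of t]) (simp add: scaleR_add_right mult.commute)
    have "ennreal (kern z \<sigma> * \<bar>mollify \<delta> F ?q - mollify \<delta> F ?p\<bar>) = ennreal (kern z \<sigma>) * ennreal \<bar>mollify \<delta> F ?q - mollify \<delta> F ?p\<bar>"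
      by (simp add: ennreal_mult kern_nonneg)
    also have "\<dots> \<le> ennreal (kern z \<sigma>) * (\<integral>\<^sup>+t. indicator {0..1} t * (ennreal (norm (?q - ?p)) * mollify_nn \<delta> (\<lambda>y. \<Sum>i\<in>UNIV. \<bar>G i y\<bar>) (?p + t *\<^sub>R (?q - ?p))) \<partial>lborel)"
      by (intro mult_left_mono mollify_difference[OF \<delta>(1) W]) simp
    also have "\<dots> = ennreal (kern z \<sigma>) * (\<integral>\<^sup>+t. indicator {0..1} t * (ennreal (norm (tilt 1 \<sigma> z - z)) * g (a + e *\<^sub>R tilt t \<sigma> z)) \<partial>lborel)"
      unfolding n l g_def S_def ..
    also have "\<dots> = (\<integral>\<^sup>+t. ennreal (kern z \<sigma>) * (indicator {0..1} t * (ennreal (norm (tilt 1 \<sigma> z - z)) * g (a + e *\<^sub>R tilt t \<sigma> z))) \<partial>lborel)"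
      by (rule nn_integral_cmult[symmetric]) measurable
    also have "\<dots> = (\<integral>\<^sup>+t. R t \<sigma> z \<partial>lborel)"
      unfolding R_def by (intro nn_integral_cong) (simp add: ennreal_mult kern_nonneg mult_ac)
    finally show ?thesis .
  qed
  have "(\<integral>\<^sup>+\<sigma>. \<integral>\<^sup>+z. ennreal (kern z \<sigma> * \<bar>mollify \<delta> F (a + e *\<^sub>R tilt 1 \<sigma> z) - mollify \<delta> F (a + e *\<^sub>R z)\<bar>) \<partial>lborel \<partial>sph)
    \<le> (\<integral>\<^sup>+\<sigma>. \<integral>\<^sup>+z. \<integral>\<^sup>+t. R t \<sigma> z \<partial>lborel \<partial>lborel \<partial>sph)"
    by (intro nn_integral_mono pt)
  also have "\<dots> = (\<integral>\<^sup>+\<sigma>. \<integral>\<^sup>+t. \<integral>\<^sup>+z. R t \<sigma> z \<partial>lborel \<partial>lborel \<partial>sph)"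
    unfolding R_def kern_def by (intro nn_integral_cong lborel_pair.Fubini') measurable
  also have "\<dots> = (\<integral>\<^sup>+t. \<integral>\<^sup>+\<sigma>. \<integral>\<^sup>+z. R t \<sigma> z \<partial>lborel \<partial>sph \<partial>lborel)"
    unfolding R_def kern_def by (rule sph_lborel.Fubini'[symmetric]) measurable
  also have "\<dots> \<le> (\<integral>\<^sup>+t. indicator {0..1::real} t * (ennreal tilt_const * (\<integral>\<^sup>+y. ennreal (norm y powr (\<gamma> + 1)) * g (a + e *\<^sub>R y) \<partial>lborel)) \<partial>lborel)"
  proof (rule nn_integral_mono)
    fix t :: real
    show "(\<integral>\<^sup>+\<sigma>. \<integral>\<^sup>+z. R t \<sigma> z \<partial>lborel \<partial>sph) \<le> indicator {0..1::real} t * (ennreal tilt_const * (\<integral>\<^sup>+y. ennreal (norm y powr (\<gamma> + 1)) * g (a + e *\<^sub>R y) \<partial>lborel))"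
      using nn_integral_kern_deflection_tilt[of t "\<lambda>y. g (a + e *\<^sub>R y)"]
      by (cases "t \<in> {0..1}") (simp_all add: R_def)
  qed
  also have "\<dots> = ennreal tilt_const * (\<integral>\<^sup>+y. ennreal (norm y powr (\<gamma> + 1)) * g (a + e *\<^sub>R y) \<partial>lborel)"
    by (simp add: nn_integral_multc)
  also have "(\<integral>\<^sup>+y. ennreal (norm y powr (\<gamma> + 1)) * g (a + e *\<^sub>R y) \<partial>lborel) = (\<integral>\<^sup>+y. ennreal (norm ((a + e *\<^sub>R y) - a) powr (\<gamma> + 1)) * g (a + e *\<^sub>R y) \<partial>lborel)"
    using e by (intro nn_integral_cong) auto
  also have "\<dots> = (\<integral>\<^sup>+x. ennreal (norm (x - a) powr (\<gamma> + 1)) * g x \<partial>lborel)"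
    by (rule nn_integral_affine_isometry[OF e, of "\<lambda>x. ennreal (norm (x - a) powr (\<gamma> + 1)) * g x"]) measurable
  also have "ennreal tilt_const * (\<integral>\<^sup>+x. ennreal (norm (x - a) powr (\<gamma> + 1)) * g x \<partial>lborel)
    \<le> ennreal tilt_const * (ennreal (9 * jb a powr (\<gamma> + 1)) * (\<integral>\<^sup>+y. ennreal (jb y powr (\<gamma> + 1) * \<bar>S y\<bar>) \<partial>lborel))"
    unfolding g_def using \<gamma> by (intro mult_left_mono nn_integral_mollify_weight \<delta>) auto
  also have "\<dots> = ennreal (9 * tilt_const * jb a powr (\<gamma> + 1)) * (\<integral>\<^sup>+y. ennreal (jb y powr (\<gamma> + 1) * (\<Sum>i\<in>UNIV. \<bar>G i y\<bar>)) \<partial>lborel)"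
    unfolding S using tilt_const_nonneg by (simp add: S_def ennreal_mult mult_ac)
  finally show ?thesis .
qed

text \<open>The bound for mollified functions does not depend on the mollification. Along a sequence for which they
converge almost everywhere it passes to the limit by Fatou's lemma; the map \<open>z \<mapsto> tilt 1 \<sigma> z\<close> pulls null sets back to null
sets on the support of the kernel. The sign \<open>e\<close> covers both \<open>v' = v\<^sub>* + z'\<close> and \<open>v'\<^sub>* = v - z'\<close>.\<close>

lemma kern_difference:
  assumes W: "weak_gradient F G" and e: "e = 1 \<or> e = (-1::real)"
  shows "(\<integral>\<^sup>+\<sigma>. \<integral>\<^sup>+z. ennreal (kern z \<sigma> * \<bar>F (a + e *\<^sub>R tilt 1 \<sigma> z) - F (a + e *\<^sub>R z)\<bar>) \<partial>lborel \<partial>sph)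
    \<le> ennreal (9 * tilt_const * jb a powr (\<gamma> + 1)) * (\<integral>\<^sup>+y. ennreal (jb y powr (\<gamma> + 1) * (\<Sum>i\<in>UNIV. \<bar>G i y\<bar>)) \<partial>lborel)"
    (is "_ \<le> ?C")
proof -
  have F: "integrable lborel F" using W by (simp add: weak_gradient_def)
  then have [measurable]: "F \<in> borel_measurable borel" by (auto dest: borel_measurable_integrable)
  obtain \<delta> where \<delta>: "\<And>n. 0 < \<delta> n" "\<And>n. 3 * \<delta> n \<le> (1::real)"
    and conv: "AE x in lborel. (\<lambda>n. mollify (\<delta> n) F x) \<longlonglongrightarrow> F x"
    using mollify_AE_convergent[OF F] by blast
  obtain N where N: "N \<in> null_sets lborel" "\<And>x. x \<notin> N \<Longrightarrow> (\<lambda>n. mollify (\<delta> n) F x) \<longlonglongrightarrow> F x"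
    using AE_E3[OF conv] by auto
  have [measurable]: "N \<in> sets borel" using N(1) by auto
  have N0: "(\<integral>\<^sup>+z. indicator N (a + e *\<^sub>R z) \<partial>lborel) = 0"
    using nn_integral_affine_isometry[OF e, of "indicator N" a] N(1) by auto
  define Y where "Y n \<sigma> z = ennreal (kern z \<sigma> * \<bar>mollify (\<delta> n) F (a + e *\<^sub>R tilt 1 \<sigma> z) - mollify (\<delta> n) F (a + e *\<^sub>R z)\<bar>)" for n \<sigma> z
  have [measurable]: "(\<lambda>(\<sigma>, z). Y n \<sigma> z) \<in> borel_measurable (borel \<Otimes>\<^sub>M borel)" for n
    unfolding Y_def kern_def by measurable
  have "(\<integral>\<^sup>+\<sigma>. \<integral>\<^sup>+z. ennreal (kern z \<sigma> * \<bar>F (a + e *\<^sub>R tilt 1 \<sigma> z) - F (a + e *\<^sub>R z)\<bar>) \<partial>lborel \<partial>sph)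
    \<le> (\<integral>\<^sup>+\<sigma>. liminf (\<lambda>n. \<integral>\<^sup>+z. Y n \<sigma> z \<partial>lborel) \<partial>sph)"
  proof (rule nn_integral_mono_AE, rule AE_mp[OF AE_sph_norm], rule AE_I2, rule impI)
    fix \<sigma> :: "real^3" assume \<sigma>: "norm \<sigma> = 1"
    have a1: "AE z in lborel. a + e *\<^sub>R z \<notin> N"
      using N0 by (subst (asm) nn_integral_0_iff_AE) (auto simp: indicator_def)
    have "(\<integral>\<^sup>+z. indicator N (a + e *\<^sub>R tilt 1 \<sigma> z) * indicator {z. z \<bullet> \<sigma> > 0} z \<partial>lborel) \<le> 8 * (\<integral>\<^sup>+z. indicator N (a + e *\<^sub>R z) \<partial>lborel)"
      by (rule nn_integral_tilt_le[OF _ _ \<sigma>, of 1 "\<lambda>y. indicator N (a + e *\<^sub>R y)"]) auto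
    then have "(\<integral>\<^sup>+z. indicator N (a + e *\<^sub>R tilt 1 \<sigma> z) * indicator {z. z \<bullet> \<sigma> > 0} z \<partial>lborel) = (0::ennreal)"
      using N0 by simp
    then have a2: "AE z in lborel. z \<bullet> \<sigma> > 0 \<longrightarrow> a + e *\<^sub>R tilt 1 \<sigma> z \<notin> N"
      by (subst (asm) nn_integral_0_iff_AE) (auto simp: indicator_def)
    have "(\<integral>\<^sup>+z. ennreal (kern z \<sigma> * \<bar>F (a + e *\<^sub>R tilt 1 \<sigma> z) - F (a + e *\<^sub>R z)\<bar>) \<partial>lborel) = (\<integral>\<^sup>+z. liminf (\<lambda>n. Y n \<sigma> z) \<partial>lborel)"
    proof (rule nn_integral_cong_AE, use a1 a2 in eventually_elim)
      case (elim z)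
      show ?case
      proof (cases "z \<bullet> \<sigma> > 0")
        case True
        have "(\<lambda>n. Y n \<sigma> z) \<longlonglongrightarrow> ennreal (kern z \<sigma> * \<bar>F (a + e *\<^sub>R tilt 1 \<sigma> z) - F (a + e *\<^sub>R z)\<bar>)"
          unfolding Y_def using elim True N(2) by (intro tendsto_ennrealI tendsto_intros) auto
        then show ?thesis by (simp add: lim_imp_Liminf)
      next
        case False
        then have "\<not> 0 < sgn z \<bullet> \<sigma>" by (auto simp: sgn_div_norm zero_less_mult_iff)
        then have "kern z \<sigma> = 0" by (simp add: kern_def q_supp)
        then show ?thesis by (simp add: Y_def Liminf_const)
      qed
    qed
    also have "\<dots> \<le> liminf (\<lambda>n. \<integral>\<^sup>+z. Y n \<sigma> z \<partial>lborel)" by (rule nn_integral_liminf) measurable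
    finally show "(\<integral>\<^sup>+z. ennreal (kern z \<sigma> * \<bar>F (a + e *\<^sub>R tilt 1 \<sigma> z) - F (a + e *\<^sub>R z)\<bar>) \<partial>lborel) \<le> liminf (\<lambda>n. \<integral>\<^sup>+z. Y n \<sigma> z \<partial>lborel)" .
  qed
  also have "\<dots> \<le> liminf (\<lambda>n. \<integral>\<^sup>+\<sigma>. \<integral>\<^sup>+z. Y n \<sigma> z \<partial>lborel \<partial>sph)"
    by (rule nn_integral_liminf) measurable
  also have "\<dots> \<le> ?C"
    by (rule Liminf_le) (auto intro!: always_eventually kern_difference_mollified[OF \<delta> W e] simp: Y_def)
  finally show ?thesis .
qed

end

section \<open>Weighted weak gradients\<close>

lemma jb_powr: "jb x powr a = (1 + (norm x)\<^sup>2) powr (a / 2)"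
proof -
  have "0 \<le> 1 + (norm x)\<^sup>2" by simp
  then have "jb x = (1 + (norm x)\<^sup>2) powr (1 / 2)" by (simp add: jb_def powr_half_sqrt)
  then show ?thesis by (simp add: powr_powr)
qed

lemma jb_powr_smooth: "(\<lambda>x. jb x powr a) \<in> smooth_class"
  unfolding jb_powr by (rule smooth_class.bracket)

lemma partial_deriv_jb_powr_le:
  assumes "0 \<le> a"
  shows "\<bar>partial_deriv i (\<lambda>x. jb x powr a) x\<bar> \<le> a * jb x powr a"
proof -
  let ?s = "1 + (norm x)\<^sup>2"
  have s: "1 \<le> ?s" by simp
  have "partial_deriv i (\<lambda>x. jb x powr a) x = (a / 2 * ?s powr (a / 2 - 1)) * (2 * (x \<bullet> axis i 1))"
    unfolding jb_powr by (rule partial_deriv_eq[OF bracket_has_derivative])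
  then have "\<bar>partial_deriv i (\<lambda>x. jb x powr a) x\<bar> = a * (?s powr (a / 2 - 1) * \<bar>x $ i\<bar>)"
    using assms by (simp add: abs_mult inner_axis)
  also have "\<dots> \<le> a * (?s powr (a / 2 - 1) * ?s powr 1)"
  proof (intro mult_left_mono)
    have "\<bar>x $ i\<bar> \<le> norm x" by (rule component_le_norm_cart)
    also have "norm x \<le> ?s"
    proof -
      have "2 * norm x \<le> 1 + norm x * norm x"
        using zero_le_power2[of "norm x - 1"] by (simp add: power2_eq_square algebra_simps)
      then show ?thesis using norm_ge_zero[of x] unfolding power2_eq_square by linarith
    qed
    finally show "\<bar>x $ i\<bar> \<le> ?s powr 1" using s by simp
  qed (use assms in auto)
  also have "?s powr (a / 2 - 1) * ?s powr 1 = ?s powr (a / 2)" unfolding powr_add[symmetric] by simp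
  finally show ?thesis by (simp add: jb_powr)
qed

lemma compact_support_bounded:
  assumes \<phi>: "\<phi> \<in> smooth_class" and c: "compact (closure {x. \<phi> x \<noteq> 0})"
  obtains B where "0 \<le> B" "\<And>x. \<bar>\<phi> x\<bar> \<le> B" "\<And>x. \<bar>partial_deriv i \<phi> x\<bar> \<le> B"
proof -
  let ?K = "closure {x. \<phi> x \<noteq> 0}"
  have bd: "\<exists>B. \<forall>x. \<bar>f x\<bar> \<le> B" if f: "f \<in> smooth_class" and z: "\<And>x. x \<notin> ?K \<Longrightarrow> f x = 0" for f
  proof -
    have "bounded (f ` ?K)"
      by (intro compact_imp_bounded compact_continuous_image smooth_class_continuous f c)
    then obtain B where "\<forall>y\<in>f ` ?K. norm y \<le> B" unfolding bounded_iff by blast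
    then have B: "\<bar>f x\<bar> \<le> B" if "x \<in> ?K" for x using that by force
    have "\<bar>f x\<bar> \<le> max B 0" for x using B[of x] z[of x] by (cases "x \<in> ?K") auto
    then show ?thesis by blast
  qed
  have z: "\<phi> x = 0" if "x \<notin> ?K" for x using that closure_subset[of "{x. \<phi> x \<noteq> 0}"] by blast
  have z': "partial_deriv i \<phi> x = 0" if "x \<notin> ?K" for x
  proof -
    have "((\<lambda>x. 0) has_derivative (\<lambda>w. 0)) (at x)" by simp
    then have "(\<phi> has_derivative (\<lambda>w. 0)) (at x)"
    proof (rule has_derivative_transform_within_open[of _ _ _ _ "- ?K"])
      show "open (- ?K)" by (rule open_Compl) (rule closed_closure)
      show "x \<in> - ?K" using that by simp
      show "0 = \<phi> y" if "y \<in> - ?K" for y using z[of y] that by simp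
    qed
    then show ?thesis by (simp add: partial_deriv_eq)
  qed
  obtain B1 where B1: "\<And>x. \<bar>\<phi> x\<bar> \<le> B1" using bd[OF \<phi> z] by blast
  obtain B2 where B2: "\<And>x. \<bar>partial_deriv i \<phi> x\<bar> \<le> B2" using bd[OF smooth_class_partial[OF \<phi>] z'] by blast
  show thesis
  proof (rule that[of "max B1 B2"])
    show "0 \<le> max B1 B2" using B1[of 0] by (simp add: le_max_iff_disj) linarith
  qed (use B1 B2 in \<open>auto simp: le_max_iff_disj\<close>)
qed

lemma integrable_weighted:
  fixes f :: "real^3 \<Rightarrow> real"
  assumes [measurable]: "f \<in> borel_measurable borel" and "(\<integral>\<^sup>+x. ennreal (jb x powr a * \<bar>f x\<bar>) \<partial>lborel) < \<infinity>"
  shows "integrable lborel (\<lambda>x. f x * jb x powr a)"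
proof (rule integrableI_bounded)
  show "(\<integral>\<^sup>+x. ennreal (norm (f x * jb x powr a)) \<partial>lborel) < \<infinity>"
    using assms(2) by (simp add: abs_mult mult.commute)
qed measurable

text \<open>The product rule. The weight is in the smooth class, so \<open>\<phi>\<close> times the weight is again a test function for \<open>h\<close>.\<close>

lemma weighted_weak_gradient:
  assumes a: "0 \<le> a" and g: "\<And>i. is_weak_partial i h (g i)"
    and fh: "(\<integral>\<^sup>+x. ennreal (jb x powr a * \<bar>h x\<bar>) \<partial>lborel) < \<infinity>"
    and fg: "\<And>i. (\<integral>\<^sup>+x. ennreal (jb x powr a * \<bar>g i x\<bar>) \<partial>lborel) < \<infinity>"
  shows "weak_gradient (\<lambda>x. h x * jb x powr a) (\<lambda>i x. g i x * jb x powr a + h x * partial_deriv i (\<lambda>x. jb x powr a) x)"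
proof -
  have [measurable]: "h \<in> borel_measurable borel" "\<And>i. g i \<in> borel_measurable borel"
    using g by (auto simp: is_weak_partial_def locally_integrable_def)
  let ?w = "\<lambda>x. jb x powr a"
  have [measurable]: "partial_deriv i ?w \<in> borel_measurable borel" for i
    by (rule smooth_class_measurable[OF smooth_class_partial[OF jb_powr_smooth]])
  have hw: "integrable lborel (\<lambda>x. h x * ?w x)" by (rule integrable_weighted) (use fh in auto)
  have gw: "integrable lborel (\<lambda>x. g i x * ?w x)" for i by (rule integrable_weighted) (use fg in auto)
  have hdw: "integrable lborel (\<lambda>x. h x * partial_deriv i ?w x)" for i
  proof (rule Bochner_Integration.integrable_bound[OF integrable_mult_right[OF hw, of a]])
    show "AE x in lborel. norm (h x * partial_deriv i ?w x) \<le> norm (a * (h x * ?w x))"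
      using partial_deriv_jb_powr_le[OF a] a by (intro AE_I2) (auto simp: abs_mult mult.left_commute[of a] intro!: mult_left_mono)
  qed measurable
  show ?thesis
    unfolding weak_gradient_def
  proof (intro conjI allI ballI impI)
    show "integrable lborel (\<lambda>x. h x * ?w x)" by (rule hw)
    show "integrable lborel (\<lambda>x. g i x * ?w x + h x * partial_deriv i ?w x)" for i
      using gw hdw by (rule Bochner_Integration.integrable_add)
    fix \<phi> i assume \<phi>: "\<phi> \<in> smooth_class" and c: "compact (closure {x. \<phi> x \<noteq> 0})"
    have [measurable]: "\<phi> \<in> borel_measurable borel" "partial_deriv i \<phi> \<in> borel_measurable borel"
      using smooth_class_measurable[OF \<phi>] smooth_class_measurable[OF smooth_class_partial[OF \<phi>]] by auto
    obtain B where B: "0 \<le> B" "\<And>x. \<bar>\<phi> x\<bar> \<le> B" "\<And>x. \<bar>partial_deriv i \<phi> x\<bar> \<le> B"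
      using compact_support_bounded[OF \<phi> c, where i = i] by blast
    let ?\<psi> = "\<lambda>x. ?w x * \<phi> x"
    have \<psi>: "?\<psi> \<in> smooth_class" by (rule smooth_class.mult[OF jb_powr_smooth \<phi>])
    have "{x. ?\<psi> x \<noteq> 0} \<subseteq> {x. \<phi> x \<noteq> 0}" by auto
    then have "compact (closure {x. ?\<psi> x \<noteq> 0})"
      using c bounded_subset unfolding compact_closure by blast
    then have "test_function ?\<psi>" by (rule smooth_class_test_function[OF \<psi>])
    then have ibp: "(\<integral>x. h x * partial_deriv i ?\<psi> x \<partial>lborel) = - (\<integral>x. g i x * ?\<psi> x \<partial>lborel)"
      using g[of i] by (simp add: is_weak_partial_def)
    have i1: "integrable lborel (\<lambda>x. (h x * ?w x) * partial_deriv i \<phi> x)"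
      by (rule integrable_mult_bounded[OF hw]) (use B in auto)
    have i2: "integrable lborel (\<lambda>x. (h x * partial_deriv i ?w x) * \<phi> x)"
      by (rule integrable_mult_bounded[OF hdw]) (use B in auto)
    have i3: "integrable lborel (\<lambda>x. (g i x * ?w x) * \<phi> x)"
      by (rule integrable_mult_bounded[OF gw]) (use B in auto)
    have "(\<integral>x. h x * partial_deriv i ?\<psi> x \<partial>lborel) = (\<integral>x. (h x * ?w x) * partial_deriv i \<phi> x + (h x * partial_deriv i ?w x) * \<phi> x \<partial>lborel)"
      unfolding partial_deriv_mult[OF jb_powr_smooth \<phi>] by (simp only: distrib_left mult.assoc)
    also have "\<dots> = (\<integral>x. (h x * ?w x) * partial_deriv i \<phi> x \<partial>lborel) + (\<integral>x. (h x * partial_deriv i ?w x) * \<phi> x \<partial>lborel)"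
      by (rule Bochner_Integration.integral_add[OF i1 i2])
    finally have e1: "(\<integral>x. (h x * ?w x) * partial_deriv i \<phi> x \<partial>lborel) + (\<integral>x. (h x * partial_deriv i ?w x) * \<phi> x \<partial>lborel) = - (\<integral>x. (g i x * ?w x) * \<phi> x \<partial>lborel)"
      using ibp by (simp add: mult.assoc)
    have "(\<integral>x. (g i x * ?w x + h x * partial_deriv i ?w x) * \<phi> x \<partial>lborel) = (\<integral>x. (g i x * ?w x) * \<phi> x + (h x * partial_deriv i ?w x) * \<phi> x \<partial>lborel)"
      by (simp add: distrib_right)
    also have "\<dots> = (\<integral>x. (g i x * ?w x) * \<phi> x \<partial>lborel) + (\<integral>x. (h x * partial_deriv i ?w x) * \<phi> x \<partial>lborel)"
      by (rule Bochner_Integration.integral_add[OF i3 i2])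
    finally show "(\<integral>x. h x * ?w x * partial_deriv i \<phi> x \<partial>lborel) = - (\<integral>x. (g i x * ?w x + h x * partial_deriv i ?w x) * \<phi> x \<partial>lborel)"
      using e1 by simp
  qed
qed

section \<open>Exchange of pre- and post-collisional velocities\<close>

lemma nn_integral_centre_of_mass:
  fixes f :: "real^3 \<Rightarrow> real^3 \<Rightarrow> ennreal"
  assumes [measurable]: "(\<lambda>(v, vs). f v vs) \<in> borel_measurable (borel \<Otimes>\<^sub>M borel)"
  shows "(\<integral>\<^sup>+v. \<integral>\<^sup>+vs. f v vs \<partial>lborel \<partial>lborel) = (\<integral>\<^sup>+c. \<integral>\<^sup>+z. f (c + z /\<^sub>R 2) (c - z /\<^sub>R 2) \<partial>lborel \<partial>lborel)"
proof -
  have "(\<integral>\<^sup>+v. \<integral>\<^sup>+vs. f v vs \<partial>lborel \<partial>lborel) = (\<integral>\<^sup>+v. \<integral>\<^sup>+z. f v (v + (-1) *\<^sub>R z) \<partial>lborel \<partial>lborel)"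
    by (intro nn_integral_cong nn_integral_affine_isometry[symmetric]) (auto intro!: measurable_compose[OF _ assms, of "\<lambda>y. (_, y)", simplified])
  also have "\<dots> = (\<integral>\<^sup>+z. \<integral>\<^sup>+v. f v (v - z) \<partial>lborel \<partial>lborel)"
    by (subst lborel_pair.Fubini') simp_all
  also have "\<dots> = (\<integral>\<^sup>+z. \<integral>\<^sup>+c. f (z /\<^sub>R 2 + c) (z /\<^sub>R 2 + c - z) \<partial>lborel \<partial>lborel)"
    by (intro nn_integral_cong nn_integral_shift[symmetric]) measurable
  also have "\<dots> = (\<integral>\<^sup>+z. \<integral>\<^sup>+c. f (c + z /\<^sub>R 2) (c - z /\<^sub>R 2) \<partial>lborel \<partial>lborel)"
  proof -
    have a: "z /\<^sub>R 2 + c = c + z /\<^sub>R 2" and b: "c + z /\<^sub>R 2 - z = c - z /\<^sub>R 2" for z c :: "real^3"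
      by (simp_all add: vec_eq_iff field_simps)
    show ?thesis unfolding a b ..
  qed
  also have "\<dots> = (\<integral>\<^sup>+c. \<integral>\<^sup>+z. f (c + z /\<^sub>R 2) (c - z /\<^sub>R 2) \<partial>lborel \<partial>lborel)"
    by (rule lborel_pair.Fubini') measurable
  finally show ?thesis .
qed

context angular_kernel
begin

text \<open>In terms of the centre of mass \<open>c\<close> and the relative velocity \<open>z\<close> a collision fixes \<open>c\<close> and replaces \<open>z\<close> by
\<open>\<bar>z\<bar> \<sigma>\<close>: it exchanges the directions \<open>sgn z\<close> and \<open>\<sigma>\<close>, and the kernel is symmetric in these.\<close>

lemma pre_post_collisional:
  fixes \<Psi> :: "real^3 \<Rightarrow> real^3 \<Rightarrow> real^3 \<Rightarrow> real^3 \<Rightarrow> ennreal"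
  assumes \<Psi> [measurable]: "(\<lambda>(a, b, c, d). \<Psi> a b c d) \<in> borel_measurable (borel \<Otimes>\<^sub>M borel \<Otimes>\<^sub>M borel \<Otimes>\<^sub>M borel)"
  shows "(\<integral>\<^sup>+v. \<integral>\<^sup>+vs. \<integral>\<^sup>+\<sigma>. ennreal (kern (v - vs) \<sigma>) * \<Psi> (vs + tilt 1 \<sigma> (v - vs)) (v - tilt 1 \<sigma> (v - vs)) v vs \<partial>sph \<partial>lborel \<partial>lborel)
    = (\<integral>\<^sup>+v. \<integral>\<^sup>+vs. \<integral>\<^sup>+\<sigma>. ennreal (kern (v - vs) \<sigma>) * \<Psi> v vs (vs + tilt 1 \<sigma> (v - vs)) (v - tilt 1 \<sigma> (v - vs)) \<partial>sph \<partial>lborel \<partial>lborel)"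
proof -
  have \<Psi>m: "(\<lambda>x. \<Psi> (f1 x) (f2 x) (f3 x) (f4 x)) \<in> borel_measurable M"
    if "f1 \<in> borel_measurable M" "f2 \<in> borel_measurable M" "f3 \<in> borel_measurable M" "f4 \<in> borel_measurable M"
    for f1 f2 f3 f4 :: "(real^3) \<times> (real^3) \<Rightarrow> real^3" and M
    using measurable_compose[OF _ \<Psi>, of "\<lambda>x. (f1 x, f2 x, f3 x, f4 x)" M] that by simp
  have \<Psi>m3: "(\<lambda>x. \<Psi> (f1 x) (f2 x) (f3 x) (f4 x)) \<in> borel_measurable M"
    if "f1 \<in> borel_measurable M" "f2 \<in> borel_measurable M" "f3 \<in> borel_measurable M" "f4 \<in> borel_measurable M"
    for f1 f2 f3 f4 :: "((real^3) \<times> (real^3)) \<times> (real^3) \<Rightarrow> real^3" and M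
    using measurable_compose[OF _ \<Psi>, of "\<lambda>x. (f1 x, f2 x, f3 x, f4 x)" M] that by simp
  have m1: "(\<lambda>(v, vs). \<integral>\<^sup>+\<sigma>. ennreal (kern (v - vs) \<sigma>) * \<Psi> (vs + tilt 1 \<sigma> (v - vs)) (v - tilt 1 \<sigma> (v - vs)) v vs \<partial>sph) \<in> borel_measurable (borel \<Otimes>\<^sub>M borel)"
    unfolding case_prod_beta' kern_def
    by (rule sph.borel_measurable_nn_integral, unfold case_prod_beta', intro borel_measurable_times_ennreal \<Psi>m3) measurable
  have m2: "(\<lambda>(v, vs). \<integral>\<^sup>+\<sigma>. ennreal (kern (v - vs) \<sigma>) * \<Psi> v vs (vs + tilt 1 \<sigma> (v - vs)) (v - tilt 1 \<sigma> (v - vs)) \<partial>sph) \<in> borel_measurable (borel \<Otimes>\<^sub>M borel)"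
    unfolding case_prod_beta' kern_def
    by (rule sph.borel_measurable_nn_integral, unfold case_prod_beta', intro borel_measurable_times_ennreal \<Psi>m3) measurable
  have zz: "(c + z /\<^sub>R 2) - (c - z /\<^sub>R 2) = z" for c z :: "real^3" by (simp add: vec_eq_iff)
  have p1: "(c - z /\<^sub>R 2) + tilt 1 \<sigma> z = c + (norm z / 2) *\<^sub>R \<sigma>"
    and p2: "(c + z /\<^sub>R 2) - tilt 1 \<sigma> z = c - (norm z / 2) *\<^sub>R \<sigma>" for c z \<sigma>
    by (simp_all add: tilt_def vec_eq_iff field_simps)
  have "(\<integral>\<^sup>+v. \<integral>\<^sup>+vs. \<integral>\<^sup>+\<sigma>. ennreal (kern (v - vs) \<sigma>) * \<Psi> (vs + tilt 1 \<sigma> (v - vs)) (v - tilt 1 \<sigma> (v - vs)) v vs \<partial>sph \<partial>lborel \<partial>lborel)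
    = (\<integral>\<^sup>+c. \<integral>\<^sup>+z. \<integral>\<^sup>+\<sigma>. ennreal (kern z \<sigma>) * \<Psi> (c + (norm z / 2) *\<^sub>R \<sigma>) (c - (norm z / 2) *\<^sub>R \<sigma>) (c + z /\<^sub>R 2) (c - z /\<^sub>R 2) \<partial>sph \<partial>lborel \<partial>lborel)"
    unfolding nn_integral_centre_of_mass[OF m1] zz p1 p2 ..
  also have "\<dots> = (\<integral>\<^sup>+c. \<integral>\<^sup>+z. \<integral>\<^sup>+\<sigma>. ennreal (kern z \<sigma>) * \<Psi> (c + z /\<^sub>R 2) (c - z /\<^sub>R 2) (c + (norm z / 2) *\<^sub>R \<sigma>) (c - (norm z / 2) *\<^sub>R \<sigma>) \<partial>sph \<partial>lborel \<partial>lborel)"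
  proof (rule nn_integral_cong)
    fix c :: "real^3"
    define G where "G = (\<lambda>(z, \<sigma>). ennreal (kern z \<sigma>) * \<Psi> (c + (norm z / 2) *\<^sub>R \<sigma>) (c - (norm z / 2) *\<^sub>R \<sigma>) (c + z /\<^sub>R 2) (c - z /\<^sub>R 2))"
    have G: "G \<in> borel_measurable (borel \<Otimes>\<^sub>M borel)"
      unfolding G_def kern_def case_prod_beta' by (intro borel_measurable_times_ennreal \<Psi>m) measurable
    have "(\<integral>\<^sup>+z. \<integral>\<^sup>+\<sigma>. G (z, \<sigma>) \<partial>sph \<partial>lborel) = (\<integral>\<^sup>+z. \<integral>\<^sup>+\<sigma>. G (norm z *\<^sub>R \<sigma>, sgn z) \<partial>sph \<partial>lborel)"
      by (rule nn_integral_exchange_direction[OF G, symmetric])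
    also have "\<dots> = (\<integral>\<^sup>+z. \<integral>\<^sup>+\<sigma>. ennreal (kern z \<sigma>) * \<Psi> (c + z /\<^sub>R 2) (c - z /\<^sub>R 2) (c + (norm z / 2) *\<^sub>R \<sigma>) (c - (norm z / 2) *\<^sub>R \<sigma>) \<partial>sph \<partial>lborel)"
    proof (rule nn_integral_cong, rule nn_integral_cong_AE, rule AE_mp[OF AE_sph_norm], rule AE_I2, rule impI)
      fix z \<sigma> :: "real^3" assume \<sigma>: "norm \<sigma> = 1"
      have k: "kern (norm z *\<^sub>R \<sigma>) (sgn z) = kern z \<sigma>"
        using \<sigma> by (cases "z = 0") (simp_all add: kern_def sgn_div_norm inner_commute)
      have n: "norm (norm z *\<^sub>R \<sigma>) = norm z" using \<sigma> by simp
      have s: "(norm z / 2) *\<^sub>R sgn z = z /\<^sub>R 2" by (cases "z = 0") (simp_all add: sgn_div_norm)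
      have t: "(norm z *\<^sub>R \<sigma>) /\<^sub>R 2 = (norm z / 2) *\<^sub>R \<sigma>" by simp
      show "G (norm z *\<^sub>R \<sigma>, sgn z) = ennreal (kern z \<sigma>) * \<Psi> (c + z /\<^sub>R 2) (c - z /\<^sub>R 2) (c + (norm z / 2) *\<^sub>R \<sigma>) (c - (norm z / 2) *\<^sub>R \<sigma>)"
        unfolding G_def prod.case k n s t ..
    qed
    finally show "(\<integral>\<^sup>+z. \<integral>\<^sup>+\<sigma>. ennreal (kern z \<sigma>) * \<Psi> (c + (norm z / 2) *\<^sub>R \<sigma>) (c - (norm z / 2) *\<^sub>R \<sigma>) (c + z /\<^sub>R 2) (c - z /\<^sub>R 2) \<partial>sph \<partial>lborel)
      = (\<integral>\<^sup>+z. \<integral>\<^sup>+\<sigma>. ennreal (kern z \<sigma>) * \<Psi> (c + z /\<^sub>R 2) (c - z /\<^sub>R 2) (c + (norm z / 2) *\<^sub>R \<sigma>) (c - (norm z / 2) *\<^sub>R \<sigma>) \<partial>sph \<partial>lborel)"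
      by (simp add: G_def)
  qed
  also have "\<dots> = (\<integral>\<^sup>+v. \<integral>\<^sup>+vs. \<integral>\<^sup>+\<sigma>. ennreal (kern (v - vs) \<sigma>) * \<Psi> v vs (vs + tilt 1 \<sigma> (v - vs)) (v - tilt 1 \<sigma> (v - vs)) \<partial>sph \<partial>lborel \<partial>lborel)"
    unfolding nn_integral_centre_of_mass[OF m2] zz p1 p2 ..
  finally show ?thesis .
qed

end

section \<open>Estimates for the collision operator\<close>

definition weighted_L1 :: "real \<Rightarrow> (real^3 \<Rightarrow> real) \<Rightarrow> ennreal" where
  "weighted_L1 a f = (\<integral>\<^sup>+v. ennreal (jb v powr a * \<bar>f v\<bar>) \<partial>lborel)"

lemma weighted_L1_mono:
  assumes "a \<le> b" shows "weighted_L1 a f \<le> weighted_L1 b f"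
  unfolding weighted_L1_def
  by (intro nn_integral_mono ennreal_leI mult_right_mono powr_mono assms jb_ge_1) auto

lemma post_v_tilt: "post_v v vs \<sigma> = vs + tilt 1 \<sigma> (v - vs)"
  and post_vs_tilt: "post_vs v vs \<sigma> = v - tilt 1 \<sigma> (v - vs)"
  by (simp_all add: post_v_def post_vs_def tilt_def vec_eq_iff field_simps)

lemma jb_lipschitz: "\<bar>jb x - jb y\<bar> \<le> norm (x - y)"
proof -
  have e: "jb u = norm (1 :: real, u)" for u by (simp add: jb_def norm_Pair)
  have "\<bar>norm (1 :: real, x) - norm (1 :: real, y)\<bar> \<le> norm ((1, x) - (1 :: real, y))" by (rule norm_triangle_ineq3)
  then show ?thesis by (simp add: e norm_Pair)
qed

lemma jb_post_v_le:
  assumes \<sigma>: "norm \<sigma> = 1" shows "jb (post_v v vs \<sigma>) \<le> jb v + jb vs"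
proof -
  have "norm (post_v v vs \<sigma>) \<le> norm ((v + vs) /\<^sub>R 2) + norm ((norm (v - vs) / 2) *\<^sub>R \<sigma>)"
    unfolding post_v_def by (rule norm_triangle_ineq)
  also have "\<dots> = norm (v + vs) / 2 + norm (v - vs) / 2" using \<sigma> by simp
  also have "\<dots> \<le> norm v + norm vs" using norm_triangle_ineq[of v vs] norm_triangle_ineq4[of v vs] by linarith
  finally have "(norm (post_v v vs \<sigma>))\<^sup>2 \<le> (norm v + norm vs)\<^sup>2" by (intro power_mono) auto
  also have "\<dots> \<le> (jb v + jb vs)\<^sup>2 - 1"
  proof -
    have "norm v * norm vs \<le> jb v * jb vs" by (intro mult_mono norm_le_jb) (auto simp: less_imp_le[OF jb_pos])
    moreover have "(jb v)\<^sup>2 = 1 + (norm v)\<^sup>2" "(jb vs)\<^sup>2 = 1 + (norm vs)\<^sup>2" by (simp_all add: jb_def)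
    ultimately show ?thesis by (simp add: power2_sum)
  qed
  finally have "1 + (norm (post_v v vs \<sigma>))\<^sup>2 \<le> (jb v + jb vs)\<^sup>2" by simp
  then have "sqrt (1 + (norm (post_v v vs \<sigma>))\<^sup>2) \<le> sqrt ((jb v + jb vs)\<^sup>2)" by (rule real_sqrt_le_mono)
  then show ?thesis using jb_pos[of v] jb_pos[of vs] unfolding jb_def[of "post_v v vs \<sigma>"] by simp
qed

lemma powr_difference_le:
  fixes x y :: real
  assumes x: "0 < x" "x \<le> M" and y: "0 < y" "y \<le> M" and k: "1 \<le> k"
  shows "\<bar>x powr k - y powr k\<bar> \<le> k * M powr (k - 1) * \<bar>x - y\<bar>"
proof -
  have *: "b powr k - a powr k \<le> k * M powr (k - 1) * (b - a)" if ab: "0 < a" "a < b" "b \<le> M" for a b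
  proof -
    have "\<exists>z. a < z \<and> z < b \<and> b powr k - a powr k = (b - a) * (k * z powr (k - 1))"
      by (rule MVT2) (use ab in \<open>auto intro!: has_real_derivative_powr\<close>)
    then obtain z where z: "a < z" "z < b" "b powr k - a powr k = (b - a) * (k * z powr (k - 1))" by blast
    have "z powr (k - 1) \<le> M powr (k - 1)" using z ab k by (intro powr_mono2) auto
    then have "(b - a) * (k * z powr (k - 1)) \<le> (b - a) * (k * M powr (k - 1))"
      using ab k by (intro mult_left_mono) auto
    then show ?thesis unfolding z(3) by (simp add: mult_ac)
  qed
  have mono: "a < b \<Longrightarrow> 0 < a \<Longrightarrow> a powr k \<le> b powr k" for a b :: real
    using k by (intro powr_mono2) auto
  show ?thesis
    using *[of x y] *[of y x] mono[of x y] mono[of y x] x y by (cases x y rule: linorder_cases) (auto simp: abs_if algebra_simps)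
qed

lemma sum_powr_le:
  fixes x y :: real
  assumes "0 \<le> x" "0 \<le> y" "0 \<le> p"
  shows "(x + y) powr p \<le> 2 powr p * (x powr p + y powr p)"
proof -
  have "(x + y) powr p \<le> (2 * max x y) powr p" using assms by (intro powr_mono2) auto
  also have "\<dots> = 2 powr p * max x y powr p" using assms by (simp add: powr_mult)
  also have "max x y powr p \<le> x powr p + y powr p" by (auto simp: max_def)
  finally show ?thesis by simp
qed

lemma distr_pair_isometry:
  fixes v :: "real^3"
  assumes e: "e = 1 \<or> e = (-1::real)"
  shows "distr (lborel \<Otimes>\<^sub>M sph) (lborel \<Otimes>\<^sub>M sph) (\<lambda>(z, \<sigma>). (v + e *\<^sub>R z, \<sigma>)) = lborel \<Otimes>\<^sub>M sph"
proof (rule measure_eqI)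
  fix X assume "X \<in> sets (distr (lborel \<Otimes>\<^sub>M sph) (lborel \<Otimes>\<^sub>M sph) (\<lambda>(z, \<sigma>). (v + e *\<^sub>R z, \<sigma>)))"
  then have X: "X \<in> sets (lborel \<Otimes>\<^sub>M sph)" by simp
  have [measurable]: "indicator X \<in> borel_measurable (lborel \<Otimes>\<^sub>M sph)" using X by simp
  have T: "(\<lambda>(z, \<sigma>). (v + e *\<^sub>R z, \<sigma>)) \<in> lborel \<Otimes>\<^sub>M sph \<rightarrow>\<^sub>M lborel \<Otimes>\<^sub>M sph" by measurable
  have "emeasure (distr (lborel \<Otimes>\<^sub>M sph) (lborel \<Otimes>\<^sub>M sph) (\<lambda>(z, \<sigma>). (v + e *\<^sub>R z, \<sigma>))) X
    = (\<integral>\<^sup>+x. indicator X x \<partial>distr (lborel \<Otimes>\<^sub>M sph) (lborel \<Otimes>\<^sub>M sph) (\<lambda>(z, \<sigma>). (v + e *\<^sub>R z, \<sigma>)))"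
    using X by simp
  also have "\<dots> = (\<integral>\<^sup>+x. indicator X (case x of (z, \<sigma>) \<Rightarrow> (v + e *\<^sub>R z, \<sigma>)) \<partial>(lborel \<Otimes>\<^sub>M sph))"
    by (rule nn_integral_distr[OF T]) measurable
  also have "\<dots> = (\<integral>\<^sup>+\<sigma>. \<integral>\<^sup>+z. indicator X (v + e *\<^sub>R z, \<sigma>) \<partial>lborel \<partial>sph)"
  proof -
    have "(\<lambda>x. indicator X (case x of (z, \<sigma>) \<Rightarrow> (v + e *\<^sub>R z, \<sigma>)) :: ennreal) \<in> borel_measurable (lborel \<Otimes>\<^sub>M sph)"
      by (rule measurable_compose[OF T]) measurable
    from lborel_sph.nn_integral_snd[OF this] show ?thesis by simp
  qed
  also have "\<dots> = (\<integral>\<^sup>+\<sigma>. \<integral>\<^sup>+z. indicator X (z, \<sigma>) \<partial>lborel \<partial>sph)"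
  proof (rule nn_integral_cong)
    fix \<sigma> :: "real^3"
    have "(\<lambda>z. indicator X (z, \<sigma>)) \<in> borel_measurable lborel" by measurable
    then show "(\<integral>\<^sup>+z. indicator X (v + e *\<^sub>R z, \<sigma>) \<partial>lborel) = (\<integral>\<^sup>+z. (indicator X (z, \<sigma>) :: ennreal) \<partial>lborel)"
      by (intro nn_integral_affine_isometry[OF e]) simp
  qed
  also have "\<dots> = (\<integral>\<^sup>+x. indicator X x \<partial>(lborel \<Otimes>\<^sub>M sph))"
    by (subst lborel_sph.nn_integral_snd[symmetric]) simp_all
  also have "\<dots> = emeasure (lborel \<Otimes>\<^sub>M sph) X" using X by simp
  finally show "emeasure (distr (lborel \<Otimes>\<^sub>M sph) (lborel \<Otimes>\<^sub>M sph) (\<lambda>(z, \<sigma>). (v + e *\<^sub>R z, \<sigma>))) X = emeasure (lborel \<Otimes>\<^sub>M sph) X" .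
qed simp

lemma measurable_post [measurable]:
  assumes [measurable]: "f \<in> borel_measurable M" "g \<in> borel_measurable M" "u \<in> borel_measurable M"
  shows "(\<lambda>x. post_v (f x) (g x) (u x)) \<in> borel_measurable M" "(\<lambda>x. post_vs (f x) (g x) (u x)) \<in> borel_measurable M"
  unfolding post_v_def post_vs_def by measurable

context angular_kernel
begin

definition weight_const :: "real \<Rightarrow> real" where
  "weight_const k = k * (2 * pi * K * A) * 2 powr (\<gamma> + k)"

text \<open>After exchanging the velocities, \<open>\<bar>m' - m\<bar> \<le> k (jb v + jb v\<^sub>*) powr (k - 1) \<bar>v' - v\<bar>\<close>. Integrating the kernel times the
deflection over \<open>\<sigma>\<close> yields the total weight \<open>(jb v + jb v\<^sub>*) powr (\<gamma> + k)\<close>, which is at most a constant times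
\<open>jb v powr (\<gamma> + k) * jb v\<^sub>* powr k\<close> plus the same expression with the two velocities exchanged.\<close>

lemma weight_commutator_bound:
  assumes k: "1 \<le> k" and [measurable]: "h \<in> borel_measurable borel"
  shows "(\<integral>\<^sup>+v. \<integral>\<^sup>+vs. \<integral>\<^sup>+\<sigma>. ennreal (kern (v - vs) \<sigma>) * ennreal \<bar>h (post_vs v vs \<sigma>) * h (post_v v vs \<sigma>) * (jb v powr k - jb (post_v v vs \<sigma>) powr k)\<bar> \<partial>sph \<partial>lborel \<partial>lborel)
    \<le> ennreal (2 * weight_const k) * (weighted_L1 (\<gamma> + k) h * weighted_L1 k h)"
proof -
  define c where "c = weight_const k"
  have c: "0 \<le> c" using k K A_pos by (simp add: c_def weight_const_def)
  have "(\<integral>\<^sup>+v. \<integral>\<^sup>+vs. \<integral>\<^sup>+\<sigma>. ennreal (kern (v - vs) \<sigma>) * ennreal \<bar>h (post_vs v vs \<sigma>) * h (post_v v vs \<sigma>) * (jb v powr k - jb (post_v v vs \<sigma>) powr k)\<bar> \<partial>sph \<partial>lborel \<partial>lborel)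
    = (\<integral>\<^sup>+v. \<integral>\<^sup>+vs. \<integral>\<^sup>+\<sigma>. ennreal (kern (v - vs) \<sigma>) * ennreal \<bar>h vs * h v * (jb (post_v v vs \<sigma>) powr k - jb v powr k)\<bar> \<partial>sph \<partial>lborel \<partial>lborel)"
    unfolding post_v_tilt post_vs_tilt
    by (rule pre_post_collisional[of "\<lambda>v' vs' v vs. ennreal \<bar>h vs' * h v' * (jb v powr k - jb v' powr k)\<bar>"]) measurable
  also have "\<dots> \<le> (\<integral>\<^sup>+v. \<integral>\<^sup>+vs. ennreal c * (ennreal (jb v powr (\<gamma> + k) * \<bar>h v\<bar>) * ennreal (jb vs powr k * \<bar>h vs\<bar>)
      + ennreal (jb v powr k * \<bar>h v\<bar>) * ennreal (jb vs powr (\<gamma> + k) * \<bar>h vs\<bar>)) \<partial>lborel \<partial>lborel)"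
  proof (intro nn_integral_mono)
    fix v vs :: "real^3"
    define J where "J = jb v + jb vs"
    have J: "0 < J" "jb v \<le> J" using jb_pos[of v] jb_pos[of vs] by (auto simp: J_def)
    define P where "P = \<bar>h vs * h v\<bar> * (k * J powr (k - 1))"
    have P: "0 \<le> P" using k by (simp add: P_def)
    have "(\<integral>\<^sup>+\<sigma>. ennreal (kern (v - vs) \<sigma>) * ennreal \<bar>h vs * h v * (jb (post_v v vs \<sigma>) powr k - jb v powr k)\<bar> \<partial>sph)
      \<le> (\<integral>\<^sup>+\<sigma>. ennreal P * ennreal (kern (v - vs) \<sigma> * norm (tilt 1 \<sigma> (v - vs) - (v - vs))) \<partial>sph)"
    proof (rule nn_integral_mono_AE, rule AE_mp[OF AE_sph_norm], rule AE_I2, rule impI)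
      fix \<sigma> :: "real^3" assume \<sigma>: "norm \<sigma> = 1"
      let ?d = "norm (tilt 1 \<sigma> (v - vs) - (v - vs))"
      have pd: "post_v v vs \<sigma> - v = tilt 1 \<sigma> (v - vs) - (v - vs)" by (simp add: post_v_tilt)
      have d: "\<bar>jb (post_v v vs \<sigma>) - jb v\<bar> \<le> ?d" using jb_lipschitz[of "post_v v vs \<sigma>" v] unfolding pd .
      have "\<bar>jb (post_v v vs \<sigma>) powr k - jb v powr k\<bar> \<le> k * J powr (k - 1) * \<bar>jb (post_v v vs \<sigma>) - jb v\<bar>"
        using jb_post_v_le[OF \<sigma>, of v vs] J k by (intro powr_difference_le jb_pos) (auto simp: J_def)
      also have "\<dots> \<le> k * J powr (k - 1) * ?d" using d k by (intro mult_left_mono) auto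
      finally have "\<bar>h vs * h v\<bar> * \<bar>jb (post_v v vs \<sigma>) powr k - jb v powr k\<bar> \<le> \<bar>h vs * h v\<bar> * (k * J powr (k - 1) * ?d)"
        by (rule mult_left_mono) simp
      then have "kern (v - vs) \<sigma> * \<bar>h vs * h v * (jb (post_v v vs \<sigma>) powr k - jb v powr k)\<bar> \<le> kern (v - vs) \<sigma> * (P * ?d)"
        unfolding P_def abs_mult[of "h vs * h v"] by (intro mult_left_mono kern_nonneg) (simp add: mult.assoc)
      then show "ennreal (kern (v - vs) \<sigma>) * ennreal \<bar>h vs * h v * (jb (post_v v vs \<sigma>) powr k - jb v powr k)\<bar>
        \<le> ennreal P * ennreal (kern (v - vs) \<sigma> * ?d)"
        using P kern_nonneg by (simp add: ennreal_mult[symmetric] mult_ac ennreal_leI)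
    qed
    also have "\<dots> = ennreal P * (\<integral>\<^sup>+\<sigma>. ennreal (kern (v - vs) \<sigma> * norm (tilt 1 \<sigma> (v - vs) - (v - vs))) \<partial>sph)"
      by (rule nn_integral_cmult) measurable
    also have "\<dots> \<le> ennreal P * ennreal (2 * pi * K * A * norm (v - vs) powr (\<gamma> + 1))"
      by (intro mult_left_mono nn_integral_kern_deflection) simp
    also have "\<dots> \<le> ennreal (P * (2 * pi * K * A * J powr (\<gamma> + 1)))"
    proof -
      have "norm (v - vs) \<le> J" unfolding J_def using norm_triangle_ineq4[of v vs] norm_le_jb[of v] norm_le_jb[of vs] by linarith
      then have "norm (v - vs) powr (\<gamma> + 1) \<le> J powr (\<gamma> + 1)" using \<gamma> by (intro powr_mono2) auto
      then have "P * (2 * pi * K * A * norm (v - vs) powr (\<gamma> + 1)) \<le> P * (2 * pi * K * A * J powr (\<gamma> + 1))"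
        using P K A_pos by (intro mult_left_mono) auto
      then show ?thesis using P by (simp add: ennreal_mult'[symmetric] ennreal_leI)
    qed
    also have "\<dots> \<le> ennreal (c * (jb v powr (\<gamma> + k) * \<bar>h v\<bar> * (jb vs powr k * \<bar>h vs\<bar>) + jb v powr k * \<bar>h v\<bar> * (jb vs powr (\<gamma> + k) * \<bar>h vs\<bar>)))"
    proof (rule ennreal_leI)
      have "J powr (k - 1) * J powr (\<gamma> + 1) = J powr (\<gamma> + k)" unfolding powr_add[symmetric] by (simp add: add.commute)
      then have "P * (2 * pi * K * A * J powr (\<gamma> + 1)) = (k * (2 * pi * K * A)) * \<bar>h vs * h v\<bar> * J powr (\<gamma> + k)"
        by (simp add: P_def mult_ac)
      also have "\<dots> \<le> (k * (2 * pi * K * A)) * \<bar>h vs * h v\<bar> * (2 powr (\<gamma> + k) * (jb v powr (\<gamma> + k) * jb vs powr k + jb v powr k * jb vs powr (\<gamma> + k)))"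
      proof (intro mult_left_mono)
        have "J powr (\<gamma> + k) \<le> 2 powr (\<gamma> + k) * (jb v powr (\<gamma> + k) + jb vs powr (\<gamma> + k))"
          unfolding J_def using jb_pos[of v] jb_pos[of vs] \<gamma> k by (intro sum_powr_le) auto
        also have "\<dots> \<le> 2 powr (\<gamma> + k) * (jb v powr (\<gamma> + k) * jb vs powr k + jb v powr k * jb vs powr (\<gamma> + k))"
        proof (intro mult_left_mono add_mono)
          have "1 \<le> jb u powr k" for u using k by (intro ge_one_powr_ge_zero jb_ge_1) auto
          then show "jb v powr (\<gamma> + k) \<le> jb v powr (\<gamma> + k) * jb vs powr k" "jb vs powr (\<gamma> + k) \<le> jb v powr k * jb vs powr (\<gamma> + k)"
            using mult_left_mono[of 1 "jb vs powr k" "jb v powr (\<gamma> + k)"] mult_right_mono[of 1 "jb v powr k" "jb vs powr (\<gamma> + k)"] by auto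
        qed simp
        finally show "J powr (\<gamma> + k) \<le> 2 powr (\<gamma> + k) * (jb v powr (\<gamma> + k) * jb vs powr k + jb v powr k * jb vs powr (\<gamma> + k))" .
      qed (use k K A_pos in auto)
      also have "\<dots> = c * (jb v powr (\<gamma> + k) * \<bar>h v\<bar> * (jb vs powr k * \<bar>h vs\<bar>) + jb v powr k * \<bar>h v\<bar> * (jb vs powr (\<gamma> + k) * \<bar>h vs\<bar>))"
        by (simp add: c_def weight_const_def abs_mult algebra_simps)
      finally show "P * (2 * pi * K * A * J powr (\<gamma> + 1)) \<le> c * (jb v powr (\<gamma> + k) * \<bar>h v\<bar> * (jb vs powr k * \<bar>h vs\<bar>) + jb v powr k * \<bar>h v\<bar> * (jb vs powr (\<gamma> + k) * \<bar>h vs\<bar>))" .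
    qed
    also have "\<dots> = ennreal c * (ennreal (jb v powr (\<gamma> + k) * \<bar>h v\<bar>) * ennreal (jb vs powr k * \<bar>h vs\<bar>)
      + ennreal (jb v powr k * \<bar>h v\<bar>) * ennreal (jb vs powr (\<gamma> + k) * \<bar>h vs\<bar>))"
      using c by (simp add: ennreal_mult[symmetric] ennreal_plus[symmetric] del: ennreal_plus)
    finally show "(\<integral>\<^sup>+\<sigma>. ennreal (kern (v - vs) \<sigma>) * ennreal \<bar>h vs * h v * (jb (post_v v vs \<sigma>) powr k - jb v powr k)\<bar> \<partial>sph)
      \<le> ennreal c * (ennreal (jb v powr (\<gamma> + k) * \<bar>h v\<bar>) * ennreal (jb vs powr k * \<bar>h vs\<bar>)
      + ennreal (jb v powr k * \<bar>h v\<bar>) * ennreal (jb vs powr (\<gamma> + k) * \<bar>h vs\<bar>))" .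
  qed
  also have "\<dots> = ennreal c * (weighted_L1 (\<gamma> + k) h * weighted_L1 k h + weighted_L1 k h * weighted_L1 (\<gamma> + k) h)"
    by (simp add: nn_integral_cmult nn_integral_add nn_integral_multc weighted_L1_def)
  also have "\<dots> = ennreal (2 * weight_const k) * (weighted_L1 (\<gamma> + k) h * weighted_L1 k h)"
    using c unfolding c_def[symmetric] by (simp add: ennreal_mult mult_2[symmetric] mult_ac)
  finally show ?thesis .
qed

text \<open>After exchanging the velocities, \<open>\<bar>h\<^sub>*\<bar>\<close> factors out and the integral over \<open>v\<close> and \<open>\<sigma>\<close> is that of \<open>kern_difference\<close>, centred
at \<open>v\<^sub>*\<close>.\<close>

lemma gradient_term_bound:
  assumes W: "weak_gradient F G" and [measurable]: "h \<in> borel_measurable borel"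
  shows "(\<integral>\<^sup>+v. \<integral>\<^sup>+vs. \<integral>\<^sup>+\<sigma>. ennreal (kern (v - vs) \<sigma>) * ennreal \<bar>h (post_vs v vs \<sigma>) * (F (post_v v vs \<sigma>) - F v)\<bar> \<partial>sph \<partial>lborel \<partial>lborel)
    \<le> ennreal (9 * tilt_const) * (weighted_L1 (\<gamma> + 1) h * weighted_L1 (\<gamma> + 1) (\<lambda>y. \<Sum>i\<in>UNIV. \<bar>G i y\<bar>))"
proof -
  have [measurable]: "F \<in> borel_measurable borel" "\<And>i. G i \<in> borel_measurable borel"
    using W by (auto simp: weak_gradient_def dest!: borel_measurable_integrable)
  define N where "N = weighted_L1 (\<gamma> + 1) (\<lambda>y. \<Sum>i\<in>UNIV. \<bar>G i y\<bar>)"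
  have "(\<integral>\<^sup>+v. \<integral>\<^sup>+vs. \<integral>\<^sup>+\<sigma>. ennreal (kern (v - vs) \<sigma>) * ennreal \<bar>h (post_vs v vs \<sigma>) * (F (post_v v vs \<sigma>) - F v)\<bar> \<partial>sph \<partial>lborel \<partial>lborel)
    = (\<integral>\<^sup>+v. \<integral>\<^sup>+vs. \<integral>\<^sup>+\<sigma>. ennreal (kern (v - vs) \<sigma>) * ennreal \<bar>h vs * (F v - F (post_v v vs \<sigma>))\<bar> \<partial>sph \<partial>lborel \<partial>lborel)"
    unfolding post_v_tilt post_vs_tilt
    by (rule pre_post_collisional[of "\<lambda>v' vs' v vs. ennreal \<bar>h vs' * (F v' - F v)\<bar>"]) measurable
  also have "\<dots> = (\<integral>\<^sup>+vs. \<integral>\<^sup>+v. \<integral>\<^sup>+\<sigma>. ennreal (kern (v - vs) \<sigma>) * ennreal \<bar>h vs * (F v - F (post_v v vs \<sigma>))\<bar> \<partial>sph \<partial>lborel \<partial>lborel)"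
    by (rule lborel_pair.Fubini') measurable
  also have "\<dots> \<le> (\<integral>\<^sup>+vs. ennreal (9 * tilt_const) * (ennreal (jb vs powr (\<gamma> + 1) * \<bar>h vs\<bar>) * N) \<partial>lborel)"
  proof (rule nn_integral_mono)
    fix vs :: "real^3"
    have "(\<integral>\<^sup>+v. \<integral>\<^sup>+\<sigma>. ennreal (kern (v - vs) \<sigma>) * ennreal \<bar>h vs * (F v - F (post_v v vs \<sigma>))\<bar> \<partial>sph \<partial>lborel)
      = (\<integral>\<^sup>+\<sigma>. \<integral>\<^sup>+v. ennreal (kern (v - vs) \<sigma>) * ennreal \<bar>h vs * (F v - F (post_v v vs \<sigma>))\<bar> \<partial>lborel \<partial>sph)"
      by (rule lborel_sph.Fubini'[symmetric]) measurable
    also have "\<dots> = (\<integral>\<^sup>+\<sigma>. \<integral>\<^sup>+z. ennreal (kern ((vs + 1 *\<^sub>R z) - vs) \<sigma>) * ennreal \<bar>h vs * (F (vs + 1 *\<^sub>R z) - F (post_v (vs + 1 *\<^sub>R z) vs \<sigma>))\<bar> \<partial>lborel \<partial>sph)"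
    proof (rule nn_integral_cong)
      fix \<sigma> :: "real^3"
      show "(\<integral>\<^sup>+v. ennreal (kern (v - vs) \<sigma>) * ennreal \<bar>h vs * (F v - F (post_v v vs \<sigma>))\<bar> \<partial>lborel)
        = (\<integral>\<^sup>+z. ennreal (kern ((vs + 1 *\<^sub>R z) - vs) \<sigma>) * ennreal \<bar>h vs * (F (vs + 1 *\<^sub>R z) - F (post_v (vs + 1 *\<^sub>R z) vs \<sigma>))\<bar> \<partial>lborel)"
        by (rule nn_integral_affine_isometry[symmetric]) (simp, measurable)
    qed
    also have "\<dots> = (\<integral>\<^sup>+\<sigma>. \<integral>\<^sup>+z. ennreal \<bar>h vs\<bar> * ennreal (kern z \<sigma> * \<bar>F (vs + 1 *\<^sub>R tilt 1 \<sigma> z) - F (vs + 1 *\<^sub>R z)\<bar>) \<partial>lborel \<partial>sph)"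
    proof (intro nn_integral_cong)
      fix z \<sigma> :: "real^3"
      have p: "post_v (vs + 1 *\<^sub>R z) vs \<sigma> = vs + 1 *\<^sub>R tilt 1 \<sigma> z" by (simp add: post_v_tilt)
      show "ennreal (kern ((vs + 1 *\<^sub>R z) - vs) \<sigma>) * ennreal \<bar>h vs * (F (vs + 1 *\<^sub>R z) - F (post_v (vs + 1 *\<^sub>R z) vs \<sigma>))\<bar>
        = ennreal \<bar>h vs\<bar> * ennreal (kern z \<sigma> * \<bar>F (vs + 1 *\<^sub>R tilt 1 \<sigma> z) - F (vs + 1 *\<^sub>R z)\<bar>)"
        unfolding p abs_minus_commute[of "F (vs + 1 *\<^sub>R tilt 1 \<sigma> z)"] abs_mult
        by (simp add: ennreal_mult kern_nonneg mult_ac)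
    qed
    also have "\<dots> = ennreal \<bar>h vs\<bar> * (\<integral>\<^sup>+\<sigma>. \<integral>\<^sup>+z. ennreal (kern z \<sigma> * \<bar>F (vs + 1 *\<^sub>R tilt 1 \<sigma> z) - F (vs + 1 *\<^sub>R z)\<bar>) \<partial>lborel \<partial>sph)"
      by (simp add: nn_integral_cmult)
    also have "\<dots> \<le> ennreal \<bar>h vs\<bar> * (ennreal (9 * tilt_const * jb vs powr (\<gamma> + 1)) * (\<integral>\<^sup>+y. ennreal (jb y powr (\<gamma> + 1) * (\<Sum>i\<in>UNIV. \<bar>G i y\<bar>)) \<partial>lborel))"
      by (intro mult_left_mono kern_difference[OF W]) auto
    also have "(\<integral>\<^sup>+y. ennreal (jb y powr (\<gamma> + 1) * (\<Sum>i\<in>UNIV. \<bar>G i y\<bar>)) \<partial>lborel) = N"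
      unfolding N_def weighted_L1_def by (simp add: sum_nonneg)
    also have "ennreal \<bar>h vs\<bar> * (ennreal (9 * tilt_const * jb vs powr (\<gamma> + 1)) * N) = ennreal (9 * tilt_const) * (ennreal (jb vs powr (\<gamma> + 1) * \<bar>h vs\<bar>) * N)"
      using tilt_const_nonneg by (simp add: ennreal_mult mult_ac)
    finally show "(\<integral>\<^sup>+v. \<integral>\<^sup>+\<sigma>. ennreal (kern (v - vs) \<sigma>) * ennreal \<bar>h vs * (F v - F (post_v v vs \<sigma>))\<bar> \<partial>sph \<partial>lborel)
      \<le> ennreal (9 * tilt_const) * (ennreal (jb vs powr (\<gamma> + 1) * \<bar>h vs\<bar>) * N)" .
  qed
  also have "\<dots> = ennreal (9 * tilt_const) * (weighted_L1 (\<gamma> + 1) h * N)"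
    by (simp add: nn_integral_cmult nn_integral_multc weighted_L1_def)
  finally show ?thesis by (simp add: N_def)
qed

lemma convolution_bound:
  assumes [measurable]: "h \<in> borel_measurable borel"
  shows "(\<integral>\<^sup>+z. ennreal (norm z powr \<gamma> * \<bar>h (v - z)\<bar>) \<partial>lborel) \<le> ennreal (2 * jb v powr \<gamma>) * weighted_L1 \<gamma> h"
proof -
  have "(\<integral>\<^sup>+z. ennreal (norm z powr \<gamma> * \<bar>h (v - z)\<bar>) \<partial>lborel)
    = (\<integral>\<^sup>+z. ennreal (norm (v - (v + (-1) *\<^sub>R z)) powr \<gamma> * \<bar>h (v + (-1) *\<^sub>R z)\<bar>) \<partial>lborel)"
    by simp
  also have "\<dots> = (\<integral>\<^sup>+x. ennreal (norm (v - x) powr \<gamma> * \<bar>h x\<bar>) \<partial>lborel)"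
    by (rule nn_integral_affine_isometry[of "-1" "\<lambda>x. ennreal (norm (v - x) powr \<gamma> * \<bar>h x\<bar>)"]) auto
  also have "\<dots> \<le> (\<integral>\<^sup>+x. ennreal (2 * jb v powr \<gamma>) * ennreal (jb x powr \<gamma> * \<bar>h x\<bar>) \<partial>lborel)"
  proof (rule nn_integral_mono)
    fix x
    have "norm (v - x) \<le> jb v + jb x" using norm_triangle_ineq4[of v x] norm_le_jb[of v] norm_le_jb[of x] by linarith
    also have "\<dots> \<le> 2 * (jb v * jb x)"
    proof -
      have "jb v \<le> jb v * jb x" using mult_left_mono[OF jb_ge_1[of x], of "jb v"] jb_pos[of v] by simp
      moreover have "jb x \<le> jb v * jb x" using mult_right_mono[OF jb_ge_1[of v], of "jb x"] jb_pos[of x] by simp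
      ultimately show ?thesis by linarith
    qed
    finally have "norm (v - x) powr \<gamma> \<le> (2 * (jb v * jb x)) powr \<gamma>" using \<gamma> by (intro powr_mono2) auto
    also have "\<dots> = 2 powr \<gamma> * (jb v powr \<gamma> * jb x powr \<gamma>)" using jb_pos by (simp add: powr_mult less_imp_le)
    also have "\<dots> \<le> 2 * (jb v powr \<gamma> * jb x powr \<gamma>)"
    proof (rule mult_right_mono)
      have "2 powr \<gamma> \<le> (2::real) powr 1" using \<gamma> by (intro powr_mono) auto
      then show "2 powr \<gamma> \<le> (2::real)" by simp
    qed simp
    finally have "norm (v - x) powr \<gamma> * \<bar>h x\<bar> \<le> 2 * (jb v powr \<gamma> * jb x powr \<gamma>) * \<bar>h x\<bar>" by (rule mult_right_mono) simp
    then show "ennreal (norm (v - x) powr \<gamma> * \<bar>h x\<bar>) \<le> ennreal (2 * jb v powr \<gamma>) * ennreal (jb x powr \<gamma> * \<bar>h x\<bar>)"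
      by (simp add: ennreal_mult'[symmetric] mult_ac ennreal_leI)
  qed
  also have "\<dots> = ennreal (2 * jb v powr \<gamma>) * weighted_L1 \<gamma> h"
    unfolding weighted_L1_def by (rule nn_integral_cmult) measurable
  finally show ?thesis .
qed

text \<open>The gradient enters only through the finiteness of its norm, which makes the integrand integrable; the quantitative
bound comes from the cancellation lemma for \<open>x \<mapsto> h (v - x)\<close>.\<close>

lemma cancellation_term:
  assumes [measurable]: "h \<in> borel_measurable borel" and W: "weak_gradient h G"
    and fin: "weighted_L1 \<gamma> h < \<infinity>" "weighted_L1 (\<gamma> + 1) (\<lambda>y. \<Sum>i\<in>UNIV. \<bar>G i y\<bar>) < \<infinity>"
  shows "integrable (lborel \<Otimes>\<^sub>M sph) (\<lambda>(vs, \<sigma>). kern (v - vs) \<sigma> * (h (post_vs v vs \<sigma>) - h vs))"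
    and "ennreal \<bar>\<integral>(vs, \<sigma>). kern (v - vs) \<sigma> * (h (post_vs v vs \<sigma>) - h vs) \<partial>(lborel \<Otimes>\<^sub>M sph)\<bar>
      \<le> ennreal (16 * pi * K * A * jb v powr \<gamma>) * weighted_L1 \<gamma> h"
proof -
  define u where "u x = h (v - x)" for x
  have [measurable]: "u \<in> borel_measurable borel" unfolding u_def by measurable
  define f where "f = (\<lambda>(z, \<sigma>). kern z \<sigma> * (u (tilt 1 \<sigma> z) - u z))"
  have fm [measurable]: "f \<in> borel_measurable (lborel \<Otimes>\<^sub>M sph)" unfolding f_def by measurable
  have int: "integrable (lborel \<Otimes>\<^sub>M sph) f"
  proof (rule integrableI_bounded[OF fm])
    have "(\<integral>\<^sup>+x. ennreal (norm (f x)) \<partial>(lborel \<Otimes>\<^sub>M sph))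
      = (\<integral>\<^sup>+\<sigma>. \<integral>\<^sup>+z. ennreal (kern z \<sigma> * \<bar>h (v + (-1) *\<^sub>R tilt 1 \<sigma> z) - h (v + (-1) *\<^sub>R z)\<bar>) \<partial>lborel \<partial>sph)"
      by (subst lborel_sph.nn_integral_snd[symmetric]) (simp_all add: f_def u_def abs_mult kern_nonneg)
    also have "\<dots> \<le> ennreal (9 * tilt_const * jb v powr (\<gamma> + 1)) * (\<integral>\<^sup>+y. ennreal (jb y powr (\<gamma> + 1) * (\<Sum>i\<in>UNIV. \<bar>G i y\<bar>)) \<partial>lborel)"
      by (rule kern_difference[OF W]) simp
    also have "\<dots> < \<infinity>" using fin(2) by (simp add: weighted_L1_def sum_nonneg ennreal_mult_less_top)
    finally show "(\<integral>\<^sup>+x. ennreal (norm (f x)) \<partial>(lborel \<Otimes>\<^sub>M sph)) < \<infinity>" .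
  qed
  define T where "T = (\<lambda>(z, \<sigma>). (v + (-1) *\<^sub>R z, \<sigma> :: real^3))"
  have T: "T \<in> lborel \<Otimes>\<^sub>M sph \<rightarrow>\<^sub>M lborel \<Otimes>\<^sub>M sph" unfolding T_def by measurable
  have dT: "distr (lborel \<Otimes>\<^sub>M sph) (lborel \<Otimes>\<^sub>M sph) T = lborel \<Otimes>\<^sub>M sph"
    unfolding T_def by (rule distr_pair_isometry) simp
  have fT: "(\<lambda>x. f (T x)) = (\<lambda>(vs, \<sigma>). kern (v - vs) \<sigma> * (h (post_vs v vs \<sigma>) - h vs))"
    by (auto simp: f_def T_def u_def post_vs_tilt fun_eq_iff)
  show "integrable (lborel \<Otimes>\<^sub>M sph) (\<lambda>(vs, \<sigma>). kern (v - vs) \<sigma> * (h (post_vs v vs \<sigma>) - h vs))"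
    using integrable_distr[OF T, of f] int unfolding dT fT by simp
  have eq: "(\<integral>(vs, \<sigma>). kern (v - vs) \<sigma> * (h (post_vs v vs \<sigma>) - h vs) \<partial>(lborel \<Otimes>\<^sub>M sph)) = (\<integral>x. f x \<partial>(lborel \<Otimes>\<^sub>M sph))"
    using integral_distr[OF T fm] unfolding dT fT by simp
  have conv: "(\<integral>\<^sup>+z. ennreal (norm z powr \<gamma> * \<bar>u z\<bar>) \<partial>lborel) \<le> ennreal (2 * jb v powr \<gamma>) * weighted_L1 \<gamma> h"
    unfolding u_def by (rule convolution_bound) measurable
  also have "\<dots> < \<infinity>" using fin(1) by (simp add: ennreal_mult_less_top)
  finally have "ennreal \<bar>\<integral>x. f x \<partial>(lborel \<Otimes>\<^sub>M sph)\<bar> \<le> ennreal (8 * pi * K * A) * (\<integral>\<^sup>+z. ennreal (norm z powr \<gamma> * \<bar>u z\<bar>) \<partial>lborel)"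
    using cancellation[of u] int unfolding f_def by simp
  also have "\<dots> \<le> ennreal (8 * pi * K * A) * (ennreal (2 * jb v powr \<gamma>) * weighted_L1 \<gamma> h)"
    by (intro mult_left_mono conv) simp
  also have "\<dots> = ennreal (16 * pi * K * A * jb v powr \<gamma>) * weighted_L1 \<gamma> h"
  proof -
    have "ennreal (8 * pi * K * A) * ennreal (2 * jb v powr \<gamma>) = ennreal (16 * pi * K * A * jb v powr \<gamma>)"
      using K A_pos by (simp add: ennreal_mult'[symmetric] mult_ac)
    then show ?thesis by (simp only: mult.assoc[symmetric])
  qed
  finally show "ennreal \<bar>\<integral>(vs, \<sigma>). kern (v - vs) \<sigma> * (h (post_vs v vs \<sigma>) - h vs) \<partial>(lborel \<Otimes>\<^sub>M sph)\<bar>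
      \<le> ennreal (16 * pi * K * A * jb v powr \<gamma>) * weighted_L1 \<gamma> h" unfolding eq .
qed

end

lemma weighted_gradient_norm:
  assumes a: "0 \<le> a" and [measurable]: "h \<in> borel_measurable borel" "\<And>i. g i \<in> borel_measurable borel"
  shows "weighted_L1 p (\<lambda>x. \<Sum>i\<in>UNIV. \<bar>g i x * jb x powr a + h x * partial_deriv i (\<lambda>x. jb x powr a) x\<bar>)
    \<le> ennreal (1 + 3 * a) * (weighted_L1 (p + a) h + (\<Sum>i\<in>(UNIV :: 3 set). weighted_L1 (p + a) (g i)))"
proof -
  let ?G = "\<lambda>i x. g i x * jb x powr a + h x * partial_deriv i (\<lambda>x. jb x powr a) x"
  have pt: "jb x powr p * \<bar>\<Sum>i\<in>UNIV. \<bar>?G i x\<bar>\<bar> \<le> (\<Sum>i\<in>UNIV. jb x powr (p + a) * \<bar>g i x\<bar>) + 3 * a * (jb x powr (p + a) * \<bar>h x\<bar>)" for x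
  proof -
    have "\<bar>?G i x\<bar> \<le> jb x powr a * \<bar>g i x\<bar> + a * (jb x powr a * \<bar>h x\<bar>)" for i
    proof -
      have "\<bar>?G i x\<bar> \<le> \<bar>g i x * jb x powr a\<bar> + \<bar>h x * partial_deriv i (\<lambda>x. jb x powr a) x\<bar>" by (rule abs_triangle_ineq)
      moreover have "\<bar>h x * partial_deriv i (\<lambda>x. jb x powr a) x\<bar> \<le> \<bar>h x\<bar> * (a * jb x powr a)"
        unfolding abs_mult by (intro mult_left_mono partial_deriv_jb_powr_le a) simp
      ultimately show ?thesis by (simp add: abs_mult mult_ac)
    qed
    then have "(\<Sum>i\<in>UNIV. \<bar>?G i x\<bar>) \<le> (\<Sum>i\<in>(UNIV :: 3 set). jb x powr a * \<bar>g i x\<bar> + a * (jb x powr a * \<bar>h x\<bar>))"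
      by (intro sum_mono)
    also have "\<dots> = (\<Sum>i\<in>(UNIV :: 3 set). jb x powr a * \<bar>g i x\<bar>) + 3 * (a * (jb x powr a * \<bar>h x\<bar>))"
      by (simp add: sum.distrib)
    finally have "jb x powr p * (\<Sum>i\<in>UNIV. \<bar>?G i x\<bar>) \<le> jb x powr p * ((\<Sum>i\<in>(UNIV :: 3 set). jb x powr a * \<bar>g i x\<bar>) + 3 * (a * (jb x powr a * \<bar>h x\<bar>)))"
      by (rule mult_left_mono) simp
    also have "\<dots> = (\<Sum>i\<in>UNIV. jb x powr (p + a) * \<bar>g i x\<bar>) + 3 * a * (jb x powr (p + a) * \<bar>h x\<bar>)"
      by (simp add: powr_add distrib_left sum_distrib_left mult_ac)
    finally show ?thesis by (simp add: sum_nonneg)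
  qed
  have "weighted_L1 p (\<lambda>x. \<Sum>i\<in>UNIV. \<bar>?G i x\<bar>)
    \<le> (\<integral>\<^sup>+x. (\<Sum>i\<in>(UNIV :: 3 set). ennreal (jb x powr (p + a) * \<bar>g i x\<bar>)) + ennreal (3 * a) * ennreal (jb x powr (p + a) * \<bar>h x\<bar>) \<partial>lborel)"
    unfolding weighted_L1_def
  proof (rule nn_integral_mono)
    fix x
    show "ennreal (jb x powr p * \<bar>\<Sum>i\<in>UNIV. \<bar>?G i x\<bar>\<bar>) \<le> (\<Sum>i\<in>(UNIV :: 3 set). ennreal (jb x powr (p + a) * \<bar>g i x\<bar>)) + ennreal (3 * a) * ennreal (jb x powr (p + a) * \<bar>h x\<bar>)"
    proof -
      have "ennreal (jb x powr p * \<bar>\<Sum>i\<in>UNIV. \<bar>?G i x\<bar>\<bar>)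
        \<le> ennreal ((\<Sum>i\<in>(UNIV :: 3 set). jb x powr (p + a) * \<bar>g i x\<bar>) + 3 * a * (jb x powr (p + a) * \<bar>h x\<bar>))"
        by (rule ennreal_leI[OF pt])
      also have "\<dots> = ennreal (\<Sum>i\<in>(UNIV :: 3 set). jb x powr (p + a) * \<bar>g i x\<bar>) + ennreal (3 * a * (jb x powr (p + a) * \<bar>h x\<bar>))"
        by (rule ennreal_plus) (use a in \<open>auto intro!: sum_nonneg\<close>)
      also have "ennreal (\<Sum>i\<in>(UNIV :: 3 set). jb x powr (p + a) * \<bar>g i x\<bar>) = (\<Sum>i\<in>(UNIV :: 3 set). ennreal (jb x powr (p + a) * \<bar>g i x\<bar>))"
        by (rule sum_ennreal[symmetric]) simp
      also have "ennreal (3 * a * (jb x powr (p + a) * \<bar>h x\<bar>)) = ennreal (3 * a) * ennreal (jb x powr (p + a) * \<bar>h x\<bar>)"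
        by (rule ennreal_mult) (use a in auto)
      finally show ?thesis .
    qed
  qed
  also have "\<dots> = (\<Sum>i\<in>(UNIV :: 3 set). weighted_L1 (p + a) (g i)) + ennreal (3 * a) * weighted_L1 (p + a) h"
    unfolding weighted_L1_def
    by (subst nn_integral_add, measurable, subst nn_integral_sum, measurable, subst nn_integral_cmult, measurable)
  also have "\<dots> \<le> ennreal (1 + 3 * a) * (\<Sum>i\<in>(UNIV :: 3 set). weighted_L1 (p + a) (g i)) + ennreal (1 + 3 * a) * weighted_L1 (p + a) h"
  proof (intro add_mono mult_right_mono ennreal_leI)
    have "1 \<le> ennreal (1 + 3 * a)" using ennreal_leI[of 1 "1 + 3 * a"] a by simp
    from mult_right_mono[OF this, of "\<Sum>i\<in>(UNIV :: 3 set). weighted_L1 (p + a) (g i)"]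
    show "(\<Sum>i\<in>(UNIV :: 3 set). weighted_L1 (p + a) (g i)) \<le> ennreal (1 + 3 * a) * (\<Sum>i\<in>(UNIV :: 3 set). weighted_L1 (p + a) (g i))"
      by simp
  qed auto
  finally show ?thesis by (simp add: distrib_left add.commute)
qed

context angular_kernel
begin

definition collision_const :: "real \<Rightarrow> real" where
  "collision_const k = 2 * weight_const k + 9 * tilt_const * (1 + 3 * k) + 16 * pi * K * A"

text \<open>The decomposition of \<open>m (h'\<^sub>* h' - h\<^sub>* h)\<close> into the three terms above. The first two are integrable in \<open>(v\<^sub>*, \<sigma>)\<close> for almost
every \<open>v\<close>, since they are integrable in all variables; the third one is integrable for every \<open>v\<close>.\<close>

lemma collision_estimate:
  assumes k: "1 \<le> k" and g: "\<And>i. is_weak_partial i h (g i)"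
    and fin: "weighted_L1 (\<gamma> + 1 + k) h < \<infinity>" "\<And>i. weighted_L1 (\<gamma> + 1 + k) (g i) < \<infinity>"
  defines "W \<equiv> weighted_L1 (\<gamma> + 1 + k) h + (\<Sum>i\<in>UNIV. weighted_L1 (\<gamma> + 1 + k) (g i))"
  shows "AE v in lborel. integrable (lborel \<Otimes>\<^sub>M sph) (collision_integrand kern h h v)"
    and "weighted_L1 k (\<lambda>v. \<integral>x. collision_integrand kern h h v x \<partial>(lborel \<Otimes>\<^sub>M sph))
      \<le> ennreal (collision_const k) * (weighted_L1 (\<gamma> + k) h * weighted_L1 k h + weighted_L1 (\<gamma> + 1) h * W)"
proof -
  let ?M = "lborel \<Otimes>\<^sub>M sph :: ((real^3) \<times> (real^3)) measure"
  have [measurable]: "h \<in> borel_measurable borel" "\<And>i. g i \<in> borel_measurable borel"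
    using g by (auto simp: is_weak_partial_def locally_integrable_def)
  define w where "w v = jb v powr k" for v
  have [measurable]: "w \<in> borel_measurable borel" unfolding w_def by measurable
  have w: "0 < w v" for v using jb_pos[of v] by (simp add: w_def)
  define F where "F v = h v * w v" for v
  have [measurable]: "F \<in> borel_measurable borel" unfolding F_def by measurable
  \<comment> \<open>Weak gradients of \<open>F = h m\<close> and, with the exponent zero, of \<open>h\<close> itself.\<close>
  define G where "G i x = g i x * jb x powr k + h x * partial_deriv i (\<lambda>x. jb x powr k) x" for i x
  define G0 where "G0 i x = g i x * jb x powr 0 + h x * partial_deriv i (\<lambda>x. jb x powr 0) x" for i x
  have finle: "weighted_L1 a f < \<infinity>" if "weighted_L1 (\<gamma> + 1 + k) f < \<infinity>" "a \<le> \<gamma> + 1 + k" for a f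
    using le_less_trans[OF weighted_L1_mono[OF that(2)] that(1)] .
  have WF: "weak_gradient F G"
    unfolding F_def[abs_def] G_def[abs_def] w_def
    by (rule weighted_weak_gradient[OF _ g])
       (use k \<gamma> finle[OF fin(1), of k] finle[OF fin(2), of k] in \<open>auto simp: weighted_L1_def\<close>)
  have "weak_gradient (\<lambda>x. h x * jb x powr 0) G0"
    unfolding G0_def[abs_def]
    by (rule weighted_weak_gradient[OF _ g])
       (use k \<gamma> finle[OF fin(1), of 0] finle[OF fin(2), of 0] in \<open>auto simp: weighted_L1_def\<close>)
  moreover have "(\<lambda>x. h x * jb x powr 0) = h" using jb_pos by (auto simp: fun_eq_iff less_imp_neq[symmetric])
  ultimately have Wh: "weak_gradient h G0" by simp
  have Gbound: "weighted_L1 (\<gamma> + 1) (\<lambda>y. \<Sum>i\<in>UNIV. \<bar>G i y\<bar>) \<le> ennreal (1 + 3 * k) * W"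
    unfolding G_def W_def by (rule weighted_gradient_norm) (use k in auto)
  have "weighted_L1 (\<gamma> + 1) (\<lambda>y. \<Sum>i\<in>UNIV. \<bar>G0 i y\<bar>) \<le> ennreal (1 + 3 * 0) * (weighted_L1 (\<gamma> + 1 + 0) h + (\<Sum>i\<in>UNIV. weighted_L1 (\<gamma> + 1 + 0) (g i)))"
    unfolding G0_def by (rule weighted_gradient_norm) auto
  also have "\<dots> < \<infinity>"
    using finle[OF fin(1), of "\<gamma> + 1"] finle[OF fin(2), of "\<gamma> + 1"] k by (simp add: ennreal_mult_less_top)
  finally have G0fin: "weighted_L1 (\<gamma> + 1) (\<lambda>y. \<Sum>i\<in>UNIV. \<bar>G0 i y\<bar>) < \<infinity>" .
  have hfin: "weighted_L1 \<gamma> h < \<infinity>" by (rule finle[OF fin(1)]) (use k in auto)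

  define a where "a v vs \<sigma> = kern (v - vs) \<sigma> * (h (post_vs v vs \<sigma>) * h (post_v v vs \<sigma>) * (w v - w (post_v v vs \<sigma>)))" for v vs \<sigma>
  define b where "b v vs \<sigma> = kern (v - vs) \<sigma> * (h (post_vs v vs \<sigma>) * (F (post_v v vs \<sigma>) - F v))" for v vs \<sigma>
  define d where "d v vs \<sigma> = kern (v - vs) \<sigma> * (h (post_vs v vs \<sigma>) - h vs)" for v vs \<sigma>
  have split: "w v * collision_integrand kern h h v (vs, \<sigma>) = a v vs \<sigma> + b v vs \<sigma> + F v * d v vs \<sigma>" for v vs \<sigma>
    unfolding collision_integrand_def a_def b_def d_def F_def by (simp add: algebra_simps)
  define NA where "NA v = (\<integral>\<^sup>+vs. \<integral>\<^sup>+\<sigma>. ennreal \<bar>a v vs \<sigma>\<bar> \<partial>sph \<partial>lborel)" for v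
  define NB where "NB v = (\<integral>\<^sup>+vs. \<integral>\<^sup>+\<sigma>. ennreal \<bar>b v vs \<sigma>\<bar> \<partial>sph \<partial>lborel)" for v
  have [measurable]: "NA \<in> borel_measurable borel" "NB \<in> borel_measurable borel"
    unfolding NA_def NB_def a_def b_def by measurable
  have NA: "(\<integral>\<^sup>+v. NA v \<partial>lborel) \<le> ennreal (2 * weight_const k) * (weighted_L1 (\<gamma> + k) h * weighted_L1 k h)"
  proof -
    have "(\<integral>\<^sup>+v. NA v \<partial>lborel) = (\<integral>\<^sup>+v. \<integral>\<^sup>+vs. \<integral>\<^sup>+\<sigma>. ennreal (kern (v - vs) \<sigma>) * ennreal \<bar>h (post_vs v vs \<sigma>) * h (post_v v vs \<sigma>) * (jb v powr k - jb (post_v v vs \<sigma>) powr k)\<bar> \<partial>sph \<partial>lborel \<partial>lborel)"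
      unfolding NA_def a_def w_def
      by (intro nn_integral_cong) (simp add: abs_mult[of "kern _ _"] kern_nonneg ennreal_mult)
    also have "\<dots> \<le> ennreal (2 * weight_const k) * (weighted_L1 (\<gamma> + k) h * weighted_L1 k h)"
      by (rule weight_commutator_bound[OF k]) measurable
    finally show ?thesis .
  qed
  have NB: "(\<integral>\<^sup>+v. NB v \<partial>lborel) \<le> ennreal (9 * tilt_const * (1 + 3 * k)) * (weighted_L1 (\<gamma> + 1) h * W)"
  proof -
    have "(\<integral>\<^sup>+v. NB v \<partial>lborel) = (\<integral>\<^sup>+v. \<integral>\<^sup>+vs. \<integral>\<^sup>+\<sigma>. ennreal (kern (v - vs) \<sigma>) * ennreal \<bar>h (post_vs v vs \<sigma>) * (F (post_v v vs \<sigma>) - F v)\<bar> \<partial>sph \<partial>lborel \<partial>lborel)"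
      unfolding NB_def b_def
      by (intro nn_integral_cong) (simp add: abs_mult[of "kern _ _"] kern_nonneg ennreal_mult)
    also have "\<dots> \<le> ennreal (9 * tilt_const) * (weighted_L1 (\<gamma> + 1) h * weighted_L1 (\<gamma> + 1) (\<lambda>y. \<Sum>i\<in>UNIV. \<bar>G i y\<bar>))"
      by (rule gradient_term_bound[OF WF]) measurable
    also have "\<dots> \<le> ennreal (9 * tilt_const) * (weighted_L1 (\<gamma> + 1) h * (ennreal (1 + 3 * k) * W))"
      by (intro mult_left_mono Gbound) auto
    also have "\<dots> = ennreal (9 * tilt_const * (1 + 3 * k)) * (weighted_L1 (\<gamma> + 1) h * W)"
      using k tilt_const_nonneg by (simp add: ennreal_mult mult_ac)
    finally show ?thesis .
  qed
  define NC where "NC v = ennreal \<bar>F v\<bar> * (ennreal (16 * pi * K * A * jb v powr \<gamma>) * weighted_L1 \<gamma> h)" for v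
  have [measurable]: "NC \<in> borel_measurable borel" unfolding NC_def by measurable
  have NC: "(\<integral>\<^sup>+v. NC v \<partial>lborel) \<le> ennreal (16 * pi * K * A) * (weighted_L1 (\<gamma> + k) h * weighted_L1 k h)"
  proof -
    have "NC v = (ennreal (16 * pi * K * A) * weighted_L1 \<gamma> h) * ennreal (jb v powr (\<gamma> + k) * \<bar>h v\<bar>)" for v
      using K A_pos by (simp add: NC_def F_def w_def abs_mult ennreal_mult powr_add mult_ac)
    then have "(\<integral>\<^sup>+v. NC v \<partial>lborel) = (ennreal (16 * pi * K * A) * weighted_L1 \<gamma> h) * weighted_L1 (\<gamma> + k) h"
      by (simp add: nn_integral_cmult weighted_L1_def)
    also have "\<dots> \<le> (ennreal (16 * pi * K * A) * weighted_L1 k h) * weighted_L1 (\<gamma> + k) h"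
      using \<gamma> k by (intro mult_right_mono mult_left_mono weighted_L1_mono) auto
    finally show ?thesis by (simp add: mult_ac)
  qed
  have prod: "(\<integral>\<^sup>+x. ennreal (norm (case x of (vs, \<sigma>) \<Rightarrow> f vs \<sigma>)) \<partial>?M) = (\<integral>\<^sup>+vs. \<integral>\<^sup>+\<sigma>. ennreal \<bar>f vs \<sigma>\<bar> \<partial>sph \<partial>lborel)"
    if [measurable]: "(\<lambda>(vs, \<sigma>). f vs \<sigma>) \<in> borel_measurable ?M" for f :: "real^3 \<Rightarrow> real^3 \<Rightarrow> real"
    by (subst sph.nn_integral_fst[symmetric]) simp_all
  have main: "integrable ?M (collision_integrand kern h h v)"
    "ennreal (w v * \<bar>\<integral>x. collision_integrand kern h h v x \<partial>?M\<bar>) \<le> NA v + NB v + NC v"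
    if NAv: "NA v < \<infinity>" and NBv: "NB v < \<infinity>" for v
  proof -
    have m: "(\<lambda>(vs, \<sigma>). a v vs \<sigma>) \<in> borel_measurable ?M" "(\<lambda>(vs, \<sigma>). b v vs \<sigma>) \<in> borel_measurable ?M"
      unfolding a_def b_def by measurable
    have ia: "integrable ?M (\<lambda>(vs, \<sigma>). a v vs \<sigma>)"
      by (rule integrableI_bounded[OF m(1)]) (use NAv in \<open>simp only: prod[OF m(1)] NA_def\<close>)
    have ib: "integrable ?M (\<lambda>(vs, \<sigma>). b v vs \<sigma>)"
      by (rule integrableI_bounded[OF m(2)]) (use NBv in \<open>simp only: prod[OF m(2)] NB_def\<close>)
    have id: "integrable ?M (\<lambda>(vs, \<sigma>). d v vs \<sigma>)"
      unfolding d_def by (rule cancellation_term(1)[OF _ Wh hfin G0fin]) measurable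
    have bd: "ennreal \<bar>\<integral>(vs, \<sigma>). d v vs \<sigma> \<partial>?M\<bar> \<le> ennreal (16 * pi * K * A * jb v powr \<gamma>) * weighted_L1 \<gamma> h"
      unfolding d_def by (rule cancellation_term(2)[OF _ Wh hfin G0fin]) measurable
    define S where "S x = (case x of (vs, \<sigma>) \<Rightarrow> a v vs \<sigma>) + (case x of (vs, \<sigma>) \<Rightarrow> b v vs \<sigma>) + F v * (case x of (vs, \<sigma>) \<Rightarrow> d v vs \<sigma>)" for x
    have iS: "integrable ?M S" unfolding S_def
      by (intro Bochner_Integration.integrable_add integrable_mult_right ia ib id)
    have eq: "collision_integrand kern h h v = (\<lambda>x. (1 / w v) * S x)"
    proof
      fix x :: "(real^3) \<times> (real^3)"
      obtain vs \<sigma> where x: "x = (vs, \<sigma>)" by (cases x)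
      have "w v * collision_integrand kern h h v x = S x" unfolding x split S_def by simp
      then show "collision_integrand kern h h v x = (1 / w v) * S x" using w[of v] by (simp add: field_simps)
    qed
    show "integrable ?M (collision_integrand kern h h v)" unfolding eq using iS by (rule integrable_mult_right)
    have "w v * (\<integral>x. collision_integrand kern h h v x \<partial>?M) = (\<integral>x. S x \<partial>?M)"
      unfolding eq using w[of v] by simp
    also have "\<dots> = (\<integral>(vs, \<sigma>). a v vs \<sigma> \<partial>?M) + (\<integral>(vs, \<sigma>). b v vs \<sigma> \<partial>?M) + F v * (\<integral>(vs, \<sigma>). d v vs \<sigma> \<partial>?M)"
      unfolding S_def
      by (simp only: Bochner_Integration.integral_add[OF Bochner_Integration.integrable_add[OF ia ib] integrable_mult_right[OF id]]
          Bochner_Integration.integral_add[OF ia ib] Bochner_Integration.integral_mult_right_zero)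
    finally have "w v * \<bar>\<integral>x. collision_integrand kern h h v x \<partial>?M\<bar>
      = \<bar>(\<integral>(vs, \<sigma>). a v vs \<sigma> \<partial>?M) + (\<integral>(vs, \<sigma>). b v vs \<sigma> \<partial>?M) + F v * (\<integral>(vs, \<sigma>). d v vs \<sigma> \<partial>?M)\<bar>"
      using w[of v] by (metis abs_mult abs_of_pos)
    also have "\<dots> \<le> \<bar>\<integral>(vs, \<sigma>). a v vs \<sigma> \<partial>?M\<bar> + \<bar>\<integral>(vs, \<sigma>). b v vs \<sigma> \<partial>?M\<bar> + \<bar>F v\<bar> * \<bar>\<integral>(vs, \<sigma>). d v vs \<sigma> \<partial>?M\<bar>"
      unfolding abs_mult[symmetric] by linarith
    finally have "ennreal (w v * \<bar>\<integral>x. collision_integrand kern h h v x \<partial>?M\<bar>)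
      \<le> ennreal (\<bar>\<integral>(vs, \<sigma>). a v vs \<sigma> \<partial>?M\<bar> + \<bar>\<integral>(vs, \<sigma>). b v vs \<sigma> \<partial>?M\<bar> + \<bar>F v\<bar> * \<bar>\<integral>(vs, \<sigma>). d v vs \<sigma> \<partial>?M\<bar>)"
      by (rule ennreal_leI)
    also have "\<dots> = ennreal \<bar>\<integral>(vs, \<sigma>). a v vs \<sigma> \<partial>?M\<bar> + ennreal \<bar>\<integral>(vs, \<sigma>). b v vs \<sigma> \<partial>?M\<bar> + ennreal \<bar>F v\<bar> * ennreal \<bar>\<integral>(vs, \<sigma>). d v vs \<sigma> \<partial>?M\<bar>"
      by (simp add: ennreal_mult)
    also have "\<dots> \<le> NA v + NB v + NC v"
    proof (intro add_mono)
      show "ennreal \<bar>\<integral>(vs, \<sigma>). a v vs \<sigma> \<partial>?M\<bar> \<le> NA v"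
        using integral_norm_bound_ennreal[OF ia] unfolding prod[OF m(1)] NA_def by simp
      show "ennreal \<bar>\<integral>(vs, \<sigma>). b v vs \<sigma> \<partial>?M\<bar> \<le> NB v"
        using integral_norm_bound_ennreal[OF ib] unfolding prod[OF m(2)] NB_def by simp
      show "ennreal \<bar>F v\<bar> * ennreal \<bar>\<integral>(vs, \<sigma>). d v vs \<sigma> \<partial>?M\<bar> \<le> NC v"
        unfolding NC_def by (intro mult_left_mono bd) simp
    qed
    finally show "ennreal (w v * \<bar>\<integral>x. collision_integrand kern h h v x \<partial>?M\<bar>) \<le> NA v + NB v + NC v" .
  qed
  have hk: "weighted_L1 (\<gamma> + k) h < \<infinity>" "weighted_L1 k h < \<infinity>" "weighted_L1 (\<gamma> + 1) h < \<infinity>"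
    by (rule finle[OF fin(1)], use \<gamma> k in simp)+
  have Wfin: "W < \<infinity>" unfolding W_def using fin by simp
  have "(\<integral>\<^sup>+v. NA v \<partial>lborel) < \<infinity>" using hk by (intro le_less_trans[OF NA]) (simp add: ennreal_mult_less_top)
  then have aeA: "AE v in lborel. NA v \<noteq> \<infinity>" by (intro nn_integral_PInf_AE) auto
  have "(\<integral>\<^sup>+v. NB v \<partial>lborel) < \<infinity>" using hk Wfin by (intro le_less_trans[OF NB]) (simp add: ennreal_mult_less_top)
  then have aeB: "AE v in lborel. NB v \<noteq> \<infinity>" by (intro nn_integral_PInf_AE) auto
  show "AE v in lborel. integrable ?M (collision_integrand kern h h v)"
    using aeA aeB by eventually_elim (auto intro!: main simp: less_top)
  have "weighted_L1 k (\<lambda>v. \<integral>x. collision_integrand kern h h v x \<partial>?M) \<le> (\<integral>\<^sup>+v. NA v + NB v + NC v \<partial>lborel)"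
    unfolding weighted_L1_def
  proof (rule nn_integral_mono_AE, use aeA aeB in eventually_elim)
    case (elim v)
    then show ?case using main(2)[of v] by (simp add: w_def less_top)
  qed
  also have "\<dots> = (\<integral>\<^sup>+v. NA v \<partial>lborel) + (\<integral>\<^sup>+v. NB v \<partial>lborel) + (\<integral>\<^sup>+v. NC v \<partial>lborel)"
    by (simp add: nn_integral_add)
  also have "\<dots> \<le> ennreal (2 * weight_const k) * (weighted_L1 (\<gamma> + k) h * weighted_L1 k h)
      + ennreal (9 * tilt_const * (1 + 3 * k)) * (weighted_L1 (\<gamma> + 1) h * W)
      + ennreal (16 * pi * K * A) * (weighted_L1 (\<gamma> + k) h * weighted_L1 k h)"
    by (intro add_mono NA NB NC)
  also have "\<dots> \<le> ennreal (collision_const k) * (weighted_L1 (\<gamma> + k) h * weighted_L1 k h + weighted_L1 (\<gamma> + 1) h * W)"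
  proof -
    have nn: "0 \<le> weight_const k" "0 \<le> tilt_const * (1 + 3 * k)" "0 \<le> K * A"
      using k K A_pos tilt_const_nonneg by (auto simp: weight_const_def)
    let ?X = "weighted_L1 (\<gamma> + k) h * weighted_L1 k h" and ?Y = "weighted_L1 (\<gamma> + 1) h * W"
    have "ennreal (2 * weight_const k) * ?X + ennreal (9 * tilt_const * (1 + 3 * k)) * ?Y + ennreal (16 * pi * K * A) * ?X
      = ennreal (2 * weight_const k + 16 * pi * K * A) * ?X + ennreal (9 * tilt_const * (1 + 3 * k)) * ?Y"
      using nn by (simp add: ennreal_plus distrib_right mult.assoc add_ac)
    also have "\<dots> \<le> ennreal (collision_const k) * ?X + ennreal (collision_const k) * ?Y"
      using nn by (intro add_mono mult_right_mono ennreal_leI) (auto simp: collision_const_def mult.assoc)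
    finally show ?thesis by (simp add: distrib_left)
  qed
  finally show "weighted_L1 k (\<lambda>v. \<integral>x. collision_integrand kern h h v x \<partial>?M)
      \<le> ennreal (collision_const k) * (weighted_L1 (\<gamma> + k) h * weighted_L1 k h + weighted_L1 (\<gamma> + 1) h * W)" .
qed

end

section \<open>The collision kernel on the sphere\<close>

lemma lborel_sph_eq_distr:
  "(lborel :: (real^3) measure) \<Otimes>\<^sub>M sph = distr (lborel \<Otimes>\<^sub>M sphere_measure) (borel \<Otimes>\<^sub>M borel) (\<lambda>(vs, \<sigma>). (vs, \<sigma>))"
proof -
  have l: "distr lborel borel (\<lambda>x::real^3. x) = lborel"
    by (subst distr_cong[OF refl sets_lborel[symmetric] refl]) (simp add: distr_id)
  have "distr lborel borel (\<lambda>x::real^3. x) \<Otimes>\<^sub>M distr sphere_measure borel (\<lambda>x. x)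
    = distr (lborel \<Otimes>\<^sub>M sphere_measure) (borel \<Otimes>\<^sub>M borel) (\<lambda>(x, y). (x, y))"
  proof (rule pair_measure_distr)
    show "sigma_finite_measure (distr sphere_measure borel (\<lambda>x. x))"
      using sph.sigma_finite_measure_axioms unfolding sph_def .
  qed (auto simp: measurable_sphere_id)
  then show ?thesis unfolding l sph_def .
qed

lemma measurable_sphere_pair:
  "(\<lambda>(vs, \<sigma>). (vs, \<sigma>)) \<in> (lborel :: (real^3) measure) \<Otimes>\<^sub>M sphere_measure \<rightarrow>\<^sub>M borel \<Otimes>\<^sub>M borel"
proof -
  have "(\<lambda>x. (fst x, snd x)) \<in> (lborel :: (real^3) measure) \<Otimes>\<^sub>M sphere_measure \<rightarrow>\<^sub>M borel \<Otimes>\<^sub>M borel"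
    by (intro measurable_Pair measurable_compose[OF measurable_snd measurable_sphere_id] measurable_compose[OF measurable_fst]) simp
  then show ?thesis by (simp add: case_prod_beta')
qed

lemma lborel_sphere_transfer:
  fixes f :: "(real^3) \<times> (real^3) \<Rightarrow> real"
  assumes f: "f \<in> borel_measurable (borel \<Otimes>\<^sub>M borel)"
  shows "integrable (lborel \<Otimes>\<^sub>M sphere_measure) f \<longleftrightarrow> integrable (lborel \<Otimes>\<^sub>M sph) f"
    and "integral\<^sup>L (lborel \<Otimes>\<^sub>M sphere_measure) f = integral\<^sup>L (lborel \<Otimes>\<^sub>M sph) f"
  unfolding lborel_sph_eq_distr
  using integrable_distr_eq[OF measurable_sphere_pair f] integral_distr[OF measurable_sphere_pair f]
  by (simp_all add: case_prod_beta')

lemma AE_sph_inner_neq: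
  assumes z: "z \<noteq> 0"
  shows "AE \<sigma> in sph. sgn z \<bullet> \<sigma> \<noteq> t"
proof -
  have "(\<integral>\<^sup>+\<sigma>. indicator {t} (sgn z \<bullet> \<sigma>) \<partial>sph) = ennreal (2 * pi) * (\<integral>\<^sup>+u. indicator {t} u * indicator {-1<..<1} u \<partial>lborel)"
    by (rule nn_integral_sph_inner) (use z in \<open>auto simp: norm_sgn\<close>)
  also have "(\<integral>\<^sup>+u. indicator {t} u * indicator {-1<..<1} u \<partial>lborel) = (0 :: ennreal)"
  proof -
    have "(\<integral>\<^sup>+u. indicator {t} u * indicator {-1<..<1} u \<partial>lborel) \<le> (\<integral>\<^sup>+u. indicator {t} u \<partial>(lborel :: real measure))"
      by (intro nn_integral_mono) (auto simp: indicator_def)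
    then show ?thesis by simp
  qed
  finally have "(\<integral>\<^sup>+\<sigma>. indicator {t} (sgn z \<bullet> \<sigma>) \<partial>sph) = (0::ennreal)" by simp
  then show ?thesis by (subst (asm) nn_integral_0_iff_AE) (auto simp: indicator_def)
qed

text \<open>With \<open>\<theta> = arccos u\<close>, both \<open>\<theta>\<close> and \<open>sin \<theta> = sqrt (1 - u\<^sup>2)\<close> are at least \<open>sqrt (1 - u)\<close>.\<close>

lemma grazing_bound:
  fixes b :: "real \<Rightarrow> real"
  assumes c: "c > 0" and s: "0 < s"
    and upper: "\<And>\<theta>. 0 < \<theta> \<Longrightarrow> \<theta> \<le> pi / 2 \<Longrightarrow> sin \<theta> * b (cos \<theta>) \<le> 1 / (c * \<theta> powr (1 + 2 * s))"
    and u: "0 < u" "u < 1"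
  shows "b u \<le> 1 / c * (1 - u) powr (- 1 - s)"
proof -
  define \<theta> where "\<theta> = arccos u"
  have cos: "cos \<theta> = u" using u by (simp add: \<theta>_def)
  have \<theta>: "0 < \<theta>" "\<theta> \<le> pi / 2"
    using u arccos_less_arccos[of u 1] arccos_less_arccos[of 0 u] by (auto simp: \<theta>_def)
  define r where "r = sqrt (1 - u)"
  have r: "0 < r" using u by (simp add: r_def)
  have "u\<^sup>2 \<le> u" using u by (simp add: power2_eq_square mult_left_le)
  then have "r \<le> sqrt (1 - u\<^sup>2)" by (simp add: r_def)
  also have "\<dots> = sin \<theta>" using u by (simp add: \<theta>_def sin_arccos)
  finally have rs: "r \<le> sin \<theta>" .
  also have "sin \<theta> \<le> \<theta>" using \<theta> by (intro sin_x_le_x) auto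
  finally have r\<theta>: "r \<le> \<theta>" .
  have p: "r powr (1 + 2 * s) \<le> \<theta> powr (1 + 2 * s)" using r r\<theta> s by (intro powr_mono2) auto
  have "b u \<le> 1 / (c * \<theta> powr (1 + 2 * s)) / sin \<theta>"
    using upper[OF \<theta>] rs r unfolding cos by (subst pos_le_divide_eq) (auto simp: mult.commute)
  also have "\<dots> \<le> 1 / (c * r powr (1 + 2 * s)) / r"
    using p rs r c \<theta> by (intro frac_le mult_left_mono) auto
  also have "\<dots> = 1 / c * (1 / (r powr (1 + 2 * s) * r powr 1))" using r by simp
  also have "r powr (1 + 2 * s) * r powr 1 = (1 - u) powr (1 / 2 * (2 + 2 * s))"
    using u unfolding powr_add[symmetric] r_def by (simp add: powr_half_sqrt[symmetric] powr_powr)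
  also have "1 / 2 * (2 + 2 * s) = 1 + s" by simp
  also have "1 / (1 - u) powr (1 + s) = (1 - u) powr (- (1 + s))" by (rule powr_minus_divide[symmetric])
  also have "- (1 + s) = - 1 - s" by simp
  finally show ?thesis .
qed

theorem proposition1:
  fixes k \<gamma> s c\<^sub>b :: real and b :: "real \<Rightarrow> real" and m :: "real^3 \<Rightarrow> real"
    and B :: "real^3 \<Rightarrow> real^3 \<Rightarrow> real"
  assumes k: "k > 2"
    and m: "m = (\<lambda>v. jb v powr k)"
    and B: "B = collision_kernel \<gamma> b"
    and \<gamma>: "0 < \<gamma>" "\<gamma> < 1"
    and b_smooth: "\<And>n. (deriv ^^ n) b differentiable_on {0<..<1}"
    and b_support: "\<And>\<theta>. pi / 2 < \<theta> \<Longrightarrow> \<theta> \<le> pi \<Longrightarrow> b (cos \<theta>) = 0"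
    and c\<^sub>b: "c\<^sub>b > 0"
    and s: "0 < s" "s < 1/2"
    and b_lower: "\<And>\<theta>. 0 < \<theta> \<Longrightarrow> \<theta> \<le> pi / 2 \<Longrightarrow>
      c\<^sub>b / \<theta> powr (1 + 2 * s) \<le> sin \<theta> * b (cos \<theta>)"
    and b_upper: "\<And>\<theta>. 0 < \<theta> \<Longrightarrow> \<theta> \<le> pi / 2 \<Longrightarrow>
      sin \<theta> * b (cos \<theta>) \<le> 1 / (c\<^sub>b * \<theta> powr (1 + 2 * s))"
  shows "\<exists>C::real. C > 0 \<and>
    (\<forall>h \<in> borel_measurable lborel.
       L1_norm (\<lambda>v. jb v powr \<gamma> * m v) h * L1_norm m h
         + L1_norm (\<lambda>v. jb v powr (\<gamma> + 1)) h * W11_norm (\<lambda>v. jb v powr (\<gamma> + 1) * m v) h < \<infinity> \<longrightarrow>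
       (AE v in lborel. collision_integrable B h h v) \<and>
       L1_norm m (collision_Q B h h)
         \<le> ennreal C *
            (L1_norm (\<lambda>v. jb v powr \<gamma> * m v) h * L1_norm m h
              + L1_norm (\<lambda>v. jb v powr (\<gamma> + 1)) h * W11_norm (\<lambda>v. jb v powr (\<gamma> + 1) * m v) h))"
proof -
  define q where "q u = indicator {0<..<1} u * b u" for u
  have "b differentiable_on {0<..<1}" using b_smooth[of 0] by simp
  then have "continuous_on {0<..<1} b" by (rule differentiable_imp_continuous_on)
  then have "(\<lambda>u. indicator {0<..<1} u *\<^sub>R b u) \<in> borel_measurable borel"
    by (intro borel_measurable_continuous_on_indicator) auto
  then have q_meas [measurable]: "q \<in> borel_measurable borel" by (simp add: q_def[abs_def])
  have b_nonneg: "0 \<le> b u" if u: "0 < u" "u < 1" for u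
  proof -
    have \<theta>: "0 < arccos u" "arccos u \<le> pi / 2"
      using u arccos_less_arccos[of u 1] arccos_less_arccos[of 0 u] by auto
    have "0 \<le> c\<^sub>b / arccos u powr (1 + 2 * s)" using c\<^sub>b by simp
    also have "\<dots> \<le> sin (arccos u) * b u" using b_lower[OF \<theta>] u by simp
    finally have "0 \<le> sin (arccos u) * b u" .
    moreover have "0 < sin (arccos u)" using \<theta> by (intro sin_gt_zero) auto
    ultimately show ?thesis by (simp add: zero_le_mult_iff)
  qed
  interpret angular_kernel \<gamma> s "1 / c\<^sub>b" q
  proof
    fix u
    show "0 \<le> q u" using b_nonneg[of u] by (simp add: q_def indicator_def)
    show "\<not> (0 < u \<and> u < 1) \<Longrightarrow> q u = 0" by (auto simp: q_def)
    show "0 < u \<Longrightarrow> u < 1 \<Longrightarrow> q u \<le> 1 / c\<^sub>b * (1 - u) powr (- 1 - s)"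
      using grazing_bound[OF c\<^sub>b s(1) b_upper, of u] by (simp add: q_def)
  qed (use \<gamma> s c\<^sub>b in auto)

  \<comment> \<open>A Borel function that agrees with \<open>b\<close> on the whole range \<open>[-1, 1]\<close> of cosines. The values at \<open>0\<close> and \<open>1\<close> are met on a null set of directions only.\<close>
  define b0 where "b0 u = q u + indicator {0} u * b 0 + indicator {1} u * b 1" for u
  have [measurable]: "b0 \<in> borel_measurable borel" unfolding b0_def by measurable
  have b0: "b u = b0 u" if u: "-1 \<le> u" "u \<le> 1" for u
  proof (cases "u < 0")
    case True
    have "pi / 2 < arccos u" using arccos_less_arccos[of u 0] u True by simp
    moreover have "arccos u \<le> pi" using u by (intro arccos_ubound) auto
    ultimately have "b (cos (arccos u)) = 0" by (rule b_support)
    then show ?thesis using u True by (simp add: b0_def q_def indicator_def)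
  next
    case False
    then show ?thesis using u by (auto simp: b0_def q_def indicator_def)
  qed
  define B0 where "B0 z \<sigma> = norm z powr \<gamma> * b0 (sgn z \<bullet> \<sigma>)" for z \<sigma> :: "real^3"
  have B_B0: "B z \<sigma> = B0 z \<sigma>" if \<sigma>: "norm \<sigma> = 1" for z \<sigma>
  proof -
    have "\<bar>sgn z \<bullet> \<sigma>\<bar> \<le> norm (sgn z) * norm \<sigma>" by (rule Cauchy_Schwarz_ineq2)
    also have "\<dots> \<le> 1" using \<sigma> by (simp add: norm_sgn)
    finally have "b (sgn z \<bullet> \<sigma>) = b0 (sgn z \<bullet> \<sigma>)" by (intro b0) auto
    then show ?thesis by (simp add: B collision_kernel_def B0_def)
  qed
  have kern_B0: "AE x in lborel \<Otimes>\<^sub>M sph. case x of (vs, \<sigma>) \<Rightarrow> B0 (v - vs) \<sigma> = kern (v - vs) \<sigma>" for v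
  proof (rule lborel_sph.AE_pair_measure)
    show "{x \<in> space (lborel \<Otimes>\<^sub>M sph). case x of (vs, \<sigma>) \<Rightarrow> B0 (v - vs) \<sigma> = kern (v - vs) \<sigma>} \<in> sets (lborel \<Otimes>\<^sub>M sph)"
    proof -
      have f: "(\<lambda>x. B0 (v - fst x) (snd x)) \<in> borel_measurable (lborel \<Otimes>\<^sub>M sph)"
        unfolding B0_def by measurable
      have g: "(\<lambda>x. kern (v - fst x) (snd x)) \<in> borel_measurable (lborel \<Otimes>\<^sub>M sph)"
        by measurable
      show ?thesis using borel_measurable_eq[OF f g] by (simp add: case_prod_beta')
    qed
    show "AE vs in lborel. AE \<sigma> in sph. case (vs, \<sigma>) of (vs, \<sigma>) \<Rightarrow> B0 (v - vs) \<sigma> = kern (v - vs) \<sigma>"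
      using AE_lborel_singleton[of v]
    proof eventually_elim
      case (elim vs)
      then have "v - vs \<noteq> 0" by simp
      from AE_sph_inner_neq[OF this, of 0] AE_sph_inner_neq[OF this, of 1] show ?case
        by eventually_elim (simp add: B0_def b0_def kern_def)
    qed
  qed
  have transfer: "collision_integrable B h h v \<longleftrightarrow> integrable (lborel \<Otimes>\<^sub>M sph) (collision_integrand kern h h v)"
    "collision_Q B h h v = (\<integral>x. collision_integrand kern h h v x \<partial>(lborel \<Otimes>\<^sub>M sph))"
    if [measurable]: "h \<in> borel_measurable borel" for h v
  proof -
    have m0: "collision_integrand B0 h h v \<in> borel_measurable (borel \<Otimes>\<^sub>M borel)"
      unfolding collision_integrand_def B0_def by measurable
    have m1: "collision_integrand kern h h v \<in> borel_measurable (borel \<Otimes>\<^sub>M borel)"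
      unfolding collision_integrand_def kern_def by measurable
    have m: "collision_integrand B0 h h v \<in> borel_measurable (lborel \<Otimes>\<^sub>M sph)"
      "collision_integrand kern h h v \<in> borel_measurable (lborel \<Otimes>\<^sub>M sph)"
      using m0 m1 by (simp_all cong: measurable_cong_sets)
    have sp: "collision_integrand B h h v x = collision_integrand B0 h h v x" if "x \<in> space (lborel \<Otimes>\<^sub>M sphere_measure)" for x
      using that by (auto simp: collision_integrand_def space_pair_measure space_sphere_measure B_B0)
    have ae: "AE x in lborel \<Otimes>\<^sub>M sph. collision_integrand B0 h h v x = collision_integrand kern h h v x"
      using kern_B0[of v] by eventually_elim (auto simp: collision_integrand_def)
    have "collision_integrable B h h v \<longleftrightarrow> integrable (lborel \<Otimes>\<^sub>M sphere_measure) (collision_integrand B0 h h v)"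
      unfolding collision_integrable_def by (rule Bochner_Integration.integrable_cong[OF refl sp])
    also have "\<dots> \<longleftrightarrow> integrable (lborel \<Otimes>\<^sub>M sph) (collision_integrand B0 h h v)" by (rule lborel_sphere_transfer(1)[OF m0])
    also have "\<dots> \<longleftrightarrow> integrable (lborel \<Otimes>\<^sub>M sph) (collision_integrand kern h h v)"
      by (rule integrable_cong_AE[OF m ae])
    finally show "collision_integrable B h h v \<longleftrightarrow> integrable (lborel \<Otimes>\<^sub>M sph) (collision_integrand kern h h v)" .
    have "collision_Q B h h v = integral\<^sup>L (lborel \<Otimes>\<^sub>M sphere_measure) (collision_integrand B0 h h v)"
      unfolding collision_Q_def by (rule Bochner_Integration.integral_cong[OF refl sp])
    also have "\<dots> = integral\<^sup>L (lborel \<Otimes>\<^sub>M sph) (collision_integrand B0 h h v)" by (rule lborel_sphere_transfer(2)[OF m0])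
    also have "\<dots> = (\<integral>x. collision_integrand kern h h v x \<partial>(lborel \<Otimes>\<^sub>M sph))"
      by (rule integral_cong_AE[OF m ae])
    finally show "collision_Q B h h v = (\<integral>x. collision_integrand kern h h v x \<partial>(lborel \<Otimes>\<^sub>M sph))" .
  qed
  have norms: "L1_norm (\<lambda>v. jb v powr \<gamma> * m v) f = weighted_L1 (\<gamma> + k) f" "L1_norm m f = weighted_L1 k f"
    "L1_norm (\<lambda>v. jb v powr (\<gamma> + 1)) f = weighted_L1 (\<gamma> + 1) f"
    "L1_norm (\<lambda>v. jb v powr (\<gamma> + 1) * m v) f = weighted_L1 (\<gamma> + 1 + k) f" for f
    by (simp_all add: L1_norm_def weighted_L1_def m powr_add[of _ \<gamma> k] powr_add[of _ "\<gamma> + 1" k] abs_mult mult_ac)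
  define C where "C = max 1 (collision_const k)"
  have C: "ennreal (collision_const k) \<le> ennreal C" by (rule ennreal_leI) (simp add: C_def)
  have estimate: "(AE v in lborel. collision_integrable B h h v) \<and>
      weighted_L1 k (collision_Q B h h) \<le> ennreal C * (weighted_L1 (\<gamma> + k) h * weighted_L1 k h
        + weighted_L1 (\<gamma> + 1) h * (weighted_L1 (\<gamma> + 1 + k) h + (\<Sum>i\<in>UNIV. weighted_L1 (\<gamma> + 1 + k) (g i))))"
    if h: "h \<in> borel_measurable borel" and g: "\<And>i. is_weak_partial i h (g i)"
      and fin: "weighted_L1 (\<gamma> + 1 + k) h < \<infinity>" "\<And>i. weighted_L1 (\<gamma> + 1 + k) (g i) < \<infinity>" for h g
  proof -
    have k1: "1 \<le> k" using k by simp
    note est = collision_estimate[OF k1 g fin]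
    have Q: "collision_Q B h h = (\<lambda>v. \<integral>x. collision_integrand kern h h v x \<partial>(lborel \<Otimes>\<^sub>M sph))"
      using transfer(2)[OF h] by auto
    show ?thesis unfolding transfer(1)[OF h] Q
      using est(1) order_trans[OF est(2) mult_right_mono[OF C]] by simp
  qed
  have "(AE v in lborel. collision_integrable B h h v) \<and>
       L1_norm m (collision_Q B h h)
         \<le> ennreal C *
            (L1_norm (\<lambda>v. jb v powr \<gamma> * m v) h * L1_norm m h
              + L1_norm (\<lambda>v. jb v powr (\<gamma> + 1)) h * W11_norm (\<lambda>v. jb v powr (\<gamma> + 1) * m v) h)"
    if h': "h \<in> borel_measurable lborel"
      and fin: "L1_norm (\<lambda>v. jb v powr \<gamma> * m v) h * L1_norm m h
         + L1_norm (\<lambda>v. jb v powr (\<gamma> + 1)) h * W11_norm (\<lambda>v. jb v powr (\<gamma> + 1) * m v) h < \<infinity>" for h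
  proof -
    have h [measurable]: "h \<in> borel_measurable borel" using h' by simp
    show ?thesis
    proof (cases "W11_norm (\<lambda>v. jb v powr (\<gamma> + 1) * m v) h = \<infinity>")
      case False
      then have ex: "\<forall>i. \<exists>g. is_weak_partial i h g" by (auto simp: W11_norm_def split: if_splits)
      have g: "is_weak_partial i h (weak_partial i h)" for i
        using someI_ex[OF ex[rule_format, of i]] unfolding weak_partial_def .
      have W: "W11_norm (\<lambda>v. jb v powr (\<gamma> + 1) * m v) h
          = weighted_L1 (\<gamma> + 1 + k) h + (\<Sum>i\<in>UNIV. weighted_L1 (\<gamma> + 1 + k) (weak_partial i h))"
        using ex by (simp add: W11_norm_def norms)
      have "weighted_L1 (\<gamma> + 1 + k) h < \<infinity>" "weighted_L1 (\<gamma> + 1 + k) (weak_partial i h) < \<infinity>" for i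
        using False unfolding W by (auto simp: less_top)
      then show ?thesis unfolding norms W by (intro estimate[OF h g])
    next
      case True
      \<comment> \<open>The right-hand side is finite only because \<open>0 * \<infinity> = 0\<close>: then \<open>h\<close> vanishes almost everywhere, and zero is a weak gradient of \<open>h\<close>.\<close>
      have "weighted_L1 (\<gamma> + 1) h = 0"
      proof (rule ccontr)
        assume "weighted_L1 (\<gamma> + 1) h \<noteq> 0"
        then have "weighted_L1 (\<gamma> + 1) h * \<infinity> = \<infinity>" by (simp add: ennreal_mult_top)
        then show False using fin unfolding norms True by simp
      qed
      then have h0: "AE x in lborel. h x = 0"
        unfolding weighted_L1_def
        by (subst (asm) nn_integral_0_iff_AE) (use jb_pos in \<open>auto simp: less_imp_neq[symmetric] mult_le_0_iff not_le elim!: eventually_mono\<close>)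
      have zero: "weighted_L1 a h = 0" for a
        unfolding weighted_L1_def by (subst nn_integral_0_iff_AE) (use h0 in auto)
      have loc: "locally_integrable h" "locally_integrable (\<lambda>x. 0)"
      proof -
        have "integrable lborel h" by (rule integrable_cong_AE_imp[of _ "\<lambda>x. 0"]) (use h0 in auto)
        then have "set_integrable lborel S h" if "S \<in> sets borel" for S
          unfolding set_integrable_def using that by (intro integrable_mult_indicator) auto
        then show "locally_integrable h" by (auto simp: locally_integrable_def dest: borel_compact)
      qed (simp add: locally_integrable_def set_integrable_def)
      have g: "is_weak_partial i h (\<lambda>x. 0)" for i
      proof -
        have "(\<integral>x. h x * partial_deriv i \<phi> x \<partial>lborel) = 0" for \<phi>
          by (rule integral_eq_zero_AE) (use h0 in auto)
        then show ?thesis using loc by (simp add: is_weak_partial_def)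
      qed
      have "(AE v in lborel. collision_integrable B h h v) \<and>
        weighted_L1 k (collision_Q B h h) \<le> ennreal C * (weighted_L1 (\<gamma> + k) h * weighted_L1 k h
        + weighted_L1 (\<gamma> + 1) h * (weighted_L1 (\<gamma> + 1 + k) h + (\<Sum>i\<in>(UNIV :: 3 set). weighted_L1 (\<gamma> + 1 + k) (\<lambda>x. 0))))"
        by (rule estimate[OF h g]) (simp_all add: zero, simp add: weighted_L1_def)
      then show ?thesis unfolding norms zero by simp
    qed
  qed
  then show ?thesis by (intro exI[of _ C]) (simp add: C_def)
qed

end
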